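(* Let $T>0$ and $\varepsilon,\sigma>0$. Let $v_n\rightharpoonup v$ weakly in $L^2(0,T;H^1(\mathbb T))$, and let $(E_{0,n},b_{0,n})\to(E_0,b_0)$ strongly in $L^2(\mathbb T)^2$. For each $n$, let $(E_n,b_n)$ be the energy solution of $$\varepsilon E_{n,t}-b_{n,x}=-\sigma(E_n+v_nb_n),\qquad b_{n,t}-E_{n,x}=0$$ on $(0,T)\times\mathbb T$ with initial datum $(E_{0,n},b_{0,n})$. Let $(E,b)$ be the unique energy solution of the same system with coefficient $v$ in place of $v_n$ and initial datum $(E_0,b_0)$. Then the entire sequence satisfies $$(E_n,b_n)\to(E,b)\quad\text{in }C([0,T];L^2(\mathbb T)^2).$$ Moreover, with $j_n=\sigma(E_n+v_nb_n)$ and $j=\sigma(E+vb)$, $$j_n\rightharpoonup j\quad\text{weakly in }L^2((0,T)\times\mathbb T),\qquad j_nb_n\to jb\quad\text{in }\mathcal D'((0,T)\times\mathbb T).$$ Thus the Maxwell--Ohm solution map is weak-to-strong continuous with respect to its velocity coefficient.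
   Context: $\mathbb T=\mathbb R/\mathbb Z$ with $|\mathbb T|=1$; all functions are real-valued. Energy solution: given $v\in L^2(0,T;H^1(\mathbb T))$ and $X_0=(E_0,b_0)\in L^2(\mathbb T)^2$, the energy solution of $\varepsilon E_t-b_x=-\sigma(E+vb)$, $b_t-E_x=0$, $(E,b)|_{t=0}=X_0$ is the mild solution, i.e. the function $X=(E,b)\in C([0,T];L^2(\mathbb T)^2)$ satisfying $$X(t)=S(t)X_0+\int_0^tS(t-s)\mathcal B_{v(s)}X(s)\,ds,\qquad t\in[0,T],$$ where $S(t)$ is the $C_0$-semigroup on $L^2(\mathbb T)^2$ generated by $A_\sigma(E,b)=(\varepsilon^{-1}(b_x-\sigma E),\,E_x)$ with domain $D(A_\sigma)=H^1(\mathbb T)^2$, and $\mathcal B_f(E,b)=(-\sigma\varepsilon^{-1}fb,\,0)$ for $f\in L^\infty(\mathbb T)$ (recall $H^1(\mathbb T)\hookrightarrow L^\infty(\mathbb T)$). Such a solution exists and is unique. *)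

theory Defs
  imports "HOL-Analysis.Analysis"
begin

text \<open>For second countable targets Borel measurability is strong measurability, so this is
  membership of (the class of) \<open>f\<close> in the Lebesgue--Bochner space \<open>L\<^sup>2(M; 'b)\<close>.\<close>
definition square_integrable ::
  "'a measure \<Rightarrow> ('a \<Rightarrow> 'b::{real_normed_vector, second_countable_topology}) \<Rightarrow> bool" where
  "square_integrable M f \<longleftrightarrow> f \<in> borel_measurable M \<and> integrable M (\<lambda>x. (norm (f x))\<^sup>2)"

text \<open>\<open>\<real>/\<int>\<close> with its normalised measure, realised on the fundamental domain \<open>[0,1)\<close>. Periodicity
  enters only through the test functions below.\<close>
definition circle :: "real measure" where
  "circle = restrict_space lborel {0..<1}"

lemma space_circle [simp]: "space circle = {0..<1}"
  by (simp add: circle_def space_restrict_space)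

lemma emeasure_circle [simp]: "emeasure circle {0..<1} = 1"
  by (simp add: circle_def emeasure_restrict_space)

lemma finite_measure_circle [simp]: "finite_measure circle"
  by (rule finite_measureI) (simp add: circle_def emeasure_restrict_space space_restrict_space)

lemma square_integrable_measurable [measurable_dest]:
  "square_integrable M f \<Longrightarrow> f \<in> borel_measurable M"
  by (simp add: square_integrable_def)

lemma square_integrable_mult:
  fixes f g :: "'a \<Rightarrow> real"
  assumes "square_integrable M f" "square_integrable M g"
  shows "integrable M (\<lambda>x. f x * g x)"
proof (rule Bochner_Integration.integrable_bound)
  show "integrable M (\<lambda>x. (norm (f x))\<^sup>2 + (norm (g x))\<^sup>2)"
    using assms by (simp add: square_integrable_def)
  show "(\<lambda>x. f x * g x) \<in> borel_measurable M"
    using assms by (intro borel_measurable_times) (simp_all add: square_integrable_def)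
  have "\<bar>a * b\<bar> \<le> a\<^sup>2 + b\<^sup>2" for a b :: real
  proof -
    have "2 * (\<bar>a\<bar> * \<bar>b\<bar>) \<le> a\<^sup>2 + b\<^sup>2"
      using zero_le_power2[of "\<bar>a\<bar> - \<bar>b\<bar>"] by (simp add: power2_diff)
    moreover have "0 \<le> \<bar>a\<bar> * \<bar>b\<bar>" by simp
    ultimately show ?thesis unfolding abs_mult by linarith
  qed
  then show "AE x in M. norm (f x * g x) \<le> norm ((norm (f x))\<^sup>2 + (norm (g x))\<^sup>2)"
    by (auto simp: abs_of_nonneg)
qed

lemma square_integrable_add:
  fixes f g :: "'a \<Rightarrow> real"
  assumes "square_integrable M f" "square_integrable M g"
  shows "square_integrable M (\<lambda>x. f x + g x)"
proof -
  have "(\<lambda>x. (norm (f x + g x))\<^sup>2) = (\<lambda>x. (norm (f x))\<^sup>2 + (norm (g x))\<^sup>2 + 2 * (f x * g x))"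
    by (auto simp: power2_sum)
  with assms square_integrable_mult[OF assms] show ?thesis
    by (auto simp: square_integrable_def)
qed

lemma square_integrable_scaleR:
  fixes f :: "'a \<Rightarrow> real"
  assumes "square_integrable M f"
  shows "square_integrable M (\<lambda>x. c * f x)"
  using assms by (auto simp: square_integrable_def power_mult_distrib)

lemma square_integrable_diff:
  fixes f g :: "'a \<Rightarrow> real"
  assumes "square_integrable M f" "square_integrable M g"
  shows "square_integrable M (\<lambda>x. f x - g x)"
  using square_integrable_add[OF assms(1) square_integrable_scaleR[OF assms(2), of "-1"]] by simp

lemma square_integrable_indicator_circle:
  assumes "A \<in> sets borel"
  shows "square_integrable circle (indicator A :: real \<Rightarrow> real)"
proof -
  interpret finite_measure circle by simp
  have [measurable]: "(indicator A :: real \<Rightarrow> real) \<in> borel_measurable circle"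
    unfolding circle_def using assms by (intro measurable_restrict_space1) auto
  have "integrable circle (\<lambda>x. (norm (indicator A x :: real))\<^sup>2)"
    by (rule integrable_const_bound[where B=1]) (simp, simp add: indicator_def, measurable)
  then show ?thesis by (simp add: square_integrable_def)
qed

text \<open>The Hilbert space \<open>L\<^sup>2(\<real>/\<int>)\<close> of almost-everywhere classes.\<close>
quotient_type L2T = "real \<Rightarrow> real" / partial:
  "\<lambda>f g. square_integrable circle f \<and> square_integrable circle g \<and> (AE x in circle. f x = g x)"
proof (rule part_equivpI)
  show "\<exists>f. square_integrable circle f \<and> square_integrable circle f \<and> (AE x in circle. f x = f x)" for f :: "real \<Rightarrow> real"
    by (intro exI[of _ "\<lambda>_. 0"]) (auto simp: square_integrable_def)
qed (auto intro!: sympI transpI elim: AE_mp)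

instantiation L2T :: real_inner
begin

lift_definition zero_L2T :: L2T is "\<lambda>_. 0"
  by (auto simp: square_integrable_def)

lift_definition plus_L2T :: "L2T \<Rightarrow> L2T \<Rightarrow> L2T" is "\<lambda>f g x. f x + g x"
  by (auto intro: square_integrable_add)

lift_definition minus_L2T :: "L2T \<Rightarrow> L2T \<Rightarrow> L2T" is "\<lambda>f g x. f x - g x"
  by (auto intro: square_integrable_diff)

lift_definition uminus_L2T :: "L2T \<Rightarrow> L2T" is "\<lambda>f x. - f x"
  using square_integrable_scaleR[of _ _ "-1"] by (auto)

lift_definition scaleR_L2T :: "real \<Rightarrow> L2T \<Rightarrow> L2T" is "\<lambda>c f x. c * f x"
  by (auto intro: square_integrable_scaleR)

lift_definition inner_L2T :: "L2T \<Rightarrow> L2T \<Rightarrow> real" is "\<lambda>f g. \<integral>x. f x * g x \<partial>circle"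
  by (rule integral_cong_AE) (auto simp: square_integrable_def)

definition norm_L2T :: "L2T \<Rightarrow> real" where
  "norm_L2T f = sqrt (inner f f)"

definition sgn_L2T :: "L2T \<Rightarrow> L2T" where
  "sgn_L2T f = scaleR (inverse (norm f)) f"

definition dist_L2T :: "L2T \<Rightarrow> L2T \<Rightarrow> real" where
  "dist_L2T f g = norm (f - g)"

definition uniformity_L2T :: "(L2T \<times> L2T) filter" where
  "uniformity_L2T = (INF e\<in>{0 <..}. principal {(x, y). dist x y < e})"

definition open_L2T :: "L2T set \<Rightarrow> bool" where
  "open_L2T U = (\<forall>x\<in>U. \<forall>\<^sub>F (x', y) in uniformity. x' = x \<longrightarrow> y \<in> U)"

instance
proof
  fix x y z :: L2T and a b :: real
  show "x + y + z = x + (y + z)"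
    by transfer (auto simp: add.assoc intro!: square_integrable_add)
  show "x + y = y + x"
    by transfer (auto simp: add.commute intro!: square_integrable_add)
  show "0 + x = x" by transfer auto
  show "- x + x = 0"
    by transfer (auto simp: square_integrable_def)
  show "x - y = x + - y"
    by transfer (auto intro: square_integrable_diff)
  show "a *\<^sub>R (x + y) = a *\<^sub>R x + a *\<^sub>R y"
    by transfer (auto simp: algebra_simps intro: square_integrable_add square_integrable_scaleR)
  show "(a + b) *\<^sub>R x = a *\<^sub>R x + b *\<^sub>R x"
    by transfer (auto simp: algebra_simps intro: square_integrable_add square_integrable_scaleR)
  show "a *\<^sub>R b *\<^sub>R x = (a * b) *\<^sub>R x"
    by transfer (auto simp: algebra_simps intro: square_integrable_add square_integrable_scaleR)
  show "1 *\<^sub>R x = x" by transfer auto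
  show "sgn x = scaleR (inverse (norm x)) x" by (rule sgn_L2T_def)
  show "dist x y = norm (x - y)" by (rule dist_L2T_def)
  show "inner x y = inner y x"
    by transfer (simp add: mult.commute)
  show "inner (x + y) z = inner x z + inner y z"
    by transfer (simp add: algebra_simps square_integrable_mult)
  show "inner (a *\<^sub>R x) y = a * inner x y"
    by transfer (simp add: algebra_simps)
  show "0 \<le> inner x x"
    by transfer simp
  show "inner x x = 0 \<longleftrightarrow> x = 0"
  proof transfer
    fix f :: "real \<Rightarrow> real"
    assume "square_integrable circle f \<and> square_integrable circle f \<and> (AE x in circle. f x = f x)"
    then have f: "square_integrable circle f" by simp
    have "(\<integral>x. f x * f x \<partial>circle) = 0 \<longleftrightarrow> (AE x in circle. f x * f x = 0)"
      using f square_integrable_mult[OF f f] by (intro integral_nonneg_eq_0_iff_AE) auto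
    then show "(\<integral>x. f x * f x \<partial>circle) = 0 \<longleftrightarrow>
      (square_integrable circle f \<and> square_integrable circle (\<lambda>_. 0 :: real) \<and> (AE x in circle. f x = 0))"
      using f by (auto simp: square_integrable_def)
  qed
  show "norm x = sqrt (inner x x)" by (rule norm_L2T_def)
qed (rule uniformity_L2T_def open_L2T_def)+

end


text \<open>Completeness and separability make the Bochner integral of the library available on
  \<^typ>\<open>L2T\<close>.\<close>

text \<open>The class of a function; the value \<open>0\<close> off \<open>L\<^sup>2\<close> is a dummy.\<close>
definition to_L2T :: "(real \<Rightarrow> real) \<Rightarrow> L2T" where
  "to_L2T f = (if square_integrable circle f then abs_L2T f else 0)"

lemma square_integrable_rep [simp]: "square_integrable circle (rep_L2T f)"
  using Quotient3_rep_reflp[OF Quotient3_L2T, of f] by simp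

lemma rep_L2T_measurable [measurable, simp]: "rep_L2T f \<in> borel_measurable circle"
  using square_integrable_rep[of f] by (simp only: square_integrable_def)

lemma to_L2T_rep [simp]: "to_L2T (rep_L2T f) = f"
  by (simp add: to_L2T_def Quotient3_abs_rep[OF Quotient3_L2T])

lemma rep_to_L2T: "square_integrable circle f \<Longrightarrow> AE x in circle. rep_L2T (to_L2T f) x = f x"
  using Quotient3_rep_abs[OF Quotient3_L2T, of f] by (simp add: to_L2T_def)

lemma to_L2T_cong:
  "\<lbrakk>square_integrable circle f; square_integrable circle g; AE x in circle. f x = g x\<rbrakk> \<Longrightarrow> to_L2T f = to_L2T g"
  using Quotient3_rel[OF Quotient3_L2T, of f g] by (simp add: to_L2T_def)

lemma to_L2T_add:
  "\<lbrakk>square_integrable circle f; square_integrable circle g\<rbrakk>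
    \<Longrightarrow> to_L2T (\<lambda>x. f x + g x) = to_L2T f + to_L2T g"
  by (simp add: to_L2T_def square_integrable_add plus_L2T.abs_eq)

lemma to_L2T_diff:
  "\<lbrakk>square_integrable circle f; square_integrable circle g\<rbrakk>
    \<Longrightarrow> to_L2T (\<lambda>x. f x - g x) = to_L2T f - to_L2T g"
  by (simp add: to_L2T_def square_integrable_diff minus_L2T.abs_eq)

lemma to_L2T_scaleR:
  "square_integrable circle f \<Longrightarrow> to_L2T (\<lambda>x. c * f x) = c *\<^sub>R to_L2T f"
  by (simp add: to_L2T_def square_integrable_scaleR scaleR_L2T.abs_eq)

lemma to_L2T_zero: "to_L2T (\<lambda>_. 0) = 0"
  by (simp add: to_L2T_def zero_L2T_def)

lemma inner_to_L2T:
  "\<lbrakk>square_integrable circle f; square_integrable circle g\<rbrakk>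
    \<Longrightarrow> inner (to_L2T f) (to_L2T g) = (\<integral>x. f x * g x \<partial>circle)"
  by (simp add: to_L2T_def inner_L2T.abs_eq)

lemma norm_to_L2T:
  "square_integrable circle f \<Longrightarrow> (norm (to_L2T f))\<^sup>2 = (\<integral>x. (f x)\<^sup>2 \<partial>circle)"
  unfolding power2_norm_eq_inner by (simp add: inner_to_L2T power2_eq_square)

lemma nn_norm_to_L2T:
  "square_integrable circle f \<Longrightarrow> (\<integral>\<^sup>+x. ennreal ((f x)\<^sup>2) \<partial>circle) = ennreal ((norm (to_L2T f))\<^sup>2)"
  by (subst nn_integral_eq_integral) (auto simp: norm_to_L2T square_integrable_def)

lemma square_integrable_nn:
  fixes f :: "'a \<Rightarrow> real"
  assumes "f \<in> borel_measurable M" "(\<integral>\<^sup>+x. ennreal ((f x)\<^sup>2) \<partial>M) < \<infinity>"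
  shows "square_integrable M f"
  using assms by (auto simp: square_integrable_def integrable_iff_bounded)

instance L2T :: complete_space
proof
  fix X :: "nat \<Rightarrow> L2T" assume X: "Cauchy X"
  interpret finite_measure circle by simp
  have "\<forall>k. \<exists>N. \<forall>m\<ge>N. \<forall>n\<ge>N. dist (X m) (X n) < (1/2)^k"
    using X unfolding Cauchy_def by (metis zero_less_divide_1_iff zero_less_numeral zero_less_power)
  then obtain N where N: "\<And>k m n. m \<ge> N k \<Longrightarrow> n \<ge> N k \<Longrightarrow> dist (X m) (X n) < (1/2)^k"
    by metis
  define r where "r = rec_nat (N 0) (\<lambda>k rk. Suc (max rk (N (Suc k))))"
  have r: "strict_mono r"
    by (rule strict_mono_Suc_iff[THEN iffD2]) (simp add: r_def less_Suc_eq_le)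
  have rN: "r k \<ge> N k" for k
    by (cases k) (simp_all add: r_def)
  define f where "f k = rep_L2T (X (r k))" for k
  have f [simp]: "square_integrable circle (f k)" for k
    by (simp add: f_def)
  have [measurable]: "f k \<in> borel_measurable circle" for k
    by (simp add: f_def)
  have f': "to_L2T (f k) = X (r k)" for k
    by (simp add: f_def)
  have d: "(\<integral>\<^sup>+x. ennreal ((f m x - f k x)\<^sup>2) \<partial>circle) \<le> ennreal (((1/2)^k)\<^sup>2)" if "m \<ge> k" for m k
  proof -
    have "norm (X (r m) - X (r k)) \<le> (1/2)^k"
      using N[of k "r m" "r k"] rN[of k] strict_mono_mono[OF r, THEN monoD, OF that]
      by (simp add: dist_norm)
    then show ?thesis
      by (simp add: nn_norm_to_L2T square_integrable_diff to_L2T_diff f' ennreal_leI power_mono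
          del: power_divide)
  qed
  have "(\<integral>\<^sup>+x. ennreal \<bar>f (Suc k) x - f k x\<bar> \<partial>circle) \<le> ennreal (2 * (1/2)^k)" for k
  proof -
    have "\<bar>a\<bar> \<le> 2^k * a\<^sup>2 + (1/2)^k" for a :: real
    proof -
      have "0 \<le> (2^k * \<bar>a\<bar> - 1)\<^sup>2" by simp
      then have "2 * 2^k * \<bar>a\<bar> \<le> 2^k * 2^k * a\<^sup>2 + 1"
        by (simp add: power2_eq_square algebra_simps)
      then have "2 * \<bar>a\<bar> \<le> 2^k * a\<^sup>2 + (1/2)^k"
        by (simp add: field_simps)
      then show ?thesis by simp
    qed
    then have "(\<integral>\<^sup>+x. ennreal \<bar>f (Suc k) x - f k x\<bar> \<partial>circle) \<le>
       (\<integral>\<^sup>+x. ennreal (2^k) * ennreal ((f (Suc k) x - f k x)\<^sup>2) + ennreal ((1/2)^k) \<partial>circle)"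
      by (intro nn_integral_mono) (simp add: ennreal_mult[symmetric] ennreal_plus[symmetric] ennreal_leI
          del: ennreal_plus)
    also have "\<dots> = ennreal (2^k) * (\<integral>\<^sup>+x. ennreal ((f (Suc k) x - f k x)\<^sup>2) \<partial>circle) + ennreal ((1/2)^k)"
      by (subst nn_integral_add) (auto simp: nn_integral_cmult)
    also have "\<dots> \<le> ennreal (2^k) * ennreal (((1/2)^k)\<^sup>2) + ennreal ((1/2)^k)"
      by (intro add_mono mult_left_mono d) auto
    also have "\<dots> = ennreal (2 * (1/2)^k)"
      by (simp add: ennreal_mult[symmetric] ennreal_plus[symmetric] power2_eq_square power_mult_distrib[symmetric]
            field_simps del: ennreal_plus)
    finally show ?thesis .
  qed
  then have "(\<Sum>k. \<integral>\<^sup>+x. ennreal \<bar>f (Suc k) x - f k x\<bar> \<partial>circle) \<le> (\<Sum>k. ennreal (2 * (1/2)^k))"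
    by (intro suminf_le) auto
  also have "\<dots> < \<infinity>"
    by (subst suminf_ennreal2) (auto intro!: summable_mult summable_geometric)
  finally have "(\<integral>\<^sup>+x. (\<Sum>k. ennreal \<bar>f (Suc k) x - f k x\<bar>) \<partial>circle) \<noteq> \<infinity>"
    by (subst nn_integral_suminf) auto
  then have "AE x in circle. (\<Sum>k. ennreal \<bar>f (Suc k) x - f k x\<bar>) \<noteq> \<infinity>"
    by (intro nn_integral_noteq_infinite) auto
  then have ae: "AE x in circle. (\<lambda>k. f k x) \<longlonglongrightarrow> lim (\<lambda>k. f k x)"
  proof eventually_elim
    fix x assume "(\<Sum>k. ennreal \<bar>f (Suc k) x - f k x\<bar>) \<noteq> \<infinity>"
    then have "summable (\<lambda>k. \<bar>f (Suc k) x - f k x\<bar>)"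
      by (intro summable_suminf_not_top) auto
    then have "summable (\<lambda>k. f (Suc k) x - f k x)"
      by (rule summable_rabs_cancel)
    then have "convergent (\<lambda>n. \<Sum>k<n. f (Suc k) x - f k x)"
      by (simp only: summable_iff_convergent)
    then have "convergent (\<lambda>n. f n x - f 0 x)"
      by (simp only: sum_lessThan_telescope[of "\<lambda>k. f k x"])
    from convergent_add[OF this convergent_const[of "f 0 x"]] have "convergent (\<lambda>k. f k x)"
      by simp
    then show "(\<lambda>k. f k x) \<longlonglongrightarrow> lim (\<lambda>k. f k x)"
      by (simp add: convergent_LIMSEQ_iff)
  qed
  define g where "g x = lim (\<lambda>k. f k x)" for x
  have [measurable]: "g \<in> borel_measurable circle"
    unfolding g_def by measurable
  have gd: "(\<integral>\<^sup>+x. ennreal ((g x - f k x)\<^sup>2) \<partial>circle) \<le> ennreal (((1/2)^k)\<^sup>2)" for k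
  proof -
    have "(\<integral>\<^sup>+x. ennreal ((g x - f k x)\<^sup>2) \<partial>circle) = (\<integral>\<^sup>+x. liminf (\<lambda>m. ennreal ((f m x - f k x)\<^sup>2)) \<partial>circle)"
      using ae
    proof (intro nn_integral_cong_AE, eventually_elim)
      fix x assume "(\<lambda>k. f k x) \<longlonglongrightarrow> lim (\<lambda>k. f k x)"
      then have "(\<lambda>m. ennreal ((f m x - f k x)\<^sup>2)) \<longlonglongrightarrow> ennreal ((g x - f k x)\<^sup>2)"
        unfolding g_def by (intro tendsto_intros)
      then show "ennreal ((g x - f k x)\<^sup>2) = liminf (\<lambda>m. ennreal ((f m x - f k x)\<^sup>2))"
        by (intro lim_imp_Liminf[symmetric]) auto
    qed
    also have "\<dots> \<le> liminf (\<lambda>m. \<integral>\<^sup>+x. ennreal ((f m x - f k x)\<^sup>2) \<partial>circle)"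
      by (rule nn_integral_liminf) auto
    also have "\<dots> \<le> ennreal (((1/2)^k)\<^sup>2)"
      by (rule Liminf_le) (auto simp: eventually_sequentially intro!: exI[of _ k] d)
    finally show ?thesis .
  qed
  have gf: "square_integrable circle (\<lambda>x. g x - f k x)" for k
    using gd[of k] by (intro square_integrable_nn) (auto simp: less_top[symmetric] top_unique)
  from square_integrable_add[OF gf[of 0] f[of 0]] have g: "square_integrable circle g"
    by simp
  have "norm ((X \<circ> r) k - to_L2T g) \<le> (1/2)^k" for k
  proof -
    have "ennreal ((norm (to_L2T g - X (r k)))\<^sup>2) \<le> ennreal (((1/2)^k)\<^sup>2)"
      using gd[of k] by (simp add: nn_norm_to_L2T[OF gf] to_L2T_diff g f')
    then have "(norm (to_L2T g - X (r k)))\<^sup>2 \<le> ((1/2)^k)\<^sup>2"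
      by (subst (asm) ennreal_le_iff) auto
    then have "norm (to_L2T g - X (r k)) \<le> (1/2)^k"
      by (rule power2_le_imp_le) simp
    then show ?thesis by (simp add: norm_minus_commute)
  qed
  then have "(\<lambda>k. (X \<circ> r) k - to_L2T g) \<longlonglongrightarrow> 0"
    by (rule Lim_null_comparison[OF always_eventually[OF allI]]) (simp add: LIMSEQ_realpow_zero)
  then have "(X \<circ> r) \<longlonglongrightarrow> to_L2T g"
    by (rule LIM_zero_cancel)
  then show "convergent X"
    by (intro convergentI[OF Cauchy_converges_subseq[OF X r]])
qed

instance L2T :: banach ..


lemma to_L2T_dominated:
  assumes f: "\<And>n. f n \<in> borel_measurable circle" and g: "g \<in> borel_measurable circle"
    and w: "square_integrable circle w"
    and lim: "\<And>x. x \<in> space circle \<Longrightarrow> (\<lambda>n. f n x) \<longlonglongrightarrow> g x"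
    and bd: "\<And>n x. x \<in> space circle \<Longrightarrow> \<bar>f n x\<bar> \<le> w x"
  shows "square_integrable circle g" "square_integrable circle (f n)"
    "(\<lambda>n. to_L2T (f n)) \<longlonglongrightarrow> to_L2T g"
proof -
  have bg: "\<bar>g x\<bar> \<le> w x" if "x \<in> space circle" for x
    using bd[OF that] by (intro tendsto_upperbound[OF tendsto_rabs[OF lim[OF that]]] always_eventually) auto
  have *: "square_integrable circle h"
    if h: "h \<in> borel_measurable circle" "\<And>x. x \<in> space circle \<Longrightarrow> \<bar>h x\<bar> \<le> w x" for h :: "real \<Rightarrow> real"
  proof -
    have "integrable circle (\<lambda>x. (norm (h x))\<^sup>2)"
      using w[unfolded square_integrable_def, THEN conjunct2]
    proof (rule Bochner_Integration.integrable_bound)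
      show "(\<lambda>x. (norm (h x))\<^sup>2) \<in> borel_measurable circle"
        using h(1) by measurable
      show "AE x in circle. norm ((norm (h x))\<^sup>2) \<le> norm ((norm (w x))\<^sup>2)"
      proof (rule AE_I2)
        fix x assume "x \<in> space circle"
        from power_mono[OF h(2)[OF this] abs_ge_zero, of 2]
        show "norm ((norm (h x))\<^sup>2) \<le> norm ((norm (w x))\<^sup>2)" by simp
      qed
    qed
    with h show ?thesis by (simp add: square_integrable_def)
  qed
  show g': "square_integrable circle g" by (rule * [OF g bg])
  show f': "square_integrable circle (f n)" for n by (rule * [OF f bd])
  have "(\<lambda>n. \<integral>x. (f n x - g x)\<^sup>2 \<partial>circle) \<longlonglongrightarrow> (\<integral>x. 0 \<partial>circle)"
  proof (rule integral_dominated_convergence)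
    show "integrable circle (\<lambda>x. 4 * (w x)\<^sup>2)"
      using w by (simp add: square_integrable_def)
    show "AE x in circle. (\<lambda>n. (f n x - g x)\<^sup>2) \<longlonglongrightarrow> 0"
    proof (rule AE_I2)
      fix x assume "x \<in> space circle"
      from tendsto_power[OF tendsto_diff[OF lim[OF this] tendsto_const[of "g x"]], of 2]
      show "(\<lambda>n. (f n x - g x)\<^sup>2) \<longlonglongrightarrow> 0" by simp
    qed
    show "AE x in circle. norm ((f n x - g x)\<^sup>2) \<le> 4 * (w x)\<^sup>2" for n
    proof (rule AE_I2)
      fix x assume "x \<in> space circle"
      then have "\<bar>f n x - g x\<bar> \<le> 2 * w x"
        using bd[of x n] bg[of x] by linarith
      then have "\<bar>f n x - g x\<bar>\<^sup>2 \<le> (2 * w x)\<^sup>2"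
        by (intro power_mono) auto
      then show "norm ((f n x - g x)\<^sup>2) \<le> 4 * (w x)\<^sup>2"
        by (simp add: power_mult_distrib)
    qed
  qed (use f g in measurable)
  then have "(\<lambda>n. (norm (to_L2T (f n) - to_L2T g))\<^sup>2) \<longlonglongrightarrow> 0"
    by (simp add: to_L2T_diff[symmetric] f' g' norm_to_L2T square_integrable_diff)
  then have "(\<lambda>n. norm (to_L2T (f n) - to_L2T g)) \<longlonglongrightarrow> 0"
    using tendsto_real_sqrt[of "\<lambda>n. (norm (to_L2T (f n) - to_L2T g))\<^sup>2" 0 sequentially] by simp
  then show "(\<lambda>n. to_L2T (f n)) \<longlonglongrightarrow> to_L2T g"
    by (rule LIM_zero_cancel[OF tendsto_norm_zero_cancel])
qed

lemma indicator_measurable_circle [measurable (raw)]: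
  "A \<in> sets borel \<Longrightarrow> (indicator A :: real \<Rightarrow> real) \<in> borel_measurable circle"
  unfolding circle_def by (intro measurable_restrict_space1) auto

lemma L2T_countable_dense: "\<exists>Q :: L2T set. countable Q \<and> closure Q = UNIV"
proof -
  define ind where "ind A = to_L2T (indicator A)" for A :: "real set"
  have ind_lim: "(\<lambda>n. ind (A n)) \<longlonglongrightarrow> ind B"
    if "\<And>n. A n \<in> sets borel" "B \<in> sets borel"
      "\<And>x. eventually (\<lambda>n. x \<in> A n \<longleftrightarrow> x \<in> B) sequentially" for A B
    unfolding ind_def
  proof (rule to_L2T_dominated(3)[where w="\<lambda>_. 1"])
    show "square_integrable circle (\<lambda>_. 1 :: real)"
      using square_integrable_indicator_circle[of UNIV] by (simp add: indicator_def)
    show "(\<lambda>n. indicator (A n) x) \<longlonglongrightarrow> (indicator B x :: real)" for x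
      by (rule tendsto_eventually, rule eventually_mono[OF that(3)[of x]]) (simp add: indicator_def)
  qed (use that in \<open>auto simp: indicator_def\<close>)
  define q :: "(rat \<times> rat) list \<Rightarrow> L2T"
    where "q l = sum_list (map (\<lambda>(c, r). of_rat c *\<^sub>R ind {..<of_rat r}) l)" for l
  define V where "V = closure (range q)"
  have V_lim: "x \<in> V" if "\<And>n. y n \<in> V" "y \<longlonglongrightarrow> x" for x y
    using that unfolding V_def by (meson closed_closure closed_sequentially)
  have V_add: "x + y \<in> V" if xy: "x \<in> V" "y \<in> V" for x y
  proof -
    obtain a b where a: "\<And>n. a n \<in> range q" "a \<longlonglongrightarrow> x" and b: "\<And>n. b n \<in> range q" "b \<longlonglongrightarrow> y"
      using xy unfolding V_def closure_sequential by metis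
    have "a n + b n \<in> range q" for n
    proof -
      obtain l l' where "a n = q l" "b n = q l'" using a(1)[of n] b(1)[of n] by auto
      then have "a n + b n = q (l @ l')" by (simp add: q_def)
      then show ?thesis by simp
    qed
    then show ?thesis unfolding V_def closure_sequential
      using tendsto_add[OF a(2) b(2)] by (intro exI[of _ "\<lambda>n. a n + b n"]) auto
  qed
  have V_scale: "c *\<^sub>R x \<in> V" if x: "x \<in> V" for c x
  proof -
    obtain a where a: "\<And>n. a n \<in> range q" "a \<longlonglongrightarrow> x"
      using x unfolding V_def closure_sequential by metis
    have "c \<in> closure \<rat>" by (simp add: Rats_closure_real)
    then obtain d where d: "\<And>n. d n \<in> \<rat>" "d \<longlonglongrightarrow> c"
      unfolding closure_sequential by metis
    have "d n *\<^sub>R a n \<in> range q" for n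
    proof -
      obtain l where l: "a n = q l" using a(1)[of n] by auto
      obtain e where e: "d n = of_rat e" using d(1)[of n] by (auto simp: Rats_def)
      have "of_rat e *\<^sub>R q l = q (map (\<lambda>(c, r). (e * c, r)) l)"
        by (induction l) (auto simp: q_def scaleR_add_right of_rat_mult)
      then show ?thesis by (simp add: l e)
    qed
    then show ?thesis unfolding V_def closure_sequential
      using tendsto_scaleR[OF d(2) a(2)] by (intro exI[of _ "\<lambda>n. d n *\<^sub>R a n"]) auto
  qed
  have V_0: "0 \<in> V"
  proof -
    have "q [] \<in> V" unfolding V_def by (rule subsetD[OF closure_subset]) simp
    then show ?thesis by (simp add: q_def)
  qed
  have V_sum: "sum f S \<in> V" if "\<And>i. i \<in> S \<Longrightarrow> f i \<in> V" for f :: "'i \<Rightarrow> L2T" and S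
    using that by (induction S rule: infinite_finite_induct) (auto simp: V_0 V_add)
  have V_diff: "x - y \<in> V" if "x \<in> V" "y \<in> V" for x y
    using V_add[OF that(1) V_scale[OF that(2), of "-1"]] by simp
  have rat: "ind {..<of_rat r} \<in> V" for r
  proof -
    have "q [(1, r)] \<in> V" unfolding V_def by (rule subsetD[OF closure_subset]) simp
    then show ?thesis by (simp add: q_def)
  qed
  have half: "ind {..<a} \<in> V" for a
  proof -
    have "\<exists>r. a - 1 / real (Suc n) < of_rat r \<and> of_rat r < a" for n
      by (rule of_rat_dense) simp
    then obtain r where r: "\<And>n. a - 1 / real (Suc n) < of_rat (r n)" "\<And>n. of_rat (r n) < a"
      by metis
    have "(\<lambda>n. ind {..<of_rat (r n)}) \<longlonglongrightarrow> ind {..<a}"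
    proof (rule ind_lim)
      fix x
      show "eventually (\<lambda>n. x \<in> {..<of_rat (r n)} \<longleftrightarrow> x \<in> {..<a}) sequentially"
      proof (cases "x < a")
        case True
        have "(\<lambda>n. a - 1 / real (Suc n)) \<longlonglongrightarrow> a - 0"
          using LIMSEQ_inverse_real_of_nat
          by (intro tendsto_intros) (simp add: inverse_eq_divide)
        then have "eventually (\<lambda>n. x < a - 1 / real (Suc n)) sequentially"
          using True by (intro order_tendstoD(1)) auto
        then show ?thesis
          by eventually_elim (use True r in \<open>auto intro: less_trans\<close>)
      next
        case False
        then have "\<not> x < of_rat (r n)" for n using r(2)[of n] by simp
        then show ?thesis using False by simp
      qed
    qed auto
    then show ?thesis by (rule V_lim[rotated]) (rule rat)
  qed
  have ind_empty: "ind {} = 0"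
  proof -
    have "(indicator {} :: real \<Rightarrow> real) = (\<lambda>_. 0)" by (simp add: fun_eq_iff)
    then show ?thesis by (simp only: ind_def to_L2T_zero)
  qed
  have ind_un: "ind (A \<union> B) = ind A + ind B"
    if "A \<in> sets borel" "B \<in> sets borel" "A \<inter> B = {}" for A B
  proof -
    have "(indicator (A \<union> B) :: real \<Rightarrow> real) = (\<lambda>x. indicator A x + indicator B x)"
    proof
      fix x
      from that(3) have "x \<in> A \<Longrightarrow> x \<notin> B" by blast
      then show "(indicator (A \<union> B) x :: real) = indicator A x + indicator B x"
        by (cases "x \<in> A"; cases "x \<in> B") simp_all
    qed
    then show ?thesis
      using that(1,2) by (simp only: ind_def to_L2T_add square_integrable_indicator_circle)
  qed
  have ind_UNIV: "ind UNIV \<in> V"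
  proof (rule V_lim)
    show "(\<lambda>n. ind {..<real n}) \<longlonglongrightarrow> ind UNIV"
    proof (rule ind_lim)
      fix x :: real
      have "eventually (\<lambda>n. x < real n) sequentially"
        using filterlim_real_sequentially by (simp only: filterlim_at_top_dense)
      then show "eventually (\<lambda>n. x \<in> {..<real n} \<longleftrightarrow> x \<in> UNIV) sequentially"
        by simp
    qed auto
  qed (rule half)
  have V_ind: "ind A \<in> V" if "A \<in> sets borel" for A
  proof -
    have "{..<a} \<inter> {..<b} = {..<min a b}" for a b :: real by auto
    then have "Int_stable (range lessThan :: real set set)"
      by (auto simp: Int_stable_def)
    moreover have "range lessThan \<subseteq> Pow (UNIV :: real set)" by simp
    moreover have "A \<in> sigma_sets UNIV (range lessThan)"
      using that by (simp add: borel_Iio)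
    ultimately show ?thesis
    proof (induction rule: sigma_sets_induct_disjoint)
      case (basic A) then show ?case using half by auto
    next
      case empty show ?case by (simp add: V_0 ind_empty)
    next
      case (compl A)
      have A: "A \<in> sets borel" using compl by (simp add: borel_Iio)
      have "ind (UNIV - A) = ind UNIV - ind A"
        using ind_un[of A "UNIV - A"] A by simp
      then show ?case using V_diff ind_UNIV compl by simp
    next
      case (union F)
      have F: "F i \<in> sets borel" for i using union by (auto simp: borel_Iio)
      have fin: "ind (\<Union>i<n. F i) = (\<Sum>i<n. ind (F i)) " for n :: nat
      proof (induction n)
        case 0 show ?case by (simp add: ind_empty)
      next
        case (Suc n)
        have "(\<Union>i<Suc n. F i) = (\<Union>i<n. F i) \<union> F n" by (auto simp: less_Suc_eq)
        moreover have "(\<Union>i<n. F i) \<inter> F n = {}"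
        proof -
          have "F i \<inter> F n = {}" if "i < n" for i
            using union(1) that by (intro disjoint_family_onD[of F UNIV]) auto
          then show ?thesis by blast
        qed
        moreover have "(\<Union>i<n. F i) \<in> sets borel"
          using F by (intro sets.finite_UN) auto
        ultimately have "ind (\<Union>i<Suc n. F i) = ind (\<Union>i<n. F i) + ind (F n)"
          using F[of n] by (simp only: ind_un)
        then show ?case using Suc by simp
      qed
      show ?case
      proof (rule V_lim)
        show "(\<lambda>n. ind (\<Union>i<n. F i)) \<longlonglongrightarrow> ind (\<Union>i. F i)"
        proof (rule ind_lim)
          fix x
          show "eventually (\<lambda>n. x \<in> (\<Union>i<n. F i) \<longleftrightarrow> x \<in> (\<Union>i. F i)) sequentially"
          proof (cases "x \<in> (\<Union>i. F i)")
            case True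
            then obtain i where "x \<in> F i" by auto
            then show ?thesis
              by (intro eventually_mono[OF eventually_gt_at_top[of i]]) auto
          next
            case False then show ?thesis by auto
          qed
        qed (use F in auto)
        show "ind (\<Union>i<n. F i) \<in> V" for n
          unfolding fin by (rule V_sum) (rule union(3))
      qed
    qed
  qed
  have "u \<in> V" for u
  proof -
    obtain s where s: "\<And>i. simple_function circle (s i)"
        "\<And>x. x \<in> space circle \<Longrightarrow> (\<lambda>i. s i x) \<longlonglongrightarrow> rep_L2T u x"
        "\<And>i x. x \<in> space circle \<Longrightarrow> norm (s i x) \<le> 2 * norm (rep_L2T u x)"
      using borel_measurable_implies_sequence_metric[OF rep_L2T_measurable, of u 0]
      unfolding norm_conv_dist by metis
    have sm: "s i \<in> borel_measurable circle" for i
      using s(1) by (rule borel_measurable_simple_function)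
    have w: "square_integrable circle (\<lambda>x. 2 * \<bar>rep_L2T u x\<bar>)"
      using square_integrable_rep[of u]
      by (intro square_integrable_scaleR) (simp add: square_integrable_def)
    have s3: "\<bar>s i x\<bar> \<le> 2 * \<bar>rep_L2T u x\<bar>" if "x \<in> space circle" for i x
      using s(3)[OF that, of i] by (simp only: real_norm_def)
    note dom = to_L2T_dominated[where f=s and w="\<lambda>x. 2 * \<bar>rep_L2T u x\<bar>", OF sm rep_L2T_measurable[of u] w s(2) s3]
    have lim: "(\<lambda>i. to_L2T (s i)) \<longlonglongrightarrow> u"
      using dom(3) unfolding to_L2T_rep .
    have "to_L2T (s i) \<in> V" for i
    proof -
      have *: "s i -` {y} \<inter> space circle \<in> sets borel" for y
      proof -
        have "s i -` {y} \<inter> space circle \<in> sets circle" using s(1) by (rule simple_functionD(2))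
        then show ?thesis by (simp add: circle_def sets_restrict_space_iff)
      qed
      define G where "G y x = y * indicator (s i -` {y} \<inter> space circle) x" for y x :: real
      have G1: "square_integrable circle (G y)" for y
        unfolding G_def by (intro square_integrable_scaleR square_integrable_indicator_circle *)
      have "to_L2T (G y) = y *\<^sub>R ind (s i -` {y} \<inter> space circle)" for y
        unfolding G_def ind_def by (intro to_L2T_scaleR square_integrable_indicator_circle *)
      then have G2: "to_L2T (G y) \<in> V" for y
        using V_scale[OF V_ind[OF *]] by simp
      have sq: "square_integrable circle (\<lambda>x. \<Sum>y\<in>S. G y x) \<and> to_L2T (\<lambda>x. \<Sum>y\<in>S. G y x) \<in> V"
        if "finite S" for S
        using that
      proof (induction S rule: finite_induct)
        case empty show ?case by (simp add: to_L2T_zero V_0 square_integrable_def)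
      next
        case (insert y S)
        then show ?case using G1[of y] G2[of y]
          by (simp add: to_L2T_add square_integrable_add V_add)
      qed
      have "finite (s i ` space circle)" using s(1) by (rule simple_functionD(1))
      note sq = sq[OF this]
      have "to_L2T (s i) = to_L2T (\<lambda>x. \<Sum>y\<in>s i ` space circle. G y x)"
      proof (rule to_L2T_cong)
        show "square_integrable circle (s i)" by (rule dom(2))
        show "AE x in circle. s i x = (\<Sum>y\<in>s i ` space circle. G y x)"
          using simple_function_indicator_representation_AE[OF s(1)[of i]]
          unfolding G_def real_scaleR_def by (simp only: mult.commute)
      qed (use sq in simp)
      then show ?thesis using sq by simp
    qed
    then show ?thesis using lim by (rule V_lim)
  qed
  then show ?thesis
    unfolding V_def by (intro exI[of _ "range q"]) auto
qed

instance L2T :: second_countable_topology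
proof
  obtain Q :: "L2T set" where Q: "countable Q" "closure Q = UNIV"
    using L2T_countable_dense by blast
  define B where "B = (\<lambda>(q, r). ball q (of_rat r)) ` (Q \<times> (UNIV :: rat set))"
  have "topological_basis B"
  proof (rule topological_basisI)
    show "open b" if "b \<in> B" for b using that by (auto simp: B_def)
    fix U :: "L2T set" and x assume U: "open U" "x \<in> U"
    then obtain e where e: "e > 0" "ball x e \<subseteq> U" by (auto simp: open_contains_ball)
    obtain r where r: "0 < real_of_rat r" "real_of_rat r < e / 2"
      using of_rat_dense[of 0 "e/2"] e(1) by auto
    have "x \<in> closure Q" using Q by simp
    then obtain y where y: "y \<in> Q" "dist y x < real_of_rat r"
      using r(1) unfolding closure_approachable by blast
    have "ball y (of_rat r) \<subseteq> ball x e"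
    proof
      fix z assume "z \<in> ball y (of_rat r)"
      then show "z \<in> ball x e"
        using y(2) r(2) dist_triangle[of x z y] by (simp add: dist_commute)
    qed
    with y e show "\<exists>b\<in>B. x \<in> b \<and> b \<subseteq> U"
      by (intro bexI[of _ "ball y (of_rat r)"]) (auto simp: B_def)
  qed
  moreover have "countable B" unfolding B_def using Q(1) by auto
  ultimately show "\<exists>B :: L2T set set. countable B \<and> open = generate_topology B"
    using topological_basis_imp_subbasis by blast
qed

text \<open>\<open>C\<^sup>k\<close>: differentiable with all directional derivatives of class \<open>C\<^sup>k\<^sup>-\<^sup>1\<close>.\<close>
primrec C_k :: "nat \<Rightarrow> ('a::euclidean_space \<Rightarrow> real) \<Rightarrow> bool" where
  "C_k 0 f \<longleftrightarrow> continuous_on UNIV f"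
| "C_k (Suc k) f \<longleftrightarrow> (\<forall>x. f differentiable (at x)) \<and> (\<forall>h. C_k k (\<lambda>x. frechet_derivative f (at x) h))"

definition smooth :: "('a::euclidean_space \<Rightarrow> real) \<Rightarrow> bool" where
  "smooth f \<longleftrightarrow> (\<forall>k. C_k k f)"

definition smooth_circle :: "(real \<Rightarrow> real) \<Rightarrow> bool" where
  "smooth_circle \<phi> \<longleftrightarrow> smooth \<phi> \<and> (\<forall>x. \<phi> (x + 1) = \<phi> x)"

definition weak_deriv :: "L2T \<Rightarrow> L2T \<Rightarrow> bool" where
  "weak_deriv f g \<longleftrightarrow> (\<forall>\<phi>. smooth_circle \<phi> \<longrightarrow>
     (\<integral>x. rep_L2T f x * deriv \<phi> x \<partial>circle) = - (\<integral>x. rep_L2T g x * \<phi> x \<partial>circle))"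

lemma square_integrable_continuous_circle:
  fixes f :: "real \<Rightarrow> real"
  assumes "continuous_on UNIV f"
  shows "square_integrable circle f"
proof -
  interpret finite_measure circle by simp
  have m: "f \<in> borel_measurable circle"
    unfolding circle_def using assms by (intro measurable_restrict_space1) (simp add: borel_measurable_continuous_onI)
  have "compact (f ` {0..1})"
    using assms by (intro compact_continuous_image) (auto intro: continuous_on_subset)
  then obtain B where B: "\<And>x. x \<in> {0..1} \<Longrightarrow> norm (f x) \<le> B"
    using compact_imp_bounded bounded_iff by (metis imageI)
  have "integrable circle (\<lambda>x. (norm (f x))\<^sup>2)"
  proof (rule integrable_const_bound[where B="B\<^sup>2"])
    show "AE x in circle. norm ((norm (f x))\<^sup>2) \<le> B\<^sup>2"
    proof (rule AE_I2)
      fix x assume "x \<in> space circle"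
      then have "norm (f x) \<le> B" using B by simp
      then have "(norm (f x))\<^sup>2 \<le> B\<^sup>2" by (rule power_mono) simp
      then show "norm ((norm (f x))\<^sup>2) \<le> B\<^sup>2" by simp
    qed
    show "(\<lambda>x. (norm (f x))\<^sup>2) \<in> borel_measurable circle"
      using m by measurable
  qed
  with m show ?thesis by (simp add: square_integrable_def)
qed

lemma smooth_square_integrable:
  fixes \<phi> :: "real \<Rightarrow> real"
  assumes "smooth \<phi>"
  shows "square_integrable circle \<phi>" "square_integrable circle (deriv \<phi>)"
proof -
  have "C_k 0 \<phi>" "C_k (Suc 0) \<phi>" using assms by (simp_all only: smooth_def)
  then have c: "continuous_on UNIV \<phi>" and d: "\<And>x. \<phi> differentiable (at x)"
    and c': "continuous_on UNIV (\<lambda>x. frechet_derivative \<phi> (at x) 1)" by auto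
  have "frechet_derivative \<phi> (at x) 1 = deriv \<phi> x" for x
  proof -
    have "(\<phi> has_real_derivative deriv \<phi> x) (at x)"
      using d[of x] DERIV_deriv_iff_real_differentiable by blast
    then have "(\<phi> has_derivative (*) (deriv \<phi> x)) (at x)"
      by (simp add: has_field_derivative_def)
    then have "frechet_derivative \<phi> (at x) = (*) (deriv \<phi> x)"
      by (rule frechet_derivative_at[symmetric])
    then show ?thesis by simp
  qed
  with c c' show "square_integrable circle \<phi>" "square_integrable circle (deriv \<phi>)"
    by (auto intro!: square_integrable_continuous_circle)
qed

lemma weak_deriv_inner:
  "weak_deriv f g \<longleftrightarrow> (\<forall>\<phi>. smooth_circle \<phi> \<longrightarrow>
     inner f (to_L2T (deriv \<phi>)) = - inner g (to_L2T \<phi>))"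
proof -
  have *: "(\<integral>x. rep_L2T u x * \<psi> x \<partial>circle) = inner u (to_L2T \<psi>)" if "square_integrable circle \<psi>" for u \<psi>
    using inner_to_L2T[OF square_integrable_rep that, of u] by simp
  show ?thesis unfolding weak_deriv_def
    by (auto simp: * smooth_square_integrable smooth_circle_def)
qed

lemma weak_deriv_zero: "weak_deriv 0 0"
  and weak_deriv_add: "weak_deriv f f' \<Longrightarrow> weak_deriv g g' \<Longrightarrow> weak_deriv (f + g) (f' + g')"
  and weak_deriv_scaleR: "weak_deriv f f' \<Longrightarrow> weak_deriv (c *\<^sub>R f) (c *\<^sub>R f')"
  and weak_deriv_uminus: "weak_deriv f f' \<Longrightarrow> weak_deriv (- f) (- f')"
  and weak_deriv_diff: "weak_deriv f f' \<Longrightarrow> weak_deriv g g' \<Longrightarrow> weak_deriv (f - g) (f' - g')"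
  by (auto simp: weak_deriv_inner inner_add_left inner_diff_left)

lemma closed_weak_deriv: "closed {(f, g). weak_deriv f g}"
proof -
  have "{(f, g). weak_deriv f g} =
    (\<Inter>\<phi>\<in>Collect smooth_circle. {p. inner (fst p) (to_L2T (deriv \<phi>)) = - inner (snd p) (to_L2T \<phi>)})"
    by (auto simp: weak_deriv_inner)
  also have "closed \<dots>"
    by (intro closed_INT ballI closed_Collect_eq continuous_intros)
  finally show ?thesis .
qed

text \<open>\<open>H\<^sup>1(\<real>/\<int>)\<close> as the graph of the weak derivative: an element is the pair \<open>(u, u')\<close>, and the
  inner product inherited from the product is \<open>\<langle>u,w\<rangle> + \<langle>u',w'\<rangle>\<close> (in \<open>L\<^sup>2\<close>).\<close>
typedef H1T = "{(f, g). weak_deriv f g}"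
  using weak_deriv_zero by auto

setup_lifting type_definition_H1T

instantiation H1T :: real_inner
begin

lift_definition zero_H1T :: H1T is 0
  by (simp add: zero_prod_def weak_deriv_zero)

lift_definition plus_H1T :: "H1T \<Rightarrow> H1T \<Rightarrow> H1T" is "(+)"
  by (auto intro: weak_deriv_add)

lift_definition minus_H1T :: "H1T \<Rightarrow> H1T \<Rightarrow> H1T" is "(-)"
  by (auto intro: weak_deriv_diff)

lift_definition uminus_H1T :: "H1T \<Rightarrow> H1T" is uminus
  by (auto intro: weak_deriv_uminus)

lift_definition scaleR_H1T :: "real \<Rightarrow> H1T \<Rightarrow> H1T" is "(*\<^sub>R)"
  by (auto intro: weak_deriv_scaleR)

lift_definition inner_H1T :: "H1T \<Rightarrow> H1T \<Rightarrow> real" is inner .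

lift_definition norm_H1T :: "H1T \<Rightarrow> real" is norm .

lift_definition dist_H1T :: "H1T \<Rightarrow> H1T \<Rightarrow> real" is dist .

definition sgn_H1T :: "H1T \<Rightarrow> H1T" where
  "sgn_H1T f = scaleR (inverse (norm f)) f"

definition uniformity_H1T :: "(H1T \<times> H1T) filter" where
  "uniformity_H1T = (INF e\<in>{0 <..}. principal {(x, y). dist x y < e})"

definition open_H1T :: "H1T set \<Rightarrow> bool" where
  "open_H1T U = (\<forall>x\<in>U. \<forall>\<^sub>F (x', y) in uniformity. x' = x \<longrightarrow> y \<in> U)"

instance
proof
  fix x y z :: H1T and a b :: real
  show "x + y + z = x + (y + z)" by transfer (simp add: add.assoc)
  show "x + y = y + x" by transfer (simp add: add.commute)
  show "0 + x = x" by transfer simp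
  show "- x + x = 0" by transfer simp
  show "x - y = x + - y" by transfer simp
  show "a *\<^sub>R (x + y) = a *\<^sub>R x + a *\<^sub>R y" by transfer (simp add: scaleR_add_right)
  show "(a + b) *\<^sub>R x = a *\<^sub>R x + b *\<^sub>R x" by transfer (simp add: scaleR_add_left)
  show "a *\<^sub>R b *\<^sub>R x = (a * b) *\<^sub>R x" by transfer simp
  show "1 *\<^sub>R x = x" by transfer simp
  show "sgn x = scaleR (inverse (norm x)) x" by (rule sgn_H1T_def)
  show "dist x y = norm (x - y)" by transfer (rule dist_norm)
  show "inner x y = inner y x" by transfer (rule inner_commute)
  show "inner (x + y) z = inner x z + inner y z" by transfer (rule inner_add_left)
  show "inner (a *\<^sub>R x) y = a * inner x y" by transfer (rule inner_scaleR_left)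
  show "0 \<le> inner x x" by transfer (rule inner_ge_zero)
  show "inner x x = 0 \<longleftrightarrow> x = 0" by transfer (rule inner_eq_zero_iff)
  show "norm x = sqrt (inner x x)" by transfer (rule norm_eq_sqrt_inner)
qed (rule uniformity_H1T_def open_H1T_def)+

end

lemma continuous_Rep_H1T: "continuous_on UNIV Rep_H1T"
  by (auto simp: continuous_on_iff dist_H1T.rep_eq)

instance H1T :: complete_space
proof
  fix X :: "nat \<Rightarrow> H1T" assume "Cauchy X"
  then have "Cauchy (\<lambda>n. Rep_H1T (X n))"
    by (simp add: Cauchy_def dist_H1T.rep_eq)
  then obtain p where p: "(\<lambda>n. Rep_H1T (X n)) \<longlonglongrightarrow> p"
    using Cauchy_convergent convergent_def by blast
  have "p \<in> {(f, g). weak_deriv f g}"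
    using closed_sequentially[OF closed_weak_deriv Rep_H1T p] .
  then have "Rep_H1T (Abs_H1T p) = p" by (rule Abs_H1T_inverse)
  then have "X \<longlonglongrightarrow> Abs_H1T p"
    using p by (simp add: tendsto_iff dist_H1T.rep_eq)
  then show "convergent X" by (rule convergentI)
qed

instance H1T :: banach ..

instance H1T :: second_countable_topology
proof
  obtain B :: "(L2T \<times> L2T) set set" where B: "countable B" "topological_basis B"
    using ex_countable_basis by blast
  have "topological_basis ((\<lambda>b. Rep_H1T -` b) ` B)"
  proof (rule topological_basisI)
    fix b' assume "b' \<in> (\<lambda>b. Rep_H1T -` b) ` B"
    then obtain b where "b \<in> B" "b' = Rep_H1T -` b" by auto
    then show "open b'"
      using topological_basis_open[OF B(2)] open_vimage[OF _ continuous_Rep_H1T] by blast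
  next
    fix U :: "H1T set" and x assume "open U" "x \<in> U"
    then obtain e where e: "e > 0" "ball x e \<subseteq> U" by (auto simp: open_contains_ball)
    obtain b where b: "b \<in> B" "Rep_H1T x \<in> b" "b \<subseteq> ball (Rep_H1T x) e"
      using topological_basisE[OF B(2) open_ball centre_in_ball[THEN iffD2, OF e(1)]] by blast
    have "Rep_H1T -` b \<subseteq> U"
    proof
      fix y assume "y \<in> Rep_H1T -` b"
      then have "Rep_H1T y \<in> ball (Rep_H1T x) e" using b(3) by blast
      then have "y \<in> ball x e" by (simp add: dist_H1T.rep_eq)
      then show "y \<in> U" using e(2) by blast
    qed
    with b show "\<exists>b'\<in>(\<lambda>b. Rep_H1T -` b) ` B. x \<in> b' \<and> b' \<subseteq> U" by auto
  qed
  then show "\<exists>B :: H1T set set. countable B \<and> open = generate_topology B"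
    using B(1) topological_basis_imp_subbasis by blast
qed


text \<open>The inclusion of \<open>H\<^sup>1\<close> in \<open>L\<^sup>2\<close>.\<close>
definition H1T_to_L2T :: "H1T \<Rightarrow> L2T" where
  "H1T_to_L2T u = fst (Rep_H1T u)"

text \<open>Pointwise product. It is only used with \<open>f\<close> in \<open>H\<^sup>1\<close>, hence in \<open>L\<^sup>\<infinity>\<close>, so that the
  product of representatives is square integrable and the dummy value of \<^const>\<open>to_L2T\<close> is not
  reached.\<close>
definition times_L2T :: "L2T \<Rightarrow> L2T \<Rightarrow> L2T" where
  "times_L2T f g = to_L2T (\<lambda>x. rep_L2T f x * rep_L2T g x)"

text \<open>Only the values \<open>S t\<close> with \<open>t \<ge> 0\<close> matter.\<close>
definition C0_semigroup :: "(real \<Rightarrow> 'a \<Rightarrow> 'a::real_normed_vector) \<Rightarrow> bool" where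
  "C0_semigroup S \<longleftrightarrow>
     (\<forall>t\<ge>0. bounded_linear (S t)) \<and> S 0 = id \<and>
     (\<forall>s\<ge>0. \<forall>t\<ge>0. S (s + t) = S s \<circ> S t) \<and>
     (\<forall>x. ((\<lambda>t. S t x) \<longlongrightarrow> x) (at_right 0))"

text \<open>The generator as a graph, so that equality of generators includes equality of domains.\<close>
definition generator :: "(real \<Rightarrow> 'a \<Rightarrow> 'a::real_normed_vector) \<Rightarrow> ('a \<times> 'a) set" where
  "generator S = {(x, y). ((\<lambda>h. (S h x - x) /\<^sub>R h) \<longlongrightarrow> y) (at_right 0)}"

text \<open>The graph of \<open>(E, b) \<mapsto> (\<epsilon>\<^sup>-\<^sup>1 (b\<^sub>x - \<sigma> E), E\<^sub>x)\<close> on \<open>H\<^sup>1 \<times> H\<^sup>1\<close>.\<close>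
definition maxwell_op :: "real \<Rightarrow> real \<Rightarrow> ((L2T \<times> L2T) \<times> (L2T \<times> L2T)) set" where
  "maxwell_op \<epsilon> \<sigma> =
     {((E, b), ((b' - \<sigma> *\<^sub>R E) /\<^sub>R \<epsilon>, E')) |E b E' b'. weak_deriv E E' \<and> weak_deriv b b'}"

definition coupling :: "real \<Rightarrow> real \<Rightarrow> L2T \<Rightarrow> L2T \<times> L2T \<Rightarrow> L2T \<times> L2T" where
  "coupling \<epsilon> \<sigma> f X = (- (\<sigma> / \<epsilon>) *\<^sub>R times_L2T f (snd X), 0)"

text \<open>A \<open>C\<^sub>0\<close>-semigroup is determined by its generator, so \<open>S\<close> below is the semigroup generated by
  the Maxwell operator. The integral is the Bochner integral in \<open>L\<^sup>2 \<times> L\<^sup>2\<close>; its existence is stated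
  because the integral of the library is \<open>0\<close> on non-integrable functions. The coefficient \<open>v\<close>
  matters only up to null sets.\<close>
definition energy_solution ::
  "real \<Rightarrow> real \<Rightarrow> real \<Rightarrow> (real \<Rightarrow> H1T) \<Rightarrow> L2T \<times> L2T \<Rightarrow> (real \<Rightarrow> L2T \<times> L2T) \<Rightarrow> bool" where
  "energy_solution \<epsilon> \<sigma> T v X0 X \<longleftrightarrow>
     continuous_on {0..T} X \<and>
     (\<exists>S. C0_semigroup S \<and> generator S = maxwell_op \<epsilon> \<sigma> \<and>
       (\<forall>t\<in>{0..T}.
          set_integrable lborel {0..t} (\<lambda>s. S (t - s) (coupling \<epsilon> \<sigma> (H1T_to_L2T (v s)) (X s))) \<and>
          X t = S t X0 + (LINT s:{0..t}|lborel. S (t - s) (coupling \<epsilon> \<sigma> (H1T_to_L2T (v s)) (X s)))))"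

definition ohm_current ::
  "real \<Rightarrow> (real \<Rightarrow> H1T) \<Rightarrow> (real \<Rightarrow> L2T) \<Rightarrow> (real \<Rightarrow> L2T) \<Rightarrow> real \<Rightarrow> L2T" where
  "ohm_current \<sigma> v E b t = \<sigma> *\<^sub>R (E t + times_L2T (H1T_to_L2T (v t)) (b t))"

definition time :: "real \<Rightarrow> real measure" where
  "time T = restrict_space lborel {0<..<T}"

definition spacetime :: "real \<Rightarrow> (real \<times> real) measure" where
  "spacetime T = time T \<Otimes>\<^sub>M circle"

text \<open>Weak convergence in the Hilbert space \<open>L\<^sup>2(M; 'b)\<close>, whose inner product is
  \<open>\<integral>z. inner (u z) (w z) \<partial>M\<close>.\<close>
definition weakly_converges ::
  "'a measure \<Rightarrow> (nat \<Rightarrow> 'a \<Rightarrow> 'b::{real_inner, second_countable_topology}) \<Rightarrow> ('a \<Rightarrow> 'b) \<Rightarrow> bool" where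
  "weakly_converges M u w \<longleftrightarrow>
     (\<forall>n. square_integrable M (u n)) \<and> square_integrable M w \<and>
     (\<forall>\<phi>. square_integrable M \<phi> \<longrightarrow>
        (\<lambda>n. \<integral>z. inner (u n z) (\<phi> z) \<partial>M) \<longlonglongrightarrow> (\<integral>z. inner (w z) (\<phi> z) \<partial>M))"

text \<open>\<open>F\<close> is a jointly measurable representative of the curve \<open>u\<close> in \<open>L\<^sup>2(\<real>/\<int>)\<close> under
  \<open>L\<^sup>2(0,T; L\<^sup>2(\<real>/\<int>)) = L\<^sup>2((0,T) \<times> \<real>/\<int>)\<close>; it is unique up to null sets.\<close>
definition field_of :: "real \<Rightarrow> (real \<Rightarrow> L2T) \<Rightarrow> (real \<times> real \<Rightarrow> real) \<Rightarrow> bool" where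
  "field_of T u F \<longleftrightarrow> square_integrable (spacetime T) F \<and>
     (AE t in time T. AE x in circle. F (t, x) = rep_L2T (u t) x)"

text \<open>\<open>C\<^sub>c\<^sup>\<infinity>((0,T) \<times> \<real>/\<int>)\<close>: smooth, periodic in \<open>x\<close>, with \<open>t\<close>-support inside a compact
  subinterval of \<open>(0,T)\<close>.\<close>
definition spacetime_test :: "real \<Rightarrow> (real \<times> real \<Rightarrow> real) \<Rightarrow> bool" where
  "spacetime_test T \<phi> \<longleftrightarrow> smooth \<phi> \<and> (\<forall>t x. \<phi> (t, x + 1) = \<phi> (t, x)) \<and>
     (\<exists>a c. 0 < a \<and> c < T \<and> (\<forall>t x. t \<notin> {a..c} \<longrightarrow> \<phi> (t, x) = 0))"

text \<open>Convergence in the space of distributions of the regular distributions of the (locally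
  integrable) functions \<open>F n\<close> to that of \<open>G\<close>.\<close>
definition distr_converges ::
  "real \<Rightarrow> (nat \<Rightarrow> real \<times> real \<Rightarrow> real) \<Rightarrow> (real \<times> real \<Rightarrow> real) \<Rightarrow> bool" where
  "distr_converges T F G \<longleftrightarrow> (\<forall>\<phi>. spacetime_test T \<phi> \<longrightarrow>
     (\<lambda>n. \<integral>z. F n z * \<phi> z \<partial>spacetime T) \<longlonglongrightarrow> (\<integral>z. G z * \<phi> z \<partial>spacetime T))"

end

theory Submission
  imports Defs
begin

text \<open>The difference \<open>Y\<close> of two solutions satisfies \<open>Y t = S t Y\<^sub>0 + \<integral> S (t - s) (B (v\<^sub>n s) (Y s)) + R\<^sub>n t\<close>, where \<open>B u X\<close>
  is the coupling and \<open>R\<^sub>n t = \<integral>\<^sub>0\<^sup>t S (t - s) (B (v\<^sub>n s - v s) (X s))\<close> contains the limit \<open>X\<close> only.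
  Multiplication \<open>H\<^sup>1 \<times> L\<^sup>2 \<rightarrow> L\<^sup>2\<close> is a norm limit of finite-rank operators in its first factor, because
  an \<open>H\<^sup>1\<close> function is Hoelder continuous and so uniformly close to its averages on short intervals.
  Hence \<open>R\<^sub>n\<close> reduces to integrals of continuous kernels against scalar weakly null functions of
  time, which tend to \<open>0\<close> uniformly. Since \<open>v\<^sub>n\<close> is bounded in \<open>L\<^sup>2(0,T; H\<^sup>1)\<close>, Gronwall's inequality
  gives \<open>Y \<rightarrow> 0\<close>. For the currents, \<open>v\<^sub>n b\<^sub>n - v b = v\<^sub>n (b\<^sub>n - b) + (v\<^sub>n - v) b\<close> is a strongly null term plus
  a weakly null one, and \<open>j\<^sub>n b\<^sub>n\<close> is a product of a weakly and a strongly convergent sequence.\<close>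

section \<open>Strongly continuous semigroups\<close>

text \<open>Compactness is available in space only. The Maxwell propagator does not smooth and
  nothing bounds the time derivative of \<open>v_n\<close>, so neither a compact semigroup nor an
  Aubin-Lions argument applies; what is compact is the embedding of H^1 into the bounded functions
  on the circle. Uniformity in \<open>t\<close> has another source: primitives of an
  L^2(0,T)-bounded scalar sequence share one Hoelder constant of exponent 1/2, so pointwise
  convergence is uniform. The remainder is evaluated on the fixed continuous limit \<open>X\<close>,
  hence no product of two varying sequences is passed to the limit there; the product of
  \<open>v_n\<close> and \<open>Y\<close> is left to Gronwall, which asks only for the L^2 norm in
  time of \<open>norm (v_n s)\<close>. Two definitions force preparatory work. An energy solution
  carries its own semigroup, so comparing two solutions requires that a generator determine its
  semigroup. And H^1 is given by weak derivatives against smooth periodic functions, so Hoelder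
  continuity requires the du Bois-Reymond lemma.\<close>

lemma uniform_boundedness_principle:
  fixes T :: "nat \<Rightarrow> 'a::banach \<Rightarrow> 'b::real_normed_vector"
  assumes T: "\<And>n. bounded_linear (T n)"
    and bounded: "\<And>x. \<exists>C. \<forall>n. norm (T n x) \<le> C"
  shows "\<exists>M\<ge>0. \<forall>n x. norm (T n x) \<le> M * norm x"
proof -
  define A where "A m = {x. \<forall>n. norm (T n x) \<le> real m}" for m :: nat
  have closed: "closed (A m)" for m
  proof -
    have "A m = (\<Inter>n. {x. norm (T n x) \<le> real m})" by (auto simp: A_def)
    also have "closed \<dots>"
      by (intro closed_INT ballI closed_Collect_le continuous_intros
          linear_continuous_on[OF T])
    finally show ?thesis .
  qed
  have cover: "(\<Union>m. A m) = UNIV"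
  proof -
    have "\<exists>m. x \<in> A m" for x
    proof -
      obtain C where "\<forall>n. norm (T n x) \<le> C" using bounded by blast
      moreover obtain m :: nat where "C \<le> real m" using real_arch_simple by blast
      ultimately show ?thesis unfolding A_def by (auto intro: order_trans)
    qed
    then show ?thesis by auto
  qed
  have "\<exists>m. interior (A m) \<noteq> {}"
  proof (rule ccontr)
    assume "\<not> ?thesis"
    then have "(euclidean :: 'a topology) interior_of \<Union> (range A) = {}"
      by (intro Baire_category_alt) (auto simp: completely_metrizable_space_euclidean closed)
    then show False using cover by simp
  qed
  then obtain m a where "a \<in> interior (A m)" by auto
  then obtain r where r: "r > 0" "ball a r \<subseteq> A m"
    using open_contains_ball[of "interior (A m)"] interior_subset by blast
  have ball: "norm (T n x) \<le> real m" if "dist a x < r" for n x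
    using r(2) that by (auto simp: A_def)
  show ?thesis
  proof (intro exI[of _ "4 * real m / r"] conjI allI)
    fix n x
    interpret bounded_linear "T n" by (rule T)
    show "norm (T n x) \<le> 4 * real m / r * norm x"
    proof (cases "x = 0")
      case True then show ?thesis by (simp add: zero)
    next
      case False
      \<comment> \<open>\<open>c\<close> scales \<open>x\<close> to norm \<open>r / 2\<close>, so
        \<open>a\<close> and \<open>a + c *\<^sub>R x\<close> both lie in the ball inside
        \<open>A m\<close>. Recovering \<open>x\<close> from their difference costs a factor 2, and
        undoing the scaling gives \<open>4 * real m / r\<close>.\<close>
      define c where "c = r / (2 * norm x)"
      have c: "c > 0" using r(1) False by (simp add: c_def)
      have "norm (c *\<^sub>R x) < r" using r(1) False by (simp add: c_def)
      then have "norm (T n (a + c *\<^sub>R x)) \<le> real m" by (intro ball) (simp add: dist_norm)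
      moreover have "norm (T n a) \<le> real m" by (intro ball) (use r in simp)
      moreover have "c *\<^sub>R T n x = T n (a + c *\<^sub>R x) - T n a" by (simp add: add scale)
      ultimately have "norm (c *\<^sub>R T n x) \<le> 2 * real m"
        using norm_triangle_ineq4[of "T n (a + c *\<^sub>R x)" "T n a"] by simp
      then have "c * norm (T n x) \<le> 2 * real m" using c by simp
      then show ?thesis using c r(1) False unfolding c_def by (simp add: field_simps)
    qed
  qed (use r in auto)
qed

lemma C0_semigroupD:
  assumes "C0_semigroup S"
  shows "\<And>t. t \<ge> 0 \<Longrightarrow> bounded_linear (S t)" and "S 0 = id"
    and "\<And>s t x. s \<ge> 0 \<Longrightarrow> t \<ge> 0 \<Longrightarrow> S (s + t) x = S s (S t x)"
    and "\<And>x. ((\<lambda>t. S t x) \<longlongrightarrow> x) (at_right 0)"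
  using assms unfolding C0_semigroup_def by auto

text \<open>Strong continuity at 0 controls each orbit separately. If no common bound held near 0,
  there would be times \<open>t n\<close> tending to 0 with unbounded operators
  \<open>S (t n)\<close>, although every orbit \<open>S (t n) y\<close> converges to
  \<open>y\<close>; this contradicts uniform boundedness.\<close>

lemma C0_semigroup_locally_bounded:
  fixes S :: "real \<Rightarrow> 'a::banach \<Rightarrow> 'a"
  assumes S: "C0_semigroup S"
  obtains \<delta> M where "\<delta> > 0" "\<And>t x. t \<in> {0..\<delta>} \<Longrightarrow> norm (S t x) \<le> M * norm x"
proof -
  note S = C0_semigroupD[OF S]
  have "\<exists>\<delta>>0. \<exists>M. \<forall>t\<in>{0..\<delta>}. \<forall>x. norm (S t x) \<le> M * norm x"
  proof (rule ccontr)
    assume contra: "\<not> ?thesis"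
    have "\<exists>t x. t \<in> {0..1 / real (Suc n)} \<and> \<not> norm (S t x) \<le> real n * norm x" for n
    proof (rule ccontr)
      assume "\<not> ?thesis"
      then have "\<exists>\<delta>>0. \<exists>M. \<forall>t\<in>{0..\<delta>}. \<forall>x. norm (S t x) \<le> M * norm x"
        by (intro exI[of _ "1 / real (Suc n)"] conjI exI[of _ "real n"]) auto
      with contra show False by blast
    qed
    then obtain t x where t: "\<And>n. t n \<in> {0..1 / real (Suc n)}"
      and x: "\<And>n. \<not> norm (S (t n) (x n)) \<le> real n * norm (x n)" by metis
    have t_lim: "t \<longlonglongrightarrow> 0"
    proof (rule tendsto_sandwich[OF always_eventually always_eventually tendsto_const])
      show "(\<lambda>n. 1 / real (Suc n)) \<longlonglongrightarrow> 0"
        using LIMSEQ_inverse_real_of_nat by (simp add: inverse_eq_divide)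
    qed (use t in auto)
    have "\<exists>M\<ge>0. \<forall>n x. norm (S (t n) x) \<le> M * norm x"
    proof (rule uniform_boundedness_principle)
      show "bounded_linear (S (t n))" for n using t[of n] by (intro S) simp
      fix y
      have "((\<lambda>r. S r y) \<longlongrightarrow> y) (at 0 within {0..})"
      proof -
        have "((\<lambda>r. S r y) \<longlongrightarrow> S 0 y) (at 0 within {0<..})"
          using S(4)[of y] S(2) by simp
        then have "continuous (at 0 within {0..}) (\<lambda>r. S r y)"
          unfolding continuous_within at_within_Ici_at_right by simp
        then show ?thesis unfolding continuous_within by (simp add: S(2))
      qed
      then have "continuous (at 0 within {0..}) (\<lambda>r. S r y)"
        unfolding continuous_within by (simp add: S(2))
      then have "((\<lambda>r. S r y) \<circ> t) \<longlonglongrightarrow> S 0 y"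
        unfolding continuous_within_sequentially using t t_lim by auto
      then have "Bseq (\<lambda>n. S (t n) y)"
        by (intro convergent_imp_Bseq convergentI) (simp add: o_def)
      then show "\<exists>C. \<forall>n. norm (S (t n) y) \<le> C" by (auto simp: Bseq_def)
    qed
    then obtain M where M: "\<And>n x. norm (S (t n) x) \<le> M * norm x" by blast
    obtain n :: nat where "M \<le> real n" using real_arch_simple by blast
    then have "norm (S (t n) (x n)) \<le> real n * norm (x n)"
      using M[of n "x n"] mult_right_mono[of M "real n" "norm (x n)"] by simp
    with x[of n] show False by simp
  qed
  with that show thesis by blast
qed

text \<open>Long times are cut into steps of length \<open>\<delta>\<close>, each costing one factor
  \<open>M\<close>. Taking \<open>M\<close> at least 1 makes the powers increase, so the exponent
  for the longest time serves all shorter ones.\<close>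

lemma C0_semigroup_bounded_on:
  fixes S :: "real \<Rightarrow> 'a::banach \<Rightarrow> 'a"
  assumes S: "C0_semigroup S"
  obtains M where "M \<ge> 1" "\<And>t x. t \<in> {0..T} \<Longrightarrow> norm (S t x) \<le> M * norm x"
proof -
  note SD = C0_semigroupD[OF S]
  obtain \<delta> M0 where \<delta>: "\<delta> > 0" and M0: "\<And>t x. t \<in> {0..\<delta>} \<Longrightarrow> norm (S t x) \<le> M0 * norm x"
    using C0_semigroup_locally_bounded[OF S] by metis
  define M where "M = max M0 1"
  have M: "norm (S t x) \<le> M * norm x" if "t \<in> {0..\<delta>}" for t x
    using M0[OF that, of x] by (rule order_trans) (auto simp: M_def intro: mult_right_mono)
  have M1: "M \<ge> 1" by (simp add: M_def)
  have *: "norm (S t x) \<le> M ^ Suc n * norm x" if "t \<in> {0..real (Suc n) * \<delta>}" for n t x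
    using that
  proof (induction n arbitrary: t x)
    case 0 then show ?case using M by simp
  next
    case (Suc n)
    show ?case
    proof (cases "t \<le> \<delta>")
      case True
      have "M ^ 1 \<le> M ^ Suc (Suc n)" by (rule power_increasing) (use M1 in auto)
      then show ?thesis using M[of t x] True Suc.prems
        by (intro order_trans[OF M[of t x]] mult_right_mono) auto
    next
      case False
      have "S t x = S \<delta> (S (t - \<delta>) x)" using SD(3)[of \<delta> "t - \<delta>" x] \<delta> False by simp
      also have "norm \<dots> \<le> M * norm (S (t - \<delta>) x)" using M \<delta> by simp
      also have "\<dots> \<le> M * (M ^ Suc n * norm x)"
        using Suc.IH[of "t - \<delta>" x] Suc.prems False M1 by (intro mult_left_mono) (auto simp: algebra_simps)
      finally show ?thesis by simp
    qed
  qed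
  obtain n where n: "T / \<delta> \<le> real n" using real_arch_simple by blast
  show thesis
  proof (rule that)
    show "M ^ Suc n \<ge> 1" using M1 by (rule one_le_power)
    show "norm (S t x) \<le> M ^ Suc n * norm x" if "t \<in> {0..T}" for t x
    proof (rule *)
      have "T \<le> real n * \<delta>" using n \<delta> by (simp add: field_simps)
      then show "t \<in> {0..real (Suc n) * \<delta>}" using that \<delta> by (auto simp: algebra_simps)
    qed
  qed
qed

text \<open>The semigroup axioms give continuity from the right at 0 only. Two-sided continuity
  follows because the later value minus the earlier one is \<open>S\<close> at the earlier time
  applied to \<open>S \<bar>t - s\<bar> x - x\<close>, and that operator is bounded on compact time
  intervals.\<close>

lemma C0_semigroup_orbit_continuous:
  fixes S :: "real \<Rightarrow> 'a::banach \<Rightarrow> 'a"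
  assumes S: "C0_semigroup S"
  shows "continuous_on {0..} (\<lambda>t. S t x)"
proof -
  note SD = C0_semigroupD[OF S]
  have close: "norm (S t x - S s x) \<le> M * norm (S \<bar>t - s\<bar> x - x)"
    if "s \<in> {0..T}" "t \<in> {0..T}" and M: "\<And>t x. t \<in> {0..T} \<Longrightarrow> norm (S t x) \<le> M * norm x" for s t T M
  proof -
    have le: "norm (S t x - S s x) \<le> M * norm (S (t - s) x - x)"
      if "s \<le> t" "s \<in> {0..T}" "t \<in> {0..T}" for s t
    proof -
      interpret bounded_linear "S s" using that by (intro SD) simp
      have "S t x - S s x = S s (S (t - s) x - x)"
        using SD(3)[of s "t - s" x] that by (simp add: diff)
      then show ?thesis using M that by metis
    qed
    show ?thesis
    proof (cases "s \<le> t")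
      case True then show ?thesis using le[of s t] that by simp
    next
      case False then show ?thesis using le[of t s] that by (simp add: norm_minus_commute)
    qed
  qed
  show ?thesis
    unfolding continuous_on_iff
  proof (intro ballI allI impI)
    fix s e :: real assume s: "s \<in> {0..}" and e: "e > 0"
    obtain M where M: "M \<ge> 1" "\<And>t x. t \<in> {0..s + 1} \<Longrightarrow> norm (S t x) \<le> M * norm x"
      using C0_semigroup_bounded_on[OF S] by metis
    have "eventually (\<lambda>t. dist (S t x) x < e / M) (at_right 0)"
      using SD(4)[of x] e M(1) by (intro tendstoD) auto
    then obtain d where d: "d > 0" "\<And>r. 0 < r \<Longrightarrow> r < d \<Longrightarrow> dist (S r x) x < e / M"
      unfolding eventually_at_right[OF zero_less_one] by auto
    show "\<exists>d>0. \<forall>t\<in>{0..}. dist t s < d \<longrightarrow> dist (S t x) (S s x) < e"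
    proof (intro exI[of _ "min d 1"] conjI ballI impI)
      fix t :: real assume t: "t \<in> {0..}" "dist t s < min d 1"
      have "norm (S t x - S s x) \<le> M * norm (S \<bar>t - s\<bar> x - x)"
        by (rule close[of s "s+1"]) (use s t M in \<open>auto simp: dist_real_def\<close>)
      also have "\<dots> < e"
      proof (cases "t = s")
        case True then show ?thesis using e by (simp add: SD(2))
      next
        case False
        then have "dist (S \<bar>t - s\<bar> x) x < e / M" using t by (intro d) (auto simp: dist_real_def)
        then show ?thesis using M(1) by (simp add: dist_norm field_simps)
      qed
      finally show "dist (S t x) (S s x) < e" by (simp add: dist_norm)
    qed (use d in auto)
  qed
qed

text \<open>Near a given time the operators share one Lipschitz constant in the state, which
  combines with continuity of a single orbit. Continuity in the pair, not in each variable alone, is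
  what later gives measurable Duhamel integrands and continuous kernels.\<close>

lemma C0_semigroup_continuous:
  fixes S :: "real \<Rightarrow> 'a::banach \<Rightarrow> 'a"
  assumes S: "C0_semigroup S"
  shows "continuous_on ({0..} \<times> UNIV) (\<lambda>(t, x). S t x)"
  unfolding continuous_on_iff
proof (intro ballI allI impI)
  note SD = C0_semigroupD[OF S]
  fix p and e :: real assume p: "p \<in> {0::real..} \<times> (UNIV :: 'a set)" and e: "e > 0"
  obtain s x where sx: "p = (s, x)" by (cases p)
  then have s: "s \<ge> 0" using p by simp
  obtain M where M: "M \<ge> 1" "\<And>t x. t \<in> {0..s + 1} \<Longrightarrow> norm (S t x) \<le> M * norm x"
    using C0_semigroup_bounded_on[OF S] by metis
  obtain d where d: "d > 0" "\<And>t. t \<in> {0..} \<Longrightarrow> dist t s < d \<Longrightarrow> dist (S t x) (S s x) < e / 2"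
    using C0_semigroup_orbit_continuous[OF S, of x] s e unfolding continuous_on_iff
    by (metis atLeast_iff half_gt_zero)
  show "\<exists>d>0. \<forall>q\<in>{0..} \<times> UNIV. dist q p < d \<longrightarrow>
      dist (case q of (t, x) \<Rightarrow> S t x) (case p of (t, x) \<Rightarrow> S t x) < e"
  proof (intro exI[of _ "min (min d 1) (e / (2 * M))"] conjI ballI impI)
    fix q assume q: "q \<in> {0::real..} \<times> (UNIV :: 'a set)" "dist q p < min (min d 1) (e / (2 * M))"
    obtain t y where ty: "q = (t, y)" by (cases q)
    have t: "t \<ge> 0" "dist t s < d" "dist t s < 1" and y: "dist y x < e / (2 * M)"
      using q dist_fst_le[of q p] dist_snd_le[of q p] by (auto simp: ty sx)
    interpret bounded_linear "S t" using t by (intro SD) simp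
    have "norm (S t y - S t x) \<le> M * norm (y - x)"
      unfolding diff[symmetric] using t s by (intro M) (auto simp: dist_real_def)
    also have "\<dots> < e / 2" using y M(1) by (simp add: dist_norm field_simps)
    finally have "dist (S t y) (S t x) < e / 2" by (simp add: dist_norm)
    moreover have "dist (S t x) (S s x) < e / 2" using d t by simp
    ultimately show "dist (case q of (t, x) \<Rightarrow> S t x) (case p of (t, x) \<Rightarrow> S t x) < e"
      using dist_triangle[of "S t y" "S s x" "S t x"] by (simp add: ty sx)
  qed (use d e M in auto)
qed

section \<open>Generators and uniqueness of the generated semigroup\<close>

lemma generator_invariant:
  assumes S: "C0_semigroup S" and "(x, y) \<in> generator S" and t: "t \<ge> 0"
  shows "(S t x, S t y) \<in> generator S"
proof -
  note SD = C0_semigroupD[OF S]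
  interpret bounded_linear "S t" using t by (rule SD)
  have "((\<lambda>h. S t ((S h x - x) /\<^sub>R h)) \<longlongrightarrow> S t y) (at_right 0)"
    using assms(2) unfolding generator_def by (intro tendsto) simp
  moreover have "eventually (\<lambda>h. S t ((S h x - x) /\<^sub>R h) = (S h (S t x) - S t x) /\<^sub>R h) (at_right 0)"
    using eventually_at_right_less
  proof eventually_elim
    case (elim h)
    then have "S h (S t x) = S t (S h x)"
      using SD(3)[of h t x] SD(3)[of t h x] t by (simp add: add.commute)
    then show ?case by (simp add: scale diff)
  qed
  ultimately show ?thesis unfolding generator_def by (auto elim: Lim_transform_eventually)
qed

text \<open>The averages \<open>J h /\<^sub>R h\<close> of an orbit over short times tend to
  \<open>x\<close>. They lie in the domain because \<open>S k\<close> maps \<open>J h\<close> to the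
  integral over a shifted interval, which turns the difference quotient of \<open>S\<close> at
  \<open>J h\<close> into difference quotients of \<open>J\<close> at \<open>h\<close> and at
  0.\<close>

lemma generator_dense:
  fixes S :: "real \<Rightarrow> 'a::banach \<Rightarrow> 'a"
  assumes S: "C0_semigroup S"
  shows "closure (Domain (generator S)) = UNIV"
proof -
  note SD = C0_semigroupD[OF S]
  have "x \<in> closure (Domain (generator S))" for x
  proof -
    define J where "J u = integral {0..u} (\<lambda>s. S s x)" for u
    have cont: "continuous_on {a..b} (\<lambda>s. S s x)" if "a \<ge> 0" for a b
      using C0_semigroup_orbit_continuous[OF S] by (rule continuous_on_subset) (use that in auto)
    have int: "(\<lambda>s. S s x) integrable_on {a..b}" if "a \<ge> 0" for a b
      using cont[OF that] by (rule integrable_continuous_real)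
    have J': "((\<lambda>k. (J (u + k) - J u) /\<^sub>R k) \<longlongrightarrow> S u x) (at_right 0)" if u: "u \<ge> 0" for u
    proof -
      have "(J has_vector_derivative S u x) (at u within {0..u + 1})"
        unfolding J_def by (rule integral_has_vector_derivative) (use cont u in auto)
      then have "(J has_vector_derivative S u x) (at u within {u..u+1})"
        by (rule has_vector_derivative_within_subset) (use u in auto)
      then have "((\<lambda>w. norm (J w - J u - (w - u) *\<^sub>R S u x) / norm (w - u)) \<longlongrightarrow> 0) (at_right u)"
        unfolding has_vector_derivative_def has_derivative_iff_norm by (simp add: at_within_Icc_at_right)
      then have "((\<lambda>k. norm (J (k + u) - J u - k *\<^sub>R S u x) / norm k) \<longlongrightarrow> 0) (at_right 0)"
        by (subst (asm) filterlim_at_right_to_0) simp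
      moreover have "eventually (\<lambda>k. norm (J (k + u) - J u - k *\<^sub>R S u x) / norm k =
          norm ((J (u + k) - J u) /\<^sub>R k - S u x)) (at_right 0)"
        using eventually_at_right_less
      proof eventually_elim
        case (elim k)
        have "(J (u + k) - J u) /\<^sub>R k - S u x = (J (k + u) - J u - k *\<^sub>R S u x) /\<^sub>R k"
          using elim by (simp add: scaleR_diff_right add.commute)
        then show ?case using elim by (simp add: divide_inverse mult.commute)
      qed
      ultimately have "((\<lambda>k. norm ((J (u + k) - J u) /\<^sub>R k - S u x)) \<longlongrightarrow> 0) (at_right 0)"
        by (rule Lim_transform_eventually)
      then show ?thesis by (rule LIM_zero_cancel[OF tendsto_norm_zero_cancel])
    qed
    have avg: "((\<lambda>h. J h /\<^sub>R h) \<longlongrightarrow> x) (at_right 0)"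
      using J'[of 0] by (simp add: J_def SD(2))
    have dom: "(J h, S h x - x) \<in> generator S" if h: "h > 0" for h
    proof -
      have "S k (J h) = J (h + k) - J k" if k: "k \<ge> 0" for k
      proof -
        have "S k (J h) = integral {0..h} (\<lambda>s. S k (S s x))"
          unfolding J_def using integral_linear[OF int SD(1)[OF k], of 0 h] by (simp add: o_def)
        also have "\<dots> = integral {0..h} ((\<lambda>s. S s x) \<circ> (+) k)"
          by (rule integral_cong) (use SD(3) k in simp)
        also have "\<dots> = integral {k..h + k} (\<lambda>s. S s x)"
          by (simp add: integral_shift_Icc_real add.commute)
        also have "\<dots> = J (h + k) - J k"
          unfolding J_def using Henstock_Kurzweil_Integration.integral_combine[of 0 k "h + k" "\<lambda>s. S s x"] int h k
          by (simp add: algebra_simps)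
        finally show ?thesis .
      qed
      then have eq: "eventually (\<lambda>k. (J (h + k) - J h) /\<^sub>R k - (J (0 + k) - J 0) /\<^sub>R k
          = (S k (J h) - J h) /\<^sub>R k) (at_right 0)"
        by (intro eventually_mono[OF eventually_at_right_less])
          (simp add: J_def scaleR_diff_right)
      have "((\<lambda>k. (J (h + k) - J h) /\<^sub>R k - (J (0 + k) - J 0) /\<^sub>R k) \<longlongrightarrow> S h x - S 0 x) (at_right 0)"
        by (intro tendsto_diff J') (use h in auto)
      from Lim_transform_eventually[OF this eq] show ?thesis
        by (simp add: generator_def SD(2))
    qed
    have "eventually (\<lambda>h. J h /\<^sub>R h \<in> Domain (generator S)) (at_right 0)"
      using eventually_at_right_less
    proof eventually_elim
      case (elim h)
      have "((\<lambda>k. ((S k (J h) - J h) /\<^sub>R k) /\<^sub>R h) \<longlongrightarrow> (S h x - x) /\<^sub>R h) (at_right 0)"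
        using dom[OF elim] unfolding generator_def by (intro tendsto_intros) simp
      moreover have "eventually (\<lambda>k. ((S k (J h) - J h) /\<^sub>R k) /\<^sub>R h
          = (S k (J h /\<^sub>R h) - J h /\<^sub>R h) /\<^sub>R k) (at_right 0)"
        using eventually_at_right_less
      proof eventually_elim
        case (elim k)
        interpret bounded_linear "S k" using elim by (intro SD) simp
        show ?case by (simp add: scale scaleR_diff_right mult.commute)
      qed
      ultimately have "(J h /\<^sub>R h, (S h x - x) /\<^sub>R h) \<in> generator S"
        unfolding generator_def by (auto elim: Lim_transform_eventually)
      then show ?case by blast
    qed
    then have "eventually (\<lambda>h. J h /\<^sub>R h \<in> closure (Domain (generator S))) (at_right 0)"
      by eventually_elim (rule subsetD[OF closure_subset])
    then show ?thesis
      using avg by (intro Lim_in_closed_set[of "closure (Domain (generator S))" "\<lambda>h. J h /\<^sub>R h"]) auto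
  qed
  then show ?thesis by blast
qed

text \<open>A mean value inequality that asks for increments to the right only, since a generator
  controls no others. By continuity the set \<open>K\<close> contains its supremum, and an increment
  from there would leave \<open>K\<close> unbounded by it unless the supremum is
  \<open>b\<close>.\<close>

lemma right_derivative_bound:
  fixes F :: "real \<Rightarrow> 'a::real_normed_vector"
  assumes ab: "a \<le> b" and cont: "continuous_on {a..b} F"
    and right: "\<And>s. s \<in> {a..<b} \<Longrightarrow> \<exists>d>0. \<forall>h. 0 < h \<and> h < d \<longrightarrow> norm (F (s + h) - F s) \<le> e * h"
  shows "norm (F b - F a) \<le> e * (b - a)"
proof -
  define K where "K = {s \<in> {a..b}. norm (F s - F a) \<le> e * (s - a)}"
  have "K = {a..b} \<inter> (\<lambda>s. norm (F s - F a) - e * (s - a)) -` {..0}"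
    by (auto simp: K_def)
  moreover have "closed \<dots>"
    by (intro continuous_closed_preimage continuous_intros cont)
  ultimately have "closed K" by simp
  moreover have "K \<noteq> {}" "bdd_above K" using ab by (auto simp: K_def)
  ultimately have c: "Sup K \<in> K" using closed_contains_Sup by blast
  have "\<not> Sup K < b"
  proof
    assume less: "Sup K < b"
    have "Sup K \<in> {a..<b}" using c less by (auto simp: K_def)
    then obtain d where d: "d > 0" "\<And>h. 0 < h \<Longrightarrow> h < d \<Longrightarrow> norm (F (Sup K + h) - F (Sup K)) \<le> e * h"
      using right by blast
    define h where "h = min (d / 2) (b - Sup K)"
    have h: "0 < h" "h < d" "Sup K + h \<le> b" using d less by (auto simp: h_def)
    have "norm (F (Sup K + h) - F a) \<le> norm (F (Sup K + h) - F (Sup K)) + norm (F (Sup K) - F a)"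
      using norm_triangle_ineq[of "F (Sup K + h) - F (Sup K)" "F (Sup K) - F a"] by simp
    also have "\<dots> \<le> e * h + e * (Sup K - a)"
      using d(2)[OF h(1,2)] c by (simp add: K_def)
    finally have "Sup K + h \<in> K"
      using h c by (auto simp: K_def algebra_simps)
    then show False using h(1) cSup_upper[OF _ \<open>bdd_above K\<close>] by fastforce
  qed
  then have "Sup K = b" using c by (auto simp: K_def)
  then show ?thesis using c by (simp add: K_def)
qed

text \<open>For \<open>x\<close> in the common domain, \<open>F s = S (t - s) (R s x)\<close> runs
  from \<open>S t x\<close> to \<open>R t x\<close>. Its right derivative vanishes because both
  generators take the same value at \<open>R s x\<close>, which stays in the domain; density of the
  domain covers the remaining \<open>x\<close>.\<close>

lemma C0_semigroup_unique:
  fixes S R :: "real \<Rightarrow> 'a::banach \<Rightarrow> 'a"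
  assumes S: "C0_semigroup S" and R: "C0_semigroup R" and gen: "generator S = generator R"
    and t: "t \<ge> 0"
  shows "S t = R t"
proof -
  note SD = C0_semigroupD[OF S] and RD = C0_semigroupD[OF R]
  obtain M where M: "M \<ge> 1" "\<And>r x. r \<in> {0..t} \<Longrightarrow> norm (S r x) \<le> M * norm x"
    using C0_semigroup_bounded_on[OF S] by metis
  have eq: "S t x = R t x" if "(x, y) \<in> generator R" for x y
  proof -
    define F where "F s = S (t - s) (R s x)" for s
    have cont: "continuous_on {0..t} F"
    proof -
      have "continuous_on {0..t} (\<lambda>s. R s x)"
        using C0_semigroup_orbit_continuous[OF R] by (rule continuous_on_subset) auto
      then have "continuous_on {0..t} (\<lambda>s. (t - s, R s x))"
        by (intro continuous_intros)
      from continuous_on_compose2[OF C0_semigroup_continuous[OF S] this] show ?thesis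
        by (simp add: F_def image_subset_iff)
    qed
    have "norm (F t - F 0) \<le> e * (t - 0)" if e: "e > 0" for e
    proof (rule right_derivative_bound[OF t cont])
      fix s assume s: "s \<in> {0..<t}"
      define z where "z = R s x"
      have zR: "(z, R s y) \<in> generator R" unfolding z_def
        using \<open>(x, y) \<in> generator R\<close> s by (intro generator_invariant[OF R]) auto
      then have zS: "(z, R s y) \<in> generator S" using gen by simp
      have "((\<lambda>h. (R h z - z) /\<^sub>R h - (S h z - z) /\<^sub>R h) \<longlongrightarrow> R s y - R s y) (at_right 0)"
        using zR zS unfolding generator_def by (intro tendsto_diff) auto
      then have "eventually (\<lambda>h. dist ((R h z - z) /\<^sub>R h - (S h z - z) /\<^sub>R h) 0 < e / M) (at_right 0)"
        using e M(1) by (intro tendstoD) auto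
      then obtain d where d: "d > 0"
          "\<And>h. 0 < h \<Longrightarrow> h < d \<Longrightarrow> norm ((R h z - z) /\<^sub>R h - (S h z - z) /\<^sub>R h) < e / M"
        unfolding eventually_at_right[OF zero_less_one] by auto
      show "\<exists>d>0. \<forall>h. 0 < h \<and> h < d \<longrightarrow> norm (F (s + h) - F s) \<le> e * h"
      proof (intro exI[of _ "min d (t - s)"] conjI allI impI)
        fix h assume "0 < h \<and> h < min d (t - s)"
        then have h: "0 < h" "h < d" "h < t - s" by auto
        interpret bounded_linear "S (t - s - h)" using h s by (intro SD) simp
        have "R (s + h) x = R h z" using RD(3)[of h s x] h s by (simp add: z_def add.commute)
        moreover have "S (t - s) z = S (t - s - h) (S h z)" using SD(3)[of "t - s - h" h z] h by simp
        ultimately have "F (s + h) - F s = S (t - s - h) (R h z - S h z)"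
          by (simp add: F_def z_def[symmetric] diff[unfolded diff_diff_eq] diff_diff_eq)
        then have "norm (F (s + h) - F s) \<le> M * norm (R h z - S h z)"
          using M(2)[of "t - s - h" "R h z - S h z"] h s by simp
        also have "R h z - S h z = h *\<^sub>R ((R h z - z) /\<^sub>R h - (S h z - z) /\<^sub>R h)"
          using h by (simp add: scaleR_diff_right)
        also have "M * norm \<dots> \<le> M * (h * (e / M))"
          unfolding norm_scaleR using d(2)[OF h(1,2)] h M(1) by (intro mult_mono) auto
        finally show "norm (F (s + h) - F s) \<le> e * h" using M(1) by (simp add: mult.commute)
      qed (use d s in auto)
    qed
    then have *: "norm (F t - F 0) \<le> e * t" if "e > 0" for e using that by simp
    have "norm (F t - F 0) \<le> 0"
    proof (rule field_le_epsilon)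
      fix e :: real assume "e > 0"
      then have "norm (F t - F 0) \<le> e / (t + 1) * t" using t by (intro *) simp
      also have "\<dots> \<le> e" using t \<open>e > 0\<close> by (simp add: field_simps)
      finally show "norm (F t - F 0) \<le> 0 + e" by simp
    qed
    then show ?thesis by (simp add: F_def SD(2) RD(2))
  qed
  have "closed {x. S t x = R t x}"
    by (intro closed_Collect_eq linear_continuous_on SD RD t)
  then have "closure (Domain (generator R)) \<subseteq> {x. S t x = R t x}"
    by (intro closure_minimal) (auto simp: eq)
  then show ?thesis using generator_dense[OF R] by auto
qed

section \<open>Square integrable functions\<close>

text \<open>The minimiser of \<open>(norm u)\<^sup>2 - 2 * l u\<close> represents \<open>l\<close>:
  a minimising sequence is Cauchy by the parallelogram law, and the first variation vanishes at its
  limit. It links the abstract functionals of a finite-rank operator to weak convergence, which is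
  tested with inner products.\<close>

theorem riesz_representation:
  fixes l :: "'a::{real_inner, complete_space} \<Rightarrow> real"
  assumes l: "bounded_linear l"
  shows "\<exists>e. \<forall>u. l u = inner u e"
proof -
  interpret bounded_linear l by (rule l)
  obtain K where K: "\<And>u. \<bar>l u\<bar> \<le> norm u * K" using bounded by auto
  define J where "J u = (norm u)\<^sup>2 - 2 * l u" for u
  have lower: "- (K\<^sup>2) \<le> J u" for u
  proof -
    have "0 \<le> (norm u - K)\<^sup>2" by simp
    then show ?thesis using K[of u] unfolding J_def power2_diff by (simp add: algebra_simps)
  qed
  have bdd: "bdd_below (range J)" using lower by (intro bdd_belowI) auto
  define m where "m = Inf (range J)"
  have m: "m \<le> J u" for u unfolding m_def using bdd by (rule cInf_lower[rotated]) simp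
  have "\<exists>u. J u < m + 1 / real (Suc n)" for n
    using cInf_lessD[of "range J" "m + 1 / real (Suc n)"] by (auto simp: m_def)
  then obtain u where u: "\<And>n. J (u n) < m + 1 / real (Suc n)" by metis
  have para: "(norm (a - b))\<^sup>2 \<le> 2 * (J a - m) + 2 * (J b - m)" for a b
  proof -
    have "(norm (a - b))\<^sup>2 = 2 * J a + 2 * J b - 4 * J ((1/2) *\<^sub>R (a + b))"
      unfolding J_def power2_norm_eq_inner
      by (simp add: scale add inner_diff_left inner_diff_right inner_add_left inner_add_right
          inner_commute algebra_simps)
    then show ?thesis using m[of "(1/2) *\<^sub>R (a + b)"] by simp
  qed
  have "Cauchy u"
    unfolding Cauchy_def
  proof (intro allI impI)
    fix e :: real assume e: "e > 0"
    obtain N :: nat where N: "4 / e\<^sup>2 < real N" using reals_Archimedean2 by blast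
    have N': "1 / real (Suc n) < e\<^sup>2 / 4" if "n \<ge> N" for n
    proof -
      have "4 / e\<^sup>2 < real (Suc n)" using N that by simp
      then show ?thesis using e by (simp add: field_simps)
    qed
    show "\<exists>M. \<forall>i\<ge>M. \<forall>j\<ge>M. dist (u i) (u j) < e"
    proof (intro exI[of _ N] allI impI)
      fix i j assume "i \<ge> N" "j \<ge> N"
      then have "J (u i) < m + e\<^sup>2 / 4" "J (u j) < m + e\<^sup>2 / 4"
        using less_trans[OF u add_strict_left_mono[OF N']] by blast+
      then have "(norm (u i - u j))\<^sup>2 < e\<^sup>2"
        using para[of "u i" "u j"] by argo
      then show "dist (u i) (u j) < e" using e by (simp add: dist_norm power2_less_imp_less)
    qed
  qed
  then obtain e where e: "u \<longlonglongrightarrow> e" using Cauchy_convergent convergent_def by blast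
  have "(\<lambda>n. J (u n)) \<longlonglongrightarrow> J e"
    unfolding J_def by (intro tendsto_intros e tendsto)
  moreover have "(\<lambda>n. m + 1 / real (Suc n)) \<longlonglongrightarrow> m + 0"
    using LIMSEQ_inverse_real_of_nat by (intro tendsto_intros) (simp add: inverse_eq_divide)
  ultimately have "J e \<le> m + 0"
    using u by (intro LIMSEQ_le) (auto intro!: exI[of _ 0] less_imp_le)
  then have min: "J e \<le> J w" for w using m[of w] by simp
  have "l w = inner w e" for w
  proof -
    have quad: "0 \<le> 2 * t * (inner w e - l w) + t\<^sup>2 * (norm w)\<^sup>2" for t
    proof -
      have "J (e + t *\<^sub>R w) = J e + 2 * t * (inner w e - l w) + t\<^sup>2 * (norm w)\<^sup>2"
        unfolding J_def power2_norm_eq_inner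
        by (simp add: scale add inner_add_left inner_add_right inner_commute algebra_simps power2_eq_square)
      then show ?thesis using min[of "e + t *\<^sub>R w"] by simp
    qed
    define d where "d = inner w e - l w"
    \<comment> \<open>\<open>t = - d / q\<close> is the minimiser of the quadratic with
      \<open>(norm w)\<^sup>2\<close> replaced by \<open>q\<close>; the added 1 keeps the
      denominator positive when \<open>w = 0\<close>.\<close>
    define q where "q = (norm w)\<^sup>2 + 1"
    have "0 \<le> 2 * (- d / q) * d + (- d / q)\<^sup>2 * (q - 1)"
      using quad[of "- d / q"] by (simp add: d_def q_def)
    moreover have q: "q \<ge> 1" by (simp add: q_def)
    moreover from q have "2 * (- d / q) * d + (- d / q)\<^sup>2 * (q - 1) = - (d\<^sup>2 * (q + 1) / q\<^sup>2)"
      by (simp add: field_simps power2_eq_square)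
    ultimately have "d\<^sup>2 * (q + 1) / q\<^sup>2 \<le> 0" by simp
    then have "d\<^sup>2 \<le> 0" using q by (simp add: divide_le_0_iff mult_le_0_iff)
    then show ?thesis by (simp add: d_def)
  qed
  then show ?thesis by blast
qed

section \<open>The L^2 seminorm and Cauchy--Schwarz inequalities\<close>

definition l2norm :: "'a measure \<Rightarrow> ('a \<Rightarrow> 'b::real_normed_vector) \<Rightarrow> real" where
  "l2norm M f = sqrt (\<integral>x. (norm (f x))\<^sup>2 \<partial>M)"

lemma l2norm_nonneg [simp]: "0 \<le> l2norm M f"
  by (simp add: l2norm_def)

lemma power2_l2norm: "(l2norm M f)\<^sup>2 = (\<integral>x. (norm (f x))\<^sup>2 \<partial>M)"
  by (simp add: l2norm_def)

lemma square_integrableD: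
  assumes "square_integrable M f"
  shows "f \<in> borel_measurable M" "integrable M (\<lambda>x. (norm (f x))\<^sup>2)"
  using assms by (simp_all add: square_integrable_def)

lemma square_integrable_norm:
  "square_integrable M f \<Longrightarrow> square_integrable M (\<lambda>x. norm (f x))"
  unfolding square_integrable_def by (intro conjI borel_measurable_norm) auto

lemma square_integrable_bound:
  fixes f :: "'a \<Rightarrow> 'b::{real_normed_vector, second_countable_topology}" and g :: "'a \<Rightarrow> real"
  assumes g: "square_integrable M g" and f: "f \<in> borel_measurable M"
    and le: "AE x in M. norm (f x) \<le> g x"
  shows "square_integrable M f"
proof -
  have "integrable M (\<lambda>x. (norm (f x))\<^sup>2)"
  proof (rule Bochner_Integration.integrable_bound[OF square_integrableD(2)[OF g]])
    show "AE x in M. norm ((norm (f x))\<^sup>2) \<le> norm ((norm (g x))\<^sup>2)"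
      using le
    proof eventually_elim
      case (elim x)
      then have "(norm (f x))\<^sup>2 \<le> (g x)\<^sup>2" by (intro power_mono) auto
      then show ?case by simp
    qed
  qed (use f in measurable)
  with f show ?thesis by (simp add: square_integrable_def)
qed

lemma square_integrable_vector_diff:
  fixes f g :: "'a \<Rightarrow> 'b::{real_normed_vector, second_countable_topology}"
  assumes "square_integrable M f" "square_integrable M g"
  shows "square_integrable M (\<lambda>x. f x - g x)"
  using square_integrable_add[OF assms[THEN square_integrable_norm]]
  by (rule square_integrable_bound)
    (use assms[THEN square_integrableD(1)] in \<open>auto intro: norm_triangle_ineq4\<close>)

lemma square_integrable_const:
  "finite_measure M \<Longrightarrow> square_integrable M (\<lambda>_. c)"
  by (simp add: square_integrable_def finite_measure.integrable_const)

lemma square_integrable_integrable: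
  fixes f :: "'a \<Rightarrow> 'b::{banach, second_countable_topology}"
  assumes "finite_measure M" "square_integrable M f"
  shows "integrable M f"
  using square_integrable_mult[OF square_integrable_norm[OF assms(2)] square_integrable_const[OF assms(1), of 1]]
    square_integrableD(1)[OF assms(2)]
  by (simp add: integrable_norm_iff)

lemma l2norm_mono:
  assumes "square_integrable M g" and "f \<in> borel_measurable M"
    and "AE x in M. norm (f x) \<le> norm (g x)"
  shows "l2norm M f \<le> l2norm M g"
  unfolding l2norm_def
proof (intro real_sqrt_le_mono integral_mono_AE' square_integrableD assms)
  show "AE x in M. (norm (f x))\<^sup>2 \<le> (norm (g x))\<^sup>2"
    using assms(3) by eventually_elim (simp add: power_mono)
qed simp

text \<open>The quadratic \<open>A + 2 * t * I + t\<^sup>2 * B\<close> is nonnegative, so its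
  discriminant is not positive; \<open>t = - I / B\<close> makes this explicit. If
  \<open>B = 0\<close>, then \<open>g\<close> and with it the product vanish almost
  everywhere.\<close>

lemma integral_mult_le_l2norm:
  fixes f g :: "'a \<Rightarrow> real"
  assumes f: "square_integrable M f" and g: "square_integrable M g"
  shows "(\<integral>x. \<bar>f x * g x\<bar> \<partial>M) \<le> l2norm M f * l2norm M g"
proof -
  define A B I where "A = (\<integral>x. (f x)\<^sup>2 \<partial>M)" and "B = (\<integral>x. (g x)\<^sup>2 \<partial>M)" and "I = (\<integral>x. \<bar>f x * g x\<bar> \<partial>M)"
  have int: "integrable M (\<lambda>x. (f x)\<^sup>2)" "integrable M (\<lambda>x. (g x)\<^sup>2)" "integrable M (\<lambda>x. \<bar>f x * g x\<bar>)"
    using square_integrableD[OF f] square_integrableD[OF g] square_integrable_mult[OF f g] by auto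
  have quad: "0 \<le> A + 2 * t * I + t\<^sup>2 * B" for t
  proof -
    have "0 \<le> (\<integral>x. (\<bar>f x\<bar> + t * \<bar>g x\<bar>)\<^sup>2 \<partial>M)" by simp
    also have "(\<lambda>x. (\<bar>f x\<bar> + t * \<bar>g x\<bar>)\<^sup>2) = (\<lambda>x. (f x)\<^sup>2 + 2 * t * \<bar>f x * g x\<bar> + t\<^sup>2 * (g x)\<^sup>2)"
      by (auto simp: power2_sum power_mult_distrib abs_mult)
    also have "(\<integral>x. \<dots> x \<partial>M) = A + 2 * t * I + t\<^sup>2 * B"
      using int by (simp add: A_def B_def I_def)
    finally show ?thesis .
  qed
  have nonneg: "A \<ge> 0" "B \<ge> 0" "I \<ge> 0" by (simp_all add: A_def B_def I_def)
  have "I\<^sup>2 \<le> A * B"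
  proof (cases "B = 0")
    case True
    have "AE x in M. (g x)\<^sup>2 = 0"
      using True int(2) unfolding B_def by (subst (asm) integral_nonneg_eq_0_iff_AE) auto
    then have "AE x in M. \<bar>f x * g x\<bar> = 0" by eventually_elim simp
    then have "I = 0" unfolding I_def by (rule integral_eq_zero_AE)
    then show ?thesis using True by simp
  next
    case False
    then have B: "B > 0" using nonneg by simp
    have "0 \<le> A + 2 * (- I / B) * I + (- I / B)\<^sup>2 * B" by (rule quad)
    also have "\<dots> = A - I\<^sup>2 / B" using B by (simp add: field_simps power2_eq_square)
    finally show ?thesis using B by (simp add: field_simps)
  qed
  then have "I \<le> sqrt (A * B)" by (rule real_le_rsqrt)
  then show ?thesis by (simp add: l2norm_def A_def B_def I_def real_sqrt_mult)
qed

lemma square_integrable_inner: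
  fixes f g :: "'a \<Rightarrow> 'b::{real_inner, second_countable_topology}"
  assumes f: "square_integrable M f" and g: "square_integrable M g"
  shows "integrable M (\<lambda>x. inner (f x) (g x))"
    and "\<bar>\<integral>x. inner (f x) (g x) \<partial>M\<bar> \<le> l2norm M f * l2norm M g"
proof -
  note fg = square_integrable_norm[OF f] square_integrable_norm[OF g]
  have le: "\<bar>inner (f x) (g x)\<bar> \<le> \<bar>norm (f x) * norm (g x)\<bar>" for x
    using Cauchy_Schwarz_ineq2[of "f x" "g x"] by simp
  show int: "integrable M (\<lambda>x. inner (f x) (g x))"
  proof (rule Bochner_Integration.integrable_bound[OF square_integrable_mult[OF fg]])
    show "(\<lambda>x. inner (f x) (g x)) \<in> borel_measurable M"
      by (intro borel_measurable_inner square_integrableD f g)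
  qed (use le in auto)
  have "\<bar>\<integral>x. inner (f x) (g x) \<partial>M\<bar> \<le> (\<integral>x. \<bar>inner (f x) (g x)\<bar> \<partial>M)"
    by (rule integral_abs_bound)
  also have "\<dots> \<le> (\<integral>x. \<bar>norm (f x) * norm (g x)\<bar> \<partial>M)"
    using int square_integrable_mult[OF fg] le by (intro integral_mono) auto
  also have "\<dots> \<le> l2norm M (\<lambda>x. norm (f x)) * l2norm M (\<lambda>x. norm (g x))"
    by (rule integral_mult_le_l2norm[OF fg])
  finally show "\<bar>\<integral>x. inner (f x) (g x) \<partial>M\<bar> \<le> l2norm M f * l2norm M g"
    by (simp add: l2norm_def)
qed

lemma square_integrable_scaleR_vector:
  "square_integrable M f \<Longrightarrow> square_integrable M (\<lambda>x. c *\<^sub>R f x)"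
  by (auto simp: square_integrable_def power_mult_distrib)

lemma l2norm_scaleR: "l2norm M (\<lambda>x. c *\<^sub>R f x) = \<bar>c\<bar> * l2norm M f"
  by (simp add: l2norm_def power_mult_distrib real_sqrt_mult)

section \<open>Boundedness of weakly convergent sequences\<close>

text \<open>The weights \<open>2\<^sup>k\<close> give \<open>(\<Sum>k. \<parallel>a k\<parallel>)\<^sup>2 \<le> 2 * (\<Sum>k. 2\<^sup>k \<parallel>a k\<parallel>\<^sup>2)\<close>, whose right-hand side is integrable.\<close>
lemma l2norm_summable_series:
  fixes a :: "nat \<Rightarrow> 'a \<Rightarrow> 'b::{real_inner, banach, second_countable_topology}"
  assumes a: "\<And>k. square_integrable M (a k)" and le: "\<And>k. l2norm M (a k) \<le> (1/3) ^ k"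
  obtains \<phi> where "square_integrable M \<phi>"
    "\<And>u. square_integrable M u \<Longrightarrow>
      (\<lambda>n. \<Sum>k<n. \<integral>x. inner (u x) (a k x) \<partial>M) \<longlonglongrightarrow> (\<integral>x. inner (u x) (\<phi> x) \<partial>M)"
proof -
  have [measurable]: "a k \<in> borel_measurable M" for k by (rule square_integrableD[OF a])
  define h where "h k x = 2 ^ k * (norm (a k x))\<^sup>2" for k x
  have h_int: "integrable M (h k)" for k
    unfolding h_def using square_integrableD(2)[OF a] by simp
  have h_le: "(\<integral>x. h k x \<partial>M) \<le> (2/9) ^ k" for k
  proof -
    have "(\<integral>x. h k x \<partial>M) = 2 ^ k * (l2norm M (a k))\<^sup>2"
      by (simp add: h_def power2_l2norm)
    also have "\<dots> \<le> 2 ^ k * ((1/3) ^ k)\<^sup>2"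
      by (intro mult_left_mono power_mono le) auto
    also have "\<dots> = (2/9) ^ k"
      by (simp add: power2_eq_square power_mult_distrib[symmetric] power_divide)
    finally show ?thesis .
  qed
  have h0: "h k x \<ge> 0" for k x by (simp add: h_def)
  have summ_int: "summable (\<lambda>k. \<integral>x. norm (h k x) \<partial>M)"
    using h_le h0 by (intro summable_comparison_test'[OF summable_geometric[of "2/9::real"]]) auto
  have h_sum: "AE x in M. summable (\<lambda>k. h k x)"
  proof -
    have "(\<integral>\<^sup>+x. (\<Sum>k. ennreal (h k x)) \<partial>M) = (\<Sum>k. \<integral>\<^sup>+x. ennreal (h k x) \<partial>M)"
      by (intro nn_integral_suminf) (simp add: h_def)
    also have "\<dots> = (\<Sum>k. ennreal (\<integral>x. norm (h k x) \<partial>M))"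
      using h0 h_int by (simp add: nn_integral_eq_integral)
    also have "\<dots> < \<infinity>"
      using summ_int by (subst suminf_ennreal2) auto
    finally have "AE x in M. (\<Sum>k. ennreal (h k x)) \<noteq> \<infinity>"
      by (intro nn_integral_PInf_AE) (auto simp: h_def)
    then show ?thesis by eventually_elim (auto intro: summable_suminf_not_top[OF h0])
  qed
  define g where "g x = (\<Sum>k. h k x)" for x
  have g_int: "integrable M g"
    unfolding g_def using h_int h_sum summ_int h0 by (intro integrable_suminf) auto
  have g0: "AE x in M. g x \<ge> 0"
    using h_sum by eventually_elim (simp add: g_def suminf_nonneg h0)
  \<comment> \<open>Cauchy--Schwarz after writing \<open>norm (a k x)\<close> as
    \<open>sqrt ((1/2) ^ k) * sqrt (h k x)\<close>. The bound is free of \<open>n\<close>, so it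
    gives absolute convergence of the series and a dominating function for its partial sums.\<close>
  have partial: "(\<Sum>k<n. norm (a k x)) \<le> sqrt (2 * g x)" if "summable (\<lambda>k. h k x)" for n x
  proof (rule real_le_rsqrt)
    have "(\<Sum>k<n. norm (a k x))\<^sup>2 = (\<Sum>k<n. sqrt ((1/2) ^ k) * sqrt (h k x))\<^sup>2"
      by (simp add: h_def real_sqrt_mult[symmetric] power_divide)
    also have "\<dots> \<le> (\<Sum>k<n. (sqrt ((1/2) ^ k))\<^sup>2) * (\<Sum>k<n. (sqrt (h k x))\<^sup>2)"
      by (rule Cauchy_Schwarz_ineq_sum)
    also have "\<dots> = (\<Sum>k<n. (1/2) ^ k) * (\<Sum>k<n. h k x)"
      using h0 by simp
    also have "\<dots> \<le> 2 * g x"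
    proof (rule mult_mono)
      have "(\<Sum>k<n. (1/2::real) ^ k) \<le> (\<Sum>k. (1/2) ^ k)"
        by (intro sum_le_suminf summable_geometric) auto
      then show "(\<Sum>k<n. (1/2::real) ^ k) \<le> 2" by (simp add: suminf_geometric)
      show "(\<Sum>k<n. h k x) \<le> g x" unfolding g_def using that h0 by (intro sum_le_suminf) auto
    qed (auto intro: sum_nonneg h0)
    finally show "(\<Sum>k<n. norm (a k x))\<^sup>2 \<le> 2 * g x" .
  qed
  have a_sum: "AE x in M. summable (\<lambda>k. norm (a k x))"
    using h_sum
  proof eventually_elim
    case (elim x)
    show ?case by (rule bounded_imp_summable[of _ "sqrt (2 * g x)"])
        (use partial[OF elim, of "Suc _"] in \<open>auto simp: lessThan_Suc_atMost\<close>)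
  qed
  define \<phi> where "\<phi> x = (\<Sum>k. a k x)" for x
  have [measurable]: "\<phi> \<in> borel_measurable M" unfolding \<phi>_def by measurable
  have bd: "AE x in M. \<forall>n. norm (\<Sum>k<n. a k x) \<le> sqrt (2 * g x)"
    using h_sum
    by eventually_elim (auto intro: order_trans[OF norm_sum partial])
  have lim: "AE x in M. (\<lambda>n. \<Sum>k<n. a k x) \<longlonglongrightarrow> \<phi> x"
    using a_sum by eventually_elim (simp add: \<phi>_def summable_LIMSEQ summable_norm_cancel)
  have \<phi>_bd: "AE x in M. norm (\<phi> x) \<le> sqrt (2 * g x)"
    using bd lim
    by eventually_elim (auto intro: tendsto_upperbound[OF tendsto_norm] always_eventually)
  have g_sq: "square_integrable M (\<lambda>x. sqrt (2 * g x))"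
    unfolding square_integrable_def
  proof
    show "(\<lambda>x. sqrt (2 * g x)) \<in> borel_measurable M" using g_int by measurable
    have "AE x in M. 2 * g x = (norm (sqrt (2 * g x)))\<^sup>2" using g0 by eventually_elim simp
    then show "integrable M (\<lambda>x. (norm (sqrt (2 * g x)))\<^sup>2)"
      using g_int by (subst integrable_cong_AE[symmetric, where f="\<lambda>x. 2 * g x"]) auto
  qed
  show thesis
  proof (rule that)
    show "square_integrable M \<phi>" by (rule square_integrable_bound[OF g_sq _ \<phi>_bd]) simp
    fix u :: "'a \<Rightarrow> 'b" assume u: "square_integrable M u"
    have [measurable]: "u \<in> borel_measurable M" by (rule square_integrableD[OF u])
    have "(\<lambda>n. \<integral>x. inner (u x) (\<Sum>k<n. a k x) \<partial>M) \<longlonglongrightarrow> (\<integral>x. inner (u x) (\<phi> x) \<partial>M)"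
    proof (rule integral_dominated_convergence)
      show "integrable M (\<lambda>x. norm (u x) * sqrt (2 * g x))"
        by (rule square_integrable_mult[OF square_integrable_norm[OF u] g_sq])
      show "AE x in M. (\<lambda>n. inner (u x) (\<Sum>k<n. a k x)) \<longlonglongrightarrow> inner (u x) (\<phi> x)"
        using lim by eventually_elim (intro tendsto_intros)
      show "AE x in M. norm (inner (u x) (\<Sum>k<n. a k x)) \<le> norm (u x) * sqrt (2 * g x)" for n
        using bd
      proof eventually_elim
        case (elim x)
        show ?case unfolding real_norm_def
          by (rule order_trans[OF Cauchy_Schwarz_ineq2]) (use elim in \<open>auto intro: mult_left_mono\<close>)
      qed
    qed measurable
    moreover have "(\<integral>x. inner (u x) (\<Sum>k<n. a k x) \<partial>M) = (\<Sum>k<n. \<integral>x. inner (u x) (a k x) \<partial>M)" for n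
      unfolding inner_sum_right by (rule Bochner_Integration.integral_sum) (rule square_integrable_inner[OF u a])
    ultimately show "(\<lambda>n. \<Sum>k<n. \<integral>x. inner (u x) (a k x) \<partial>M) \<longlonglongrightarrow> (\<integral>x. inner (u x) (\<phi> x) \<partial>M)"
      by simp
  qed
qed

text \<open>Gliding hump.\<close>
theorem weakly_converges_bounded:
  fixes u :: "nat \<Rightarrow> 'a \<Rightarrow> 'b::{real_inner, banach, second_countable_topology}"
  assumes weak: "weakly_converges M u w"
  shows "\<exists>C. \<forall>n. l2norm M (u n) \<le> C"
proof (rule ccontr)
  assume contra: "\<not> ?thesis"
  have u: "square_integrable M (u n)" for n using weak by (simp add: weakly_converges_def)
  \<comment> \<open>The threshold is what the final estimate consumes: the diagonal term has size
    \<open>(1/3) ^ k * N k\<close>, the later terms destroy at most half of it, and at least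
    \<open>real k + 1\<close> has to survive.\<close>
  have "\<exists>n. 2 * (real k + 1) * 3 ^ k < l2norm M (u n)" for k
    using contra by (meson not_le)
  then obtain m where m: "\<And>k. 2 * (real k + 1) * 3 ^ k < l2norm M (u (m k))" by metis
  define N where "N k = l2norm M (u (m k))" for k
  have N: "N k > 0" for k
    using m[of k] unfolding N_def by (rule le_less_trans[rotated]) simp
  define a where "a k x = ((1/3) ^ k / N k) *\<^sub>R u (m k) x" for k x
  have a: "square_integrable M (a k)" for k
    unfolding a_def by (rule square_integrable_scaleR_vector[OF u])
  have a_norm: "l2norm M (a k) = (1/3) ^ k" for k
    unfolding a_def l2norm_scaleR using N[of k] by (simp add: N_def[symmetric])
  define c where "c k j = (\<integral>x. inner (u (m k) x) (a j x) \<partial>M)" for k j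
  have c_diag: "c k k = (1/3) ^ k * N k" for k
    using N[of k] power2_l2norm[of M "u (m k)", symmetric]
    by (simp add: c_def a_def power2_norm_eq_inner[symmetric] N_def[symmetric] power2_eq_square)
  have c_le: "\<bar>c k j\<bar> \<le> N k * (1/3) ^ j" for k j
    using square_integrable_inner(2)[OF u a, of "m k" j] by (simp add: c_def N_def a_norm)
  \<comment> \<open>The signs are chosen recursively so that the sum of the earlier terms never
    opposes the diagonal term \<open>s k * c k k\<close>. Its size is then irrelevant.\<close>
  have "\<exists>s :: nat \<Rightarrow> real. \<forall>k. \<bar>s k\<bar> = 1 \<and> 0 \<le> s k * (\<Sum>j<k. s j * c k j)"
  proof (rule dependent_wellorder_choice)
    fix r :: real and f g :: "nat \<Rightarrow> real" and k
    assume "\<And>j. j < k \<Longrightarrow> f j = g j"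
    then show "(\<bar>r\<bar> = 1 \<and> 0 \<le> r * (\<Sum>j<k. f j * c k j)) = (\<bar>r\<bar> = 1 \<and> 0 \<le> r * (\<Sum>j<k. g j * c k j))"
      by simp
  next
    fix k and f :: "nat \<Rightarrow> real"
    show "\<exists>r::real. \<bar>r\<bar> = 1 \<and> 0 \<le> r * (\<Sum>j<k. f j * c k j)"
      by (cases "0 \<le> (\<Sum>j<k. f j * c k j)") (auto intro: exI[of _ 1] exI[of _ "- 1"])
  qed
  then obtain s :: "nat \<Rightarrow> real" where s: "\<And>k. \<bar>s k\<bar> = 1" "\<And>k. 0 \<le> s k * (\<Sum>j<k. s j * c k j)"
    by blast
  obtain \<phi> where \<phi>: "square_integrable M \<phi>"
    and lim: "\<And>u. square_integrable M u \<Longrightarrow>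
      (\<lambda>n. \<Sum>k<n. \<integral>x. inner (u x) (s k *\<^sub>R a k x) \<partial>M) \<longlonglongrightarrow> (\<integral>x. inner (u x) (\<phi> x) \<partial>M)"
    using l2norm_summable_series[of M "\<lambda>k x. s k *\<^sub>R a k x"]
    by (auto simp: l2norm_scaleR s a_norm intro: square_integrable_scaleR_vector a)
  have big: "real k + 1 \<le> \<bar>\<integral>x. inner (u (m k) x) (\<phi> x) \<partial>M\<bar>" for k
  proof -
    have "(\<lambda>n. \<bar>\<Sum>j<n. s j * c k j\<bar>) \<longlonglongrightarrow> \<bar>\<integral>x. inner (u (m k) x) (\<phi> x) \<partial>M\<bar>"
      using tendsto_rabs[OF lim[OF u[of "m k"]]] by (simp add: c_def)
    moreover have "real k + 1 \<le> \<bar>\<Sum>j<n. s j * c k j\<bar>" if n: "n > k" for n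
    proof -
      \<comment> \<open>Diagonal, earlier and later terms. Only the later ones are estimated, by the
        geometric tail \<open>(1/3) ^ k / 2\<close>.\<close>
      have split: "(\<Sum>j<n. s j * c k j) = s k * c k k + (\<Sum>j<k. s j * c k j) + (\<Sum>j\<in>{k<..<n}. s j * c k j)"
        using n sum.atLeastLessThan_concat[of 0 k n "\<lambda>j. s j * c k j"]
          sum.atLeast_Suc_lessThan[of k n "\<lambda>j. s j * c k j"]
        by (simp add: lessThan_atLeast0 atLeastSucLessThan_greaterThanLessThan)
      have "\<bar>\<Sum>j\<in>{k<..<n}. s j * c k j\<bar> \<le> (\<Sum>j\<in>{k<..<n}. N k * (1/3) ^ j)"
        by (rule order_trans[OF sum_abs]) (auto simp: abs_mult s intro!: sum_mono c_le)
      also have "\<dots> = N k * (\<Sum>j\<in>{Suc k..<n}. (1/3) ^ j)"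
        by (simp add: sum_distrib_left atLeastSucLessThan_greaterThanLessThan)
      also have "(\<Sum>j\<in>{Suc k..<n}. (1/3::real) ^ j) \<le> (1/3) ^ k / 2"
      proof -
        define r :: real where "r = 1/3"
        have r: "3 * (r * y) = y" "r \<ge> 0" for y by (simp_all add: r_def)
        have "(\<Sum>j\<in>{Suc k..<n}. r ^ j) = (r ^ k - 3 * r ^ n) / 2"
          using Suc_leI[OF n] by (induction rule: dec_induct) (simp_all add: r)
        then have "(\<Sum>j\<in>{Suc k..<n}. r ^ j) \<le> r ^ k / 2" using r(2) by simp
        then show ?thesis unfolding r_def .
      qed
      finally have tail: "\<bar>\<Sum>j\<in>{k<..<n}. s j * c k j\<bar> \<le> N k * ((1/3) ^ k / 2)"
        using N[of k] by (simp add: mult_left_mono)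
      have "\<bar>s k * c k k + (\<Sum>j<k. s j * c k j)\<bar> = \<bar>c k k + s k * (\<Sum>j<k. s j * c k j)\<bar>"
      proof -
        have "s k * s k = 1" using s(1)[of k] by (auto simp: abs_if split: if_splits)
        then have "c k k + s k * (\<Sum>j<k. s j * c k j) = s k * (s k * c k k + (\<Sum>j<k. s j * c k j))"
          by (simp add: algebra_simps)
        then show ?thesis by (simp add: abs_mult s)
      qed
      moreover have "c k k \<le> \<bar>c k k + s k * (\<Sum>j<k. s j * c k j)\<bar>" using s(2)[of k] by linarith
      ultimately have "c k k - N k * ((1/3) ^ k / 2) \<le> \<bar>\<Sum>j<n. s j * c k j\<bar>"
        using tail unfolding split by linarith
      moreover have "real k + 1 \<le> c k k - N k * ((1/3) ^ k / 2)"
        using m[of k] unfolding c_diag N_def[symmetric] by (simp add: power_divide field_simps)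
      ultimately show ?thesis by linarith
    qed
    ultimately show ?thesis
      by (rule tendsto_lowerbound[OF _ eventually_mono[OF eventually_gt_at_top[of k]]]) auto
  qed
  have "convergent (\<lambda>n. \<integral>x. inner (u n x) (\<phi> x) \<partial>M)"
    using weak \<phi> unfolding weakly_converges_def by (auto intro: convergentI)
  then obtain C where C: "\<And>n. \<bar>\<integral>x. inner (u n x) (\<phi> x) \<partial>M\<bar> \<le> C"
    by (force dest!: convergent_imp_Bseq simp: Bseq_def)
  obtain k :: nat where "C \<le> real k" using real_arch_simple by blast
  with big[of k] C[of "m k"] show False by linarith
qed

section \<open>Multiplication by Sobolev functions on the circle\<close>

lemma C_k_const: "C_k k (\<lambda>x. c)"
  by (induction k arbitrary: c) simp_all

lemma C_k_SucD: "C_k (Suc k) f \<Longrightarrow> C_k k f"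
proof (induction k arbitrary: f)
  case 0
  then show ?case
    by (auto simp: continuous_on_eq_continuous_at differentiable_imp_continuous_within)
qed simp

lemma C_k_add: "C_k k f \<Longrightarrow> C_k k g \<Longrightarrow> C_k k (\<lambda>x. f x + g x)"
proof (induction k arbitrary: f g)
  case 0 then show ?case by (auto intro: continuous_intros)
next
  case (Suc k)
  have "frechet_derivative (\<lambda>x. f x + g x) (at x) = (\<lambda>h. frechet_derivative f (at x) h + frechet_derivative g (at x) h)" for x
    using Suc.prems by (intro frechet_derivative_at[symmetric] has_derivative_add)
      (simp_all add: frechet_derivative_works[symmetric])
  with Suc show ?case by simp
qed

lemma C_k_mult: "C_k k f \<Longrightarrow> C_k k g \<Longrightarrow> C_k k (\<lambda>x. f x * g x)"
proof (induction k arbitrary: f g)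
  case 0 then show ?case by (auto intro: continuous_intros)
next
  case (Suc k)
  have "frechet_derivative (\<lambda>x. f x * g x) (at x) =
      (\<lambda>h. f x * frechet_derivative g (at x) h + frechet_derivative f (at x) h * g x)" for x
    using Suc.prems by (intro frechet_derivative_at[symmetric] has_derivative_mult)
      (simp_all add: frechet_derivative_works[symmetric])
  with Suc show ?case by (simp add: C_k_add C_k_SucD[OF Suc.prems(1)] C_k_SucD[OF Suc.prems(2)])
qed

lemma frechet_derivative_real:
  "(f has_real_derivative d) (at x) \<Longrightarrow> frechet_derivative f (at x) h = d * h"
  by (subst frechet_derivative_at[of f "(*) d", symmetric]) (simp_all add: has_field_derivative_def)

text \<open>In one variable every directional derivative is a constant multiple of the ordinary one,
  so regularity of the single function \<open>p\<close> suffices.\<close>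

lemma C_k_antiderivative:
  assumes "\<And>x. (F has_real_derivative p x) (at x)" and "C_k k p"
  shows "C_k (Suc k) F"
  using assms(2) real_differentiable_def[THEN iffD2, OF exI, OF assms(1)]
  by (simp add: frechet_derivative_real[OF assms(1)] C_k_mult C_k_const)

text \<open>Differentiation sends the coefficient pair \<open>(A, B)\<close> to
  \<open>(a * B, - (a * A))\<close>. The family is closed under it, which is why the induction lets
  both coefficients vary.\<close>

lemma C_k_sinusoid: "C_k k (\<lambda>x. A * cos (a * x) + B * sin (a * x))"
proof (induction k arbitrary: A B)
  case 0 then show ?case by (auto intro!: continuous_intros)
next
  case (Suc k)
  show ?case
    by (rule C_k_antiderivative[OF _ Suc[of "a * B" "- (a * A)"]])
      (auto intro!: derivative_eq_intros simp: algebra_simps)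
qed

lemma smooth_circle_sinusoid: "smooth_circle (\<lambda>x. A * cos (2 * pi * x) + B * sin (2 * pi * x))"
  unfolding smooth_circle_def smooth_def
proof (intro conjI allI C_k_sinusoid)
  fix x :: real
  have "2 * pi * (x + 1) = 2 * pi * x + 2 * pi" by (simp add: algebra_simps)
  then show "A * cos (2 * pi * (x + 1)) + B * sin (2 * pi * (x + 1)) = A * cos (2 * pi * x) + B * sin (2 * pi * x)"
    by (simp only: sin_periodic cos_periodic)
qed

lemma smooth_circle_const: "smooth_circle (\<lambda>x. c)"
  and smooth_circle_add: "smooth_circle f \<Longrightarrow> smooth_circle g \<Longrightarrow> smooth_circle (\<lambda>x. f x + g x)"
  and smooth_circle_mult: "smooth_circle f \<Longrightarrow> smooth_circle g \<Longrightarrow> smooth_circle (\<lambda>x. f x * g x)"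
  by (simp_all add: smooth_circle_def smooth_def C_k_const C_k_add C_k_mult)

lemma smooth_circle_continuous: "smooth_circle p \<Longrightarrow> continuous_on A p"
proof -
  assume "smooth_circle p"
  then have "C_k 0 p" unfolding smooth_circle_def smooth_def by blast
  then show ?thesis by (auto intro: continuous_on_subset)
qed

text \<open>Stone--Weierstrass on the unit circle of the complex plane, parametrised by \<open>cis (2 * pi * x)\<close>.\<close>
lemma smooth_circle_dense:
  assumes \<psi>: "continuous_on {0..1} \<psi>" and per: "\<psi> 0 = \<psi> 1" and e: "e > 0"
  shows "\<exists>p. smooth_circle p \<and> (\<forall>x\<in>{0..1}. \<bar>\<psi> x - p x\<bar> < e)"
proof -
  define q where "q x = cis (2 * pi * x)" for x
  define S where "S = sphere (0::complex) 1"
  define F where "F z = \<psi> (Arg2pi z / (2 * pi))" for z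
  have q_cont: "continuous_on A q" for A
    unfolding q_def by (intro continuous_intros)
  have Fq: "F (q x) = \<psi> x" if "x \<in> {0..1}" for x
  proof (cases "x = 1")
    case True
    have "q 1 = 1" by (simp add: q_def cis_2pi)
    moreover have "Arg2pi 1 = 0" by (rule Arg2pi_unique[of 1]) auto
    ultimately show ?thesis using True per by (simp add: F_def)
  next
    case False
    then have "Arg2pi (q x) = 2 * pi * x"
      using that by (intro Arg2pi_unique[of 1]) (auto simp: q_def cis_conv_exp)
    then show ?thesis by (simp add: F_def)
  qed
  have qS: "q ` {0..1} = S"
  proof (intro equalityI subsetI)
    fix z assume "z \<in> S"
    then have z: "norm z = 1" by (simp add: S_def)
    have "z = q (Arg2pi z / (2 * pi))"
      using Arg2pi_eq[of z] z by (simp add: q_def cis_conv_exp)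
    moreover have "Arg2pi z / (2 * pi) \<in> {0..1}"
      using Arg2pi_ge_0[of z] Arg2pi_lt_2pi[of z] by (simp add: field_simps)
    ultimately show "z \<in> q ` {0..1}" by blast
  qed (auto simp: q_def S_def)
  \<comment> \<open>\<open>Arg2pi\<close> jumps at 1, so continuity is not inherited by composition.
    Instead the preimage of a closed set is the image under \<open>q\<close> of a compact subset of
    \<open>{0..1}\<close>; \<open>\<psi> 0 = \<psi> 1\<close> is what makes
    \<open>F (q x) = \<psi> x\<close> true at both ends.\<close>
  have "continuous_on S F"
  proof (subst continuous_on_closed_vimage)
    show "closed S" by (simp add: S_def)
    show "\<forall>C. closed C \<longrightarrow> closed (F -` C \<inter> S)"
    proof (intro allI impI)
      fix C :: "real set" assume "closed C"
      then have "compact ({0..1} \<inter> \<psi> -` C)"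
        using continuous_closed_preimage[OF \<psi>, of C] by (simp add: compact_eq_bounded_closed bounded_Int)
      then have "compact (q ` ({0..1} \<inter> \<psi> -` C))" by (intro compact_continuous_image q_cont)
      also have "q ` ({0..1} \<inter> \<psi> -` C) = F -` C \<inter> S"
        unfolding qS[symmetric] using Fq by auto
      finally show "closed (F -` C \<inter> S)" by (rule compact_imp_closed)
    qed
  qed
  \<comment> \<open>The approximating algebra consists of the continuous functions on
    \<open>S\<close> whose pull-back along \<open>q\<close> is smooth and periodic. It separates
    points because \<open>Re\<close> and \<open>Im\<close> pull back to a cosine and a sine.\<close>
  then have "\<exists>g. (continuous_on S g \<and> smooth_circle (\<lambda>x. g (q x))) \<and> (\<forall>z\<in>S. \<bar>F z - g z\<bar> < e)"
  proof (intro Stone_Weierstrass_HOL[OF _ _ _ _ _ _ _ e])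
    show "compact S" by (simp add: S_def)
    fix x y :: complex assume "x \<in> S \<and> y \<in> S \<and> x \<noteq> y"
    then have "Re x \<noteq> Re y \<or> Im x \<noteq> Im y" by (auto simp: complex_eq_iff)
    moreover have "smooth_circle (\<lambda>x. Re (q x))" "smooth_circle (\<lambda>x. Im (q x))"
      using smooth_circle_sinusoid[of 1 0] smooth_circle_sinusoid[of 0 1] by (simp_all add: q_def)
    moreover have "continuous_on S Re" "continuous_on S Im" by (intro continuous_intros)+
    ultimately show "\<exists>f. (continuous_on S f \<and> smooth_circle (\<lambda>x. f (q x))) \<and> f x \<noteq> f y"
      by blast
  qed (auto intro: smooth_circle_const smooth_circle_add smooth_circle_mult continuous_intros)
  then obtain g where g: "smooth_circle (\<lambda>x. g (q x))" "\<And>z. z \<in> S \<Longrightarrow> \<bar>F z - g z\<bar> < e"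
    by blast
  show ?thesis
    using g qS Fq by (intro exI[of _ "\<lambda>x. g (q x)"]) (metis image_eqI)
qed

section \<open>From weak derivatives to primitives\<close>

lemma sigma_finite_circle: "sigma_finite_measure circle"
  by (intro finite_measure.axioms finite_measure_circle)

text \<open>The circle is realised on \<open>{0..<1}\<close> and the endpoint 1 is null. The
  right-hand side is the gauge integral, to which the fundamental theorem of calculus
  applies.\<close>

lemma integral_circle_Icc:
  fixes f :: "real \<Rightarrow> real"
  assumes "continuous_on {0..1} f" "0 \<le> a" "a \<le> 1"
  shows "(\<integral>x. indicator {a..} x * f x \<partial>circle) = integral {a..1} f"
proof -
  have cont: "continuous_on {a..1} f" using assms by (auto intro: continuous_on_subset)
  have "(\<integral>x. indicator {a..} x * f x \<partial>circle) = (\<integral>x. indicator {0..<1} x *\<^sub>R (indicator {a..} x * f x) \<partial>lborel)"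
    unfolding circle_def by (subst integral_restrict_space) (auto simp: set_lebesgue_integral_def)
  also have "\<dots> = (\<integral>x. indicator {a..1} x *\<^sub>R f x \<partial>lborel)"
  proof (rule integral_cong_AE)
    show "AE x in lborel. indicator {0..<1} x *\<^sub>R (indicator {a..} x * f x) = indicator {a..1} x *\<^sub>R f x"
      using AE_lborel_singleton[of 1] by eventually_elim (use assms in \<open>auto simp: indicator_def\<close>)
    have 1: "(\<lambda>x. indicator {a..1} x *\<^sub>R f x) \<in> borel_measurable lborel"
      using borel_integrable_atLeastAtMost'[OF cont] by (auto simp: set_integrable_def)
    then have "(\<lambda>x. indicator {0..<1} x *\<^sub>R (indicator {a..1} x *\<^sub>R f x)) \<in> borel_measurable lborel"
      by measurable
    also have "(\<lambda>x. indicator {0..<1} x *\<^sub>R (indicator {a..1} x *\<^sub>R f x)) =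
        (\<lambda>x. indicator {0..<1} x *\<^sub>R (indicator {a..} x * f x))"
      by (auto simp: indicator_def)
    finally show "(\<lambda>x. indicator {0..<1} x *\<^sub>R (indicator {a..} x * f x)) \<in> borel_measurable lborel" .
    show "(\<lambda>x. indicator {a..1} x *\<^sub>R f x) \<in> borel_measurable lborel" by (rule 1)
  qed
  also have "\<dots> = integral {a..1} f"
    using set_borel_integral_eq_integral(2)[OF borel_integrable_atLeastAtMost'[OF cont]]
    by (simp add: set_lebesgue_integral_def)
  finally show ?thesis .
qed

text \<open>The vanishing mean is exactly what makes the primitive periodic:
  \<open>\<phi> (x + 1) - \<phi> x\<close> has derivative 0, and its value at 0 is the integral of
  \<open>p\<close> over one period.\<close>

lemma smooth_circle_primitive:
  assumes p: "smooth_circle p" and mean: "(\<integral>x. p x \<partial>circle) = 0"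
  obtains \<phi> where "smooth_circle \<phi>" "\<And>x. (\<phi> has_real_derivative p x) (at x)"
proof -
  define \<phi> where "\<phi> x = (LBINT y=ereal 0..x. p y)" for x :: real
  have D: "(\<phi> has_real_derivative p x) (at x)" for x
  proof -
    define r where "r = \<bar>x\<bar> + 1"
    have "((\<lambda>u. LBINT y=ereal 0..u. p y) has_vector_derivative p x) (at x within {- r..r})"
      by (rule interval_integral_FTC2) (auto simp: r_def intro: smooth_circle_continuous[OF p])
    moreover have "at x within {- r..r} = at x"
      by (rule at_within_interior) (auto simp: r_def)
    ultimately show ?thesis
      by (simp add: \<phi>_def[abs_def] has_real_derivative_iff_has_vector_derivative)
  qed
  have "\<phi> 1 - \<phi> 0 = integral {0..1} p"
  proof (rule integral_unique[symmetric], rule fundamental_theorem_of_calculus)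
    show "(\<phi> has_vector_derivative p x) (at x within {0..1})" for x
      using D[of x] by (simp add: has_real_derivative_iff_has_vector_derivative has_vector_derivative_at_within)
  qed simp
  also have "\<dots> = (\<integral>x. indicator {0..} x * p x \<partial>circle)"
    by (rule integral_circle_Icc[symmetric]) (auto intro: smooth_circle_continuous[OF p])
  also have "\<dots> = (\<integral>x. p x \<partial>circle)"
    by (rule Bochner_Integration.integral_cong) auto
  finally have step: "\<phi> 1 = \<phi> 0" using mean by simp
  have "\<phi> (x + 1) = \<phi> x" for x
  proof -
    have "((\<lambda>x. \<phi> (x + 1) - \<phi> x) has_real_derivative 0) (at x)" for x
      using p by (auto intro!: derivative_eq_intros DERIV_chain2[OF D] D simp: smooth_circle_def)
    then have "\<phi> (x + 1) - \<phi> x = \<phi> (0 + 1) - \<phi> 0"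
      by (rule DERIV_isconst_all[rule_format, rotated -1] | blast)+
    then show ?thesis using step by simp
  qed
  moreover have "C_k k \<phi>" for k
    using C_k_SucD[OF C_k_antiderivative[OF D]] p by (simp add: smooth_circle_def smooth_def)
  ultimately have "smooth_circle \<phi>" by (simp add: smooth_circle_def smooth_def)
  then show thesis using D by (rule that)
qed

text \<open>Continuous periodic functions approximate the indicators of half lines, a Dynkin
  argument carries the vanishing integrals to all Borel sets, and a density with vanishing integral
  over every set is 0.\<close>

lemma circle_AE_zero:
  assumes k: "integrable circle k"
    and zero: "\<And>\<psi>. continuous_on {0..1} \<psi> \<Longrightarrow> \<psi> 0 = \<psi> 1 \<Longrightarrow> (\<integral>x. k x * \<psi> x \<partial>circle) = 0"
  shows "AE x in circle. k x = (0::real)"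
proof -
  have [measurable]: "k \<in> borel_measurable circle" using k by simp
  have all: "(\<integral>x. k x \<partial>circle) = 0" using zero[of "\<lambda>_. 1"] by simp
  have int: "integrable circle (\<lambda>x. indicator A x * k x)" if "A \<in> sets borel" for A
    using that by (intro Bochner_Integration.integrable_bound[OF k] borel_measurable_times
        indicator_measurable_circle borel_measurable_integrable[OF k]) (auto simp: indicator_def)
  have half: "(\<integral>x. indicator {..<a} x * k x \<partial>circle) = 0" for a
  proof (cases "a < 1")
    case False
    then have "(\<integral>x. indicator {..<a} x * k x \<partial>circle) = (\<integral>x. k x \<partial>circle)"
      by (intro Bochner_Integration.integral_cong) auto
    then show ?thesis using all by simp
  next
    case True
    \<comment> \<open>A trapezoid that rises from 0 with slope \<open>real n\<close> and returns to
      0 at \<open>a\<close>. Since \<open>a < 1\<close> it vanishes at both ends of the period and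
      is admissible; its limit differs from the indicator at most at the null point 0.\<close>
    define \<psi> where "\<psi> n x = max 0 (min 1 (real n * min x (a - x)))" for n x
    have "(\<lambda>n. \<integral>x. k x * \<psi> n x \<partial>circle) \<longlonglongrightarrow> (\<integral>x. indicator {..<a} x * k x \<partial>circle)"
    proof (rule integral_dominated_convergence)
      show "integrable circle (\<lambda>x. \<bar>k x\<bar>)" using k by simp
      have "(\<lambda>x. \<psi> n x) \<in> borel_measurable circle" for n
        unfolding \<psi>_def
        by (rule square_integrableD(1)[OF square_integrable_continuous_circle]) (intro continuous_intros)
      then show "(\<lambda>x. k x * \<psi> n x) \<in> borel_measurable circle" for n by measurable
      show "(\<lambda>x. indicator {..<a} x * k x) \<in> borel_measurable circle" using int[of "{..<a}"] by simp
      show "AE x in circle. norm (k x * \<psi> n x) \<le> \<bar>k x\<bar>" for n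
        by (intro AE_I2) (simp add: \<psi>_def abs_mult mult_left_le)
      have "AE x in circle. x \<noteq> 0"
        unfolding circle_def by (subst AE_restrict_space_iff) (use AE_lborel_singleton[of 0] in auto)
      then show "AE x in circle. (\<lambda>n. k x * \<psi> n x) \<longlonglongrightarrow> indicator {..<a} x * k x"
      proof (rule AE_mp, intro AE_I2 impI)
        fix x :: real assume "x \<in> space circle" "x \<noteq> 0"
        then have x: "x > 0" by simp
        have "(\<lambda>n. \<psi> n x) \<longlonglongrightarrow> indicator {..<a} x"
        proof (cases "x < a")
          case True
          then have m: "min x (a - x) > 0" using x by simp
          obtain N :: nat where N: "1 / min x (a - x) < real N" using reals_Archimedean2 by blast
          have "eventually (\<lambda>n. \<psi> n x = 1) sequentially"
            using eventually_ge_at_top[of N]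
          proof eventually_elim
            case (elim n)
            have "1 / min x (a - x) < real n" using N elim by simp
            then have "1 < real n * min x (a - x)" using m by (simp only: pos_divide_less_eq)
            then show ?case by (simp add: \<psi>_def)
          qed
          then show ?thesis using True by (simp add: tendsto_eventually)
        next
          case False
          then have "real n * min x (a - x) \<le> 0" for n by (simp add: mult_nonneg_nonpos)
          then have "\<psi> n x = 0" for n unfolding \<psi>_def by (smt (verit))
          then show ?thesis using False by simp
        qed
        then have "(\<lambda>n. k x * \<psi> n x) \<longlonglongrightarrow> k x * indicator {..<a} x" by (intro tendsto_intros)
        then show "(\<lambda>n. k x * \<psi> n x) \<longlonglongrightarrow> indicator {..<a} x * k x" by (simp add: mult.commute)
      qed
    qed
    moreover have "(\<integral>x. k x * \<psi> n x \<partial>circle) = 0" for n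
    proof (rule zero)
      have "real n * min 0 (a - 0) \<le> 0" "real n * min 1 (a - 1) \<le> 0"
        using True by (auto intro: mult_nonneg_nonpos)
      then show "\<psi> n 0 = \<psi> n 1" unfolding \<psi>_def by linarith
    qed (auto simp: \<psi>_def intro!: continuous_intros)
    ultimately show ?thesis by (simp add: LIMSEQ_const_iff)
  qed
  have borel: "(\<integral>x. indicator A x * k x \<partial>circle) = 0" if "A \<in> sets borel" for A
  proof -
    have "{..<a} \<inter> {..<b} = {..<min a b}" for a b :: real by auto
    then have "Int_stable (range lessThan :: real set set)"
      by (auto simp: Int_stable_def)
    moreover have "range lessThan \<subseteq> Pow (UNIV :: real set)" by simp
    moreover have "A \<in> sigma_sets UNIV (range lessThan)"
      using that by (simp add: borel_Iio)
    ultimately show ?thesis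
    proof (induction rule: sigma_sets_induct_disjoint)
      case (basic A) then show ?case using half by auto
    next
      case empty show ?case by simp
    next
      case (compl A)
      have A: "A \<in> sets borel" using compl by (simp add: borel_Iio)
      have "(\<integral>x. indicator (UNIV - A) x * k x \<partial>circle) = (\<integral>x. k x - indicator A x * k x \<partial>circle)"
        by (intro Bochner_Integration.integral_cong) (auto simp: indicator_def)
      then show ?case using compl all k int[OF A] by simp
    next
      case (union F)
      have F: "F i \<in> sets borel" for i using union by (auto simp: borel_Iio)
      have "(\<lambda>n. \<integral>x. (\<Sum>i<n. indicator (F i) x * k x) \<partial>circle) \<longlonglongrightarrow> (\<integral>x. indicator (\<Union>i. F i) x * k x \<partial>circle)"
      proof (rule integral_dominated_convergence)
        show "integrable circle (\<lambda>x. \<bar>k x\<bar>)" using k by simp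
        show "(\<lambda>x. indicator (\<Union>i. F i) x * k x) \<in> borel_measurable circle"
          using F by (intro borel_measurable_integrable int sets.countable_UN) auto
        show "(\<lambda>x. \<Sum>i<n. indicator (F i) x * k x) \<in> borel_measurable circle" for n
          by (intro borel_measurable_sum borel_measurable_integrable int F)
        have part: "(\<Sum>i<n. indicator (F i) x * k x) = indicator (\<Union>i<n. F i) x * k x" for n x
          unfolding sum_distrib_right[symmetric]
          using union(1) by (subst indicator_UN_disjoint) (auto intro: disjoint_family_on_mono)
        show "AE x in circle. norm (\<Sum>i<n. indicator (F i) x * k x) \<le> \<bar>k x\<bar>" for n
          unfolding part by (auto simp: indicator_def)
        show "AE x in circle. (\<lambda>n. \<Sum>i<n. indicator (F i) x * k x) \<longlonglongrightarrow> indicator (\<Union>i. F i) x * k x"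
          unfolding part by (intro AE_I2 tendsto_intros LIMSEQ_indicator_UN)
      qed
      moreover have "(\<integral>x. (\<Sum>i<n. indicator (F i) x * k x) \<partial>circle) = 0" for n
        by (subst Bochner_Integration.integral_sum) (use union(3) int F in auto)
      ultimately show ?case by (simp add: LIMSEQ_const_iff)
    qed
  qed
  show ?thesis
  proof (rule sigma_finite_measure.density_zero[OF sigma_finite_circle k])
    fix A assume "A \<in> sets circle"
    then have "A \<in> sets borel" by (auto simp: circle_def sets_restrict_space_iff)
    then show "set_lebesgue_integral circle A k = 0"
      by (simp add: set_lebesgue_integral_def borel)
  qed
qed


text \<open>The du Bois-Reymond lemma. The primitive \<open>G\<close> satisfies the same integration
  by parts as \<open>F\<close>, so \<open>F - G\<close> is orthogonal to every derivative of a test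
  function, that is, to every smooth periodic function of mean zero. Subtracting the mean
  \<open>c\<close> makes it orthogonal to all smooth periodic functions and, by density, to all
  continuous ones.\<close>

lemma weak_deriv_imp_primitive:
  assumes wd: "weak_deriv f g"
  shows "\<exists>c. AE x in circle. rep_L2T f x = c + (\<integral>y. indicator {..<x} y * rep_L2T g y \<partial>circle)"
proof -
  interpret finite_measure circle by simp
  interpret P: pair_sigma_finite circle circle ..
  define F g0 where "F = rep_L2T f" and "g0 = rep_L2T g"
  define G where "G x = (\<integral>y. indicator {..<x} y * g0 y \<partial>circle)" for x
  have sq: "square_integrable circle F" "square_integrable circle g0" by (simp_all add: F_def g0_def)
  note int = sq[THEN square_integrable_integrable[OF finite_measure_circle]]
  have [measurable]: "F \<in> borel_measurable circle" "g0 \<in> borel_measurable circle"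
    by (simp_all add: F_def g0_def)
  have id_meas [measurable]: "(\<lambda>x. x) \<in> borel_measurable circle"
    unfolding circle_def by (intro measurable_restrict_space1) simp
  have kernel [measurable]: "(\<lambda>z. indicator {..<fst z} (snd z) :: real) \<in> borel_measurable (circle \<Otimes>\<^sub>M circle)"
  proof -
    have "(\<lambda>z. indicator {..<fst z} (snd z) :: real) = (\<lambda>z. if snd z < fst z then 1 else 0)"
      by (auto simp: indicator_def)
    also have "\<dots> \<in> borel_measurable (circle \<Otimes>\<^sub>M circle)"
    proof -
      have [measurable]: "fst \<in> borel_measurable (circle \<Otimes>\<^sub>M circle)" "snd \<in> borel_measurable (circle \<Otimes>\<^sub>M circle)"
        using measurable_compose[OF measurable_fst id_meas] measurable_compose[OF measurable_snd id_meas] by auto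
      show ?thesis by measurable
    qed
    finally show ?thesis .
  qed
  have G_meas [measurable]: "G \<in> borel_measurable circle"
    unfolding G_def using kernel by (intro sigma_finite_measure.borel_measurable_lebesgue_integral[OF sigma_finite_circle]) (simp add: case_prod_unfold)
  have G_bd: "\<bar>G x\<bar> \<le> (\<integral>y. \<bar>g0 y\<bar> \<partial>circle)" for x
  proof -
    have "\<bar>G x\<bar> \<le> (\<integral>y. \<bar>indicator {..<x} y * g0 y\<bar> \<partial>circle)" unfolding G_def by (rule integral_abs_bound)
    also have "\<dots> \<le> (\<integral>y. \<bar>g0 y\<bar> \<partial>circle)"
      using int by (intro integral_mono_AE' ) (auto simp: indicator_def)
    finally show ?thesis .
  qed
  have G_sq: "square_integrable circle G"
    by (rule square_integrable_bound[OF square_integrable_const[OF finite_measure_circle] G_meas])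
      (use G_bd in auto)
  have parts: "(\<integral>x. (F x - G x) * p x \<partial>circle) = 0"
    if p: "smooth_circle p" and mean: "(\<integral>x. p x \<partial>circle) = 0" for p
  proof -
    obtain \<phi> where \<phi>: "smooth_circle \<phi>" and D: "\<And>x. (\<phi> has_real_derivative p x) (at x)"
      using smooth_circle_primitive[OF p mean] by blast
    have p_sq: "square_integrable circle p"
      by (intro square_integrable_continuous_circle smooth_circle_continuous p)
    have \<phi>_sq: "square_integrable circle \<phi>"
      by (intro square_integrable_continuous_circle smooth_circle_continuous \<phi>)
    note [measurable] = square_integrableD(1)[OF p_sq]
    have "compact (p ` {0..1})" by (intro compact_continuous_image smooth_circle_continuous p) auto
    then obtain C where C: "\<And>x. x \<in> {0..1} \<Longrightarrow> \<bar>p x\<bar> \<le> C"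
      by (metis (no_types) compact_imp_bounded bounded_iff image_eqI real_norm_def)
    have "deriv \<phi> = p" using D by (auto intro: DERIV_imp_deriv)
    then have F_eq: "(\<integral>x. F x * p x \<partial>circle) = - (\<integral>x. g0 x * \<phi> x \<partial>circle)"
      using wd \<phi> unfolding weak_deriv_def F_def g0_def by auto
    \<comment> \<open>Testing with the constant 1 shows that a weak derivative on the circle has
      mean zero. This removes the boundary term that carries \<open>\<phi> 1\<close> below.\<close>
    have g_mean: "(\<integral>x. g0 x \<partial>circle) = 0"
    proof -
      have "deriv (\<lambda>_::real. 1::real) = (\<lambda>_. 0)" by (auto intro!: DERIV_imp_deriv)
      then show ?thesis
        using wd[unfolded weak_deriv_def, rule_format, OF smooth_circle_const[of 1]] by (simp add: g0_def)
    qed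
    have "(\<integral>x. G x * p x \<partial>circle) = (\<integral>x. (\<integral>y. indicator {..<x} y * g0 y * p x \<partial>circle) \<partial>circle)"
      unfolding G_def by (intro Bochner_Integration.integral_cong refl) simp
    \<comment> \<open>Integration by parts in the form of Fubini on the triangle
      \<open>y < x\<close>: \<open>G\<close> is known only as an integral, so the order of
      integration is exchanged instead of applying a product rule.\<close>
    also have "\<dots> = (\<integral>y. (\<integral>x. indicator {..<x} y * g0 y * p x \<partial>circle) \<partial>circle)"
    proof (rule P.Fubini_integral[symmetric])
      show "integrable (circle \<Otimes>\<^sub>M circle) (\<lambda>(x, y). indicator {..<x} y * g0 y * p x)"
      proof (rule P.Fubini_integrable)
        show m: "(\<lambda>(x, y). indicator {..<x} y * g0 y * p x) \<in> borel_measurable (circle \<Otimes>\<^sub>M circle)"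
          using kernel unfolding case_prod_unfold by measurable
        have slice: "integrable circle (\<lambda>y. indicator {..<x} y * g0 y * p x)" if "x \<in> space circle" for x
          by (rule Bochner_Integration.integrable_bound[OF integrable_mult_left[OF int(2), of "p x"]])
            (use that measurable_compose_Pair1[OF that m] in \<open>auto simp: indicator_def\<close>)
        then show "AE x in circle. integrable circle (\<lambda>y. case (x, y) of (x, y) \<Rightarrow> indicator {..<x} y * g0 y * p x)"
          by (intro AE_I2) simp
        show "integrable circle (\<lambda>x. \<integral>y. norm (case (x, y) of (x, y) \<Rightarrow> indicator {..<x} y * g0 y * p x) \<partial>circle)"
        proof (rule integrable_const_bound[where B="(\<integral>y. \<bar>g0 y\<bar> \<partial>circle) * C"])
          show "AE x in circle. norm (\<integral>y. norm (case (x, y) of (x, y) \<Rightarrow> indicator {..<x} y * g0 y * p x) \<partial>circle)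
              \<le> (\<integral>y. \<bar>g0 y\<bar> \<partial>circle) * C"
          proof (rule AE_I2)
            fix x assume x: "x \<in> space circle"
            have "(\<integral>y. \<bar>indicator {..<x} y * g0 y * p x\<bar> \<partial>circle) \<le> (\<integral>y. \<bar>g0 y\<bar> * C \<partial>circle)"
              using int C[of x] x by (intro integral_mono_AE' AE_I2)
                (auto simp: abs_mult indicator_def intro!: mult_left_mono order_trans[OF abs_ge_zero])
            then show "norm (\<integral>y. norm (case (x, y) of (x, y) \<Rightarrow> indicator {..<x} y * g0 y * p x) \<partial>circle)
              \<le> (\<integral>y. \<bar>g0 y\<bar> \<partial>circle) * C"
              by simp
          qed
          show "(\<lambda>x. \<integral>y. norm (case (x, y) of (x, y) \<Rightarrow> indicator {..<x} y * g0 y * p x) \<partial>circle) \<in> borel_measurable circle"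
            using m by (intro sigma_finite_measure.borel_measurable_lebesgue_integral[OF sigma_finite_circle]) (simp add: case_prod_unfold)
        qed
      qed
    qed
    also have "\<dots> = (\<integral>y. g0 y * (\<phi> 1 - \<phi> y) \<partial>circle)"
    proof (intro Bochner_Integration.integral_cong refl)
      fix y assume "y \<in> space circle"
      then have y: "0 \<le> y" "y < 1" by auto
      have "(\<integral>x. indicator {..<x} y * g0 y * p x \<partial>circle) = g0 y * (\<integral>x. indicator {..<x} y * p x \<partial>circle)"
        by (simp add: ac_simps flip: integral_mult_right_zero)
      also have "(\<integral>x. indicator {..<x} y * p x \<partial>circle) = (\<integral>x. indicator {y..} x * p x \<partial>circle)"
      proof (rule integral_cong_AE)
        have "AE x in circle. x \<noteq> y"
          unfolding circle_def by (subst AE_restrict_space_iff) (use AE_lborel_singleton[of y] in auto)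
        then show "AE x in circle. indicator {..<x} y * p x = indicator {y..} x * p x"
          by eventually_elim (auto simp: indicator_def)
        show "(\<lambda>x. indicator {y..} x * p x) \<in> borel_measurable circle"
          by (intro borel_measurable_times indicator_measurable_circle square_integrableD(1)[OF p_sq]) simp
        have "(\<lambda>x. indicator {y<..} x * p x) \<in> borel_measurable circle"
          by (intro borel_measurable_times indicator_measurable_circle square_integrableD(1)[OF p_sq]) simp
        then show "(\<lambda>x. indicator {..<x} y * p x) \<in> borel_measurable circle"
          by (simp add: indicator_def)
      qed
      also have "\<dots> = integral {y..1} p"
        using y by (intro integral_circle_Icc smooth_circle_continuous p) auto
      also have "\<dots> = \<phi> 1 - \<phi> y"
        using y D by (intro integral_unique fundamental_theorem_of_calculus)
          (auto simp: has_real_derivative_iff_has_vector_derivative intro: has_vector_derivative_at_within)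
      finally show "(\<integral>x. indicator {..<x} y * g0 y * p x \<partial>circle) = g0 y * (\<phi> 1 - \<phi> y)" .
    qed
    also have "\<dots> = \<phi> 1 * (\<integral>y. g0 y \<partial>circle) - (\<integral>y. g0 y * \<phi> y \<partial>circle)"
      using int(2) square_integrable_mult[OF sq(2) \<phi>_sq]
      by (simp add: right_diff_distrib mult.commute[of _ "\<phi> 1"])
    finally have "(\<integral>x. G x * p x \<partial>circle) = - (\<integral>x. g0 x * \<phi> x \<partial>circle)" using g_mean by simp
    then show ?thesis
      using F_eq square_integrable_mult[OF sq(1) p_sq] square_integrable_mult[OF G_sq p_sq]
      by (simp add: left_diff_distrib)
  qed
  define c where "c = (\<integral>x. F x - G x \<partial>circle)"
  define k where "k x = F x - G x - c" for x
  have one: "measure circle (space circle) = 1" by (simp add: measure_def)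
  have FG_sq: "square_integrable circle (\<lambda>x. F x - G x)" by (rule square_integrable_diff[OF sq(1) G_sq])
  have k_sq: "square_integrable circle k"
    unfolding k_def by (intro square_integrable_diff FG_sq square_integrable_const finite_measure_circle)
  note k_int = square_integrable_integrable[OF finite_measure_circle k_sq]
  \<comment> \<open>A general \<open>p\<close> is reduced to mean zero by subtracting
    \<open>m\<close>; the term \<open>m * c\<close> that this leaves is cancelled by the constant in
    \<open>k\<close>.\<close>
  have orth: "(\<integral>x. k x * p x \<partial>circle) = 0" if p: "smooth_circle p" for p
  proof -
    define m where "m = (\<integral>x. p x \<partial>circle)"
    have p_sq: "square_integrable circle p"
      by (intro square_integrable_continuous_circle smooth_circle_continuous p)
    note p_int = square_integrable_integrable[OF finite_measure_circle p_sq]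
    note FG_int = square_integrable_integrable[OF finite_measure_circle FG_sq]
    have "(\<integral>x. (F x - G x) * (p x + (- m)) \<partial>circle) = 0"
      by (rule parts[OF smooth_circle_add[OF p smooth_circle_const]]) (use p_int one in \<open>simp add: m_def\<close>)
    then have "(\<integral>x. (F x - G x) * p x - m * (F x - G x) \<partial>circle) = 0"
      by (simp add: algebra_simps)
    then have "(\<integral>x. (F x - G x) * p x \<partial>circle) - m * c = 0"
      using square_integrable_mult[OF FG_sq p_sq] FG_int by (simp add: c_def)
    moreover have "(\<integral>x. k x * p x \<partial>circle) = (\<integral>x. (F x - G x) * p x - c * p x \<partial>circle)"
      by (simp add: k_def algebra_simps)
    ultimately show ?thesis
      using square_integrable_mult[OF FG_sq p_sq] p_int by (simp add: m_def mult.commute)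
  qed
  have "AE x in circle. k x = 0"
  proof (rule circle_AE_zero[OF k_int])
    fix \<psi> :: "real \<Rightarrow> real" assume \<psi>: "continuous_on {0..1} \<psi>" "\<psi> 0 = \<psi> 1"
    \<comment> \<open>\<open>\<psi>\<close> is continuous on \<open>{0..1}\<close> only. Clamping
      the argument extends it continuously to the line without changing it on the circle.\<close>
    have \<psi>_meas: "(\<lambda>x. \<psi> x) \<in> borel_measurable circle"
    proof -
      have "continuous_on UNIV (\<lambda>x. \<psi> (max 0 (min 1 x)))"
        by (rule continuous_on_compose2[OF \<psi>(1)]) (auto intro!: continuous_intros)
      then have "(\<lambda>x. \<psi> (max 0 (min 1 x))) \<in> borel_measurable circle"
        by (intro square_integrableD(1) square_integrable_continuous_circle)
      then show ?thesis by (subst measurable_cong[where g="\<lambda>x. \<psi> (max 0 (min 1 x))"]) auto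
    qed
    \<comment> \<open>The smooth approximant contributes nothing by \<open>orth\<close>, so only the
      approximation error remains, weighted by the L^1 norm of \<open>k\<close>.\<close>
    have *: "\<bar>\<integral>x. k x * \<psi> x \<partial>circle\<bar> \<le> e * (\<integral>x. \<bar>k x\<bar> \<partial>circle)" if e: "e > 0" for e
    proof -
      obtain p where p: "smooth_circle p" "\<And>x. x \<in> {0..1} \<Longrightarrow> \<bar>\<psi> x - p x\<bar> < e"
        using smooth_circle_dense[OF \<psi> e] by blast
      have p_sq: "square_integrable circle p"
        by (intro square_integrable_continuous_circle smooth_circle_continuous p)
      have le: "\<bar>k x * (\<psi> x - p x)\<bar> \<le> e * \<bar>k x\<bar>" if "x \<in> space circle" for x
        using p(2)[of x] that mult_right_mono[of "\<bar>\<psi> x - p x\<bar>" e "\<bar>k x\<bar>"]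
          by (simp add: abs_mult mult.commute)
      have int': "integrable circle (\<lambda>x. k x * (\<psi> x - p x))"
      proof (rule Bochner_Integration.integrable_bound)
        show "integrable circle (\<lambda>x. e * \<bar>k x\<bar>)" using k_int by simp
        show "(\<lambda>x. k x * (\<psi> x - p x)) \<in> borel_measurable circle"
          by (intro borel_measurable_times borel_measurable_diff \<psi>_meas square_integrableD(1)[OF p_sq]
              square_integrableD(1)[OF k_sq])
        show "AE x in circle. norm (k x * (\<psi> x - p x)) \<le> norm (e * \<bar>k x\<bar>)"
          using le e by (intro AE_I2) (auto simp: abs_of_pos)
      qed
      have "(\<integral>x. k x * \<psi> x \<partial>circle) = (\<integral>x. k x * (\<psi> x - p x) + k x * p x \<partial>circle)"
        by (simp add: algebra_simps)
      also have "\<dots> = (\<integral>x. k x * (\<psi> x - p x) \<partial>circle)"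
        using int' square_integrable_mult[OF k_sq p_sq] orth[OF p(1)] by simp
      also have "\<bar>\<dots>\<bar> \<le> (\<integral>x. \<bar>k x * (\<psi> x - p x)\<bar> \<partial>circle)" by (rule integral_abs_bound)
      also have "\<dots> \<le> (\<integral>x. e * \<bar>k x\<bar> \<partial>circle)"
        using int' k_int le by (intro integral_mono) auto
      finally show ?thesis by simp
    qed
    have "\<bar>\<integral>x. k x * \<psi> x \<partial>circle\<bar> \<le> 0"
    proof (rule field_le_epsilon)
      fix e :: real assume e: "e > 0"
      define K where "K = (\<integral>x. \<bar>k x\<bar> \<partial>circle)"
      have K: "K \<ge> 0" by (simp add: K_def)
      have "\<bar>\<integral>x. k x * \<psi> x \<partial>circle\<bar> \<le> e / (K + 1) * K"
        using *[of "e / (K + 1)"] e K unfolding K_def[symmetric] by (simp add: add_nonneg_pos)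
      also have "\<dots> \<le> e" using e K by (simp add: field_simps)
      finally show "\<bar>\<integral>x. k x * \<psi> x \<partial>circle\<bar> \<le> 0 + e" by simp
    qed
    then show "(\<integral>x. k x * \<psi> x \<partial>circle) = 0" by simp
  qed
  then have "AE x in circle. F x = c + G x" by eventually_elim (simp add: k_def)
  then show ?thesis unfolding F_def G_def g0_def by blast
qed

section \<open>Hoelder representatives and multiplication operators\<close>

lemma norm_L2T_eq: "norm f = l2norm circle (rep_L2T f)"
  using real_sqrt_unique[OF norm_to_L2T[OF square_integrable_rep[of f]] norm_ge_zero]
  by (simp add: l2norm_def)

lemma measure_circle_Ico:
  assumes "0 \<le> a" "a \<le> b" "b \<le> 1"
  shows "measure circle {a..<b} = b - a"
proof -
  have "measure circle {a..<b} = measure lborel {a..<b}"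
    unfolding circle_def using assms by (intro measure_restrict_space) auto
  then show ?thesis using assms by simp
qed

lemma l2norm_indicator_circle:
  assumes "0 \<le> a" "a \<le> b" "b \<le> 1"
  shows "l2norm circle (indicator {a..<b} :: real \<Rightarrow> real) = sqrt (b - a)"
proof -
  have "{a..<b} \<in> sets circle"
    using assms by (auto simp: circle_def sets_restrict_space_iff)
  then have "(\<integral>x. indicator {a..<b} x \<partial>circle) = measure circle {a..<b}"
    using assms by (simp add: max_absorb1 min_absorb1)
  moreover have "(\<lambda>x. (norm (indicator {a..<b} x :: real))\<^sup>2) = indicator {a..<b}"
    by (rule ext) (simp add: indicator_def)
  ultimately show ?thesis using measure_circle_Ico[OF assms] by (simp add: l2norm_def)
qed

lemma norm_Rep_H1T:
  "norm (H1T_to_L2T u) \<le> norm u" "norm (snd (Rep_H1T u)) \<le> norm u"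
  unfolding H1T_to_L2T_def norm_H1T.rep_eq by (metis prod.collapse norm_fst_le norm_snd_le)+

text \<open>The primitive supplied by the weak derivative is an honest function, so pointwise
  estimates make sense: Cauchy--Schwarz against the indicator of \<open>{x..<y}\<close> gives
  exponent 1/2. Distances are those of the fundamental domain; the averaging intervals used later
  never wrap around.\<close>

lemma H1T_representative:
  obtains F where "F \<in> borel_measurable circle" "AE x in circle. rep_L2T (H1T_to_L2T u) x = F x"
    "\<And>x y. x \<in> {0..<1} \<Longrightarrow> y \<in> {0..<1} \<Longrightarrow> \<bar>F x - F y\<bar> \<le> norm u * sqrt \<bar>x - y\<bar>"
    "\<And>x. x \<in> {0..<1} \<Longrightarrow> \<bar>F x\<bar> \<le> 2 * norm u"
proof -
  interpret finite_measure circle by simp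
  define f g where "f = H1T_to_L2T u" and "g = snd (Rep_H1T u)"
  have "weak_deriv f g" using Rep_H1T[of u] by (auto simp: f_def g_def H1T_to_L2T_def)
  then obtain c where c: "AE x in circle. rep_L2T f x = c + (\<integral>y. indicator {..<x} y * rep_L2T g y \<partial>circle)"
    using weak_deriv_imp_primitive by blast
  define F where "F x = c + (\<integral>y. indicator {..<x} y * rep_L2T g y \<partial>circle)" for x
  have g_int: "integrable circle (\<lambda>y. indicator {..<x} y * rep_L2T g y)" for x
    by (rule square_integrable_mult[OF square_integrable_indicator_circle square_integrable_rep]) simp
  have ordered: "\<bar>F y - F x\<bar> \<le> norm u * sqrt (y - x)" if "0 \<le> x" "x \<le> y" "y \<le> 1" for x y
  proof -
    have sq: "square_integrable circle (indicator {x..<y} :: real \<Rightarrow> real)"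
      by (rule square_integrable_indicator_circle) simp
    have "F y - F x = (\<integral>z. indicator {..<y} z * rep_L2T g z - indicator {..<x} z * rep_L2T g z \<partial>circle)"
      using g_int by (simp add: F_def)
    also have "\<dots> = (\<integral>z. indicator {x..<y} z * rep_L2T g z \<partial>circle)"
      by (rule Bochner_Integration.integral_cong) (use that in \<open>auto simp: indicator_def\<close>)
    also have "\<bar>\<dots>\<bar> \<le> (\<integral>z. \<bar>indicator {x..<y} z * rep_L2T g z\<bar> \<partial>circle)" by (rule integral_abs_bound)
    also have "\<dots> \<le> sqrt (y - x) * norm g"
      using integral_mult_le_l2norm[OF sq square_integrable_rep[of g]] that
      by (simp add: l2norm_indicator_circle norm_L2T_eq)
    also have "\<dots> \<le> norm u * sqrt (y - x)"
      unfolding g_def mult.commute[of "norm u"] using that by (intro mult_left_mono norm_Rep_H1T) simp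
    finally show ?thesis .
  qed
  have holder: "\<bar>F x - F y\<bar> \<le> norm u * sqrt \<bar>x - y\<bar>" if "x \<in> {0..<1}" "y \<in> {0..<1}" for x y
  proof (cases "x \<le> y")
    case True then show ?thesis using ordered[of x y] that by (simp add: abs_minus_commute)
  next
    case False then show ?thesis using ordered[of y x] that by simp
  qed
  have meas: "F \<in> borel_measurable circle"
  proof -
    have "continuous_on {0..<1} F"
      unfolding continuous_on_iff
    proof (intro ballI allI impI)
      fix x e :: real assume x: "x \<in> {0..<1}" and e: "e > 0"
      define d where "d = (e / (norm u + 1))\<^sup>2"
      have u1: "norm u + 1 > 0" by (rule add_nonneg_pos) auto
      have d: "d > 0" unfolding d_def by (intro zero_less_power divide_pos_pos e u1)
      show "\<exists>d>0. \<forall>y\<in>{0..<1}. dist y x < d \<longrightarrow> dist (F y) (F x) < e"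
      proof (intro exI[of _ d] conjI d ballI impI)
        fix y assume y: "y \<in> {0..<1}" "dist y x < d"
        have "sqrt \<bar>y - x\<bar> < sqrt d" using y by (simp add: dist_real_def)
        also have "sqrt d = e / (norm u + 1)" unfolding d_def using divide_pos_pos[OF e u1] by (intro real_sqrt_abs[THEN trans] abs_of_pos)
        finally have s: "(norm u + 1) * sqrt \<bar>y - x\<bar> < e"
          unfolding pos_less_divide_eq[OF u1] by (simp only: mult.commute)
        have "\<bar>F y - F x\<bar> \<le> norm u * sqrt \<bar>y - x\<bar>" by (rule holder) (use x y in auto)
        also have "\<dots> \<le> (norm u + 1) * sqrt \<bar>y - x\<bar>" by (intro mult_right_mono) auto
        finally show "dist (F y) (F x) < e" using s by (simp add: dist_real_def)
      qed
    qed
    then have "F \<in> borel_measurable (restrict_space borel {0..<1})"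
      by (rule borel_measurable_continuous_on_restrict)
    moreover have "sets (restrict_space borel {0..<1::real}) = sets circle"
      unfolding circle_def by (intro sets_restrict_space_cong) simp
    ultimately show ?thesis by (simp cong: measurable_cong_sets)
  qed
  have AE: "AE x in circle. rep_L2T f x = F x" using c by (simp add: F_def)
  have F_sq: "square_integrable circle F"
    by (rule square_integrable_bound[OF square_integrable_norm[OF square_integrable_rep[of f]] meas])
      (use AE in \<open>eventually_elim, simp\<close>)
  note F_int = square_integrable_integrable[OF finite_measure_circle F_sq]
  have one: "measure circle (space circle) = 1" by (simp add: measure_def)
  \<comment> \<open>The factor 2 is mean plus oscillation: the mean is at most \<open>norm u\<close>
    because the total mass is 1, and the oscillation is at most \<open>norm u\<close> because points
    of \<open>{0..<1}\<close> are less than 1 apart.\<close>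
  have sup: "\<bar>F x\<bar> \<le> 2 * norm u" if x: "x \<in> {0..<1}" for x
  proof -
    have "\<bar>\<integral>y. F y \<partial>circle\<bar> \<le> (\<integral>y. \<bar>F y * 1\<bar> \<partial>circle)" using integral_abs_bound[of circle F] by simp
    also have "\<dots> \<le> l2norm circle F * l2norm circle (\<lambda>_. 1 :: real)"
      by (intro integral_mult_le_l2norm F_sq square_integrable_const finite_measure_circle)
    also have "l2norm circle (\<lambda>_. 1 :: real) = 1" using one by (simp add: l2norm_def)
    also have "l2norm circle F = norm f"
      unfolding norm_L2T_eq l2norm_def using AE meas
      by (intro arg_cong[of _ _ sqrt] integral_cong_AE) auto
    finally have mean: "\<bar>\<integral>y. F y \<partial>circle\<bar> \<le> norm u" using norm_Rep_H1T(1)[of u] by (simp add: f_def)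
    have "F x - (\<integral>y. F y \<partial>circle) = (\<integral>y. F x - F y \<partial>circle)"
      using F_int one by simp
    also have "\<bar>\<dots>\<bar> \<le> (\<integral>y. \<bar>F x - F y\<bar> \<partial>circle)" by (rule integral_abs_bound)
    also have "\<dots> \<le> (\<integral>y. norm u \<partial>circle)"
    proof (rule integral_mono)
      fix y assume "y \<in> space circle"
      then have y: "y \<in> {0..<1}" by simp
      have "sqrt \<bar>x - y\<bar> \<le> 1" using x y by (simp add: abs_le_iff)
      then show "\<bar>F x - F y\<bar> \<le> norm u"
        using holder[OF x y] by (meson mult_left_le norm_ge_zero order_trans)
    qed (use F_int in auto)
    finally show ?thesis using mean one by simp
  qed
  show thesis using that[OF meas AE[unfolded f_def] holder sup] .
qed

lemma H1T_bounded: "AE x in circle. \<bar>rep_L2T (H1T_to_L2T u) x\<bar> \<le> 2 * norm u"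
proof -
  obtain F where F: "AE x in circle. rep_L2T (H1T_to_L2T u) x = F x"
    and b: "\<And>x. x \<in> {0..<1} \<Longrightarrow> \<bar>F x\<bar> \<le> 2 * norm u"
    using H1T_representative[of u] by metis
  from F show ?thesis by (rule AE_mp) (use b in \<open>auto intro!: AE_I2\<close>)
qed

lemma rep_L2T_add: "AE x in circle. rep_L2T (f + g) x = rep_L2T f x + rep_L2T g x"
  using rep_to_L2T[OF square_integrable_add[OF square_integrable_rep[of f] square_integrable_rep[of g]]]
  by (simp add: to_L2T_add)

lemma rep_L2T_diff: "AE x in circle. rep_L2T (f - g) x = rep_L2T f x - rep_L2T g x"
  using rep_to_L2T[OF square_integrable_diff[OF square_integrable_rep[of f] square_integrable_rep[of g]]]
  by (simp add: to_L2T_diff)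

lemma rep_L2T_scaleR: "AE x in circle. rep_L2T (c *\<^sub>R f) x = c * rep_L2T f x"
  using rep_to_L2T[OF square_integrable_scaleR[OF square_integrable_rep[of f], of c]]
  by (simp add: to_L2T_scaleR)

text \<open>Pointwise domination by a multiple of \<open>b\<close> settles square integrability and
  the norm bound together; the former keeps \<open>to_L2T\<close> away from its dummy value.\<close>

lemma norm_to_L2T_le:
  assumes h: "h \<in> borel_measurable circle" and C: "C \<ge> 0"
    and le: "AE x in circle. \<bar>h x\<bar> \<le> C * \<bar>rep_L2T b x\<bar>"
  shows "square_integrable circle h" "norm (to_L2T h) \<le> C * norm b"
proof -
  have Cb: "square_integrable circle (\<lambda>x. C * \<bar>rep_L2T b x\<bar>)"
    using square_integrable_scaleR[OF square_integrable_norm[OF square_integrable_rep[of b]], of C] by simp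
  show sq: "square_integrable circle h"
    by (rule square_integrable_bound[OF Cb h]) (use le in simp)
  have "norm (to_L2T h) = l2norm circle h"
    using real_sqrt_unique[OF norm_to_L2T[OF sq] norm_ge_zero] by (simp add: l2norm_def)
  also have "\<dots> \<le> l2norm circle (\<lambda>x. C *\<^sub>R \<bar>rep_L2T b x\<bar>)"
    by (rule l2norm_mono) (use Cb h le C in \<open>auto simp: abs_mult\<close>)
  also have "\<dots> = C * norm b"
    unfolding l2norm_scaleR using C by (simp add: norm_L2T_eq l2norm_def)
  finally show "norm (to_L2T h) \<le> C * norm b" .
qed

text \<open>The hypothesis is an essential bound rather than H^1 regularity, because the results are
  applied both to H^1 functions and to indicators of intervals.\<close>

context
  fixes f :: L2T and C :: real
  assumes f: "AE x in circle. \<bar>rep_L2T f x\<bar> \<le> C"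
begin

lemma times_L2T_square_integrable: "square_integrable circle (\<lambda>x. rep_L2T f x * rep_L2T b x)"
proof (rule norm_to_L2T_le(1)[of _ "max C 0"])
  show "AE x in circle. \<bar>rep_L2T f x * rep_L2T b x\<bar> \<le> max C 0 * \<bar>rep_L2T b x\<bar>"
    using f by eventually_elim (auto simp: abs_mult intro!: mult_right_mono)
qed auto

lemma bounded_linear_times_L2T: "bounded_linear (times_L2T f)"
proof (rule bounded_linear_intro[where K="max C 0"])
  show "times_L2T f (a + b) = times_L2T f a + times_L2T f b" for a b
    unfolding times_L2T_def
    by (subst to_L2T_add[symmetric, OF times_L2T_square_integrable times_L2T_square_integrable], rule to_L2T_cong,
        rule times_L2T_square_integrable, intro square_integrable_add times_L2T_square_integrable,
        rule AE_mp[OF rep_L2T_add[of a b]])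
       (auto intro!: AE_I2 simp: algebra_simps)
  show "times_L2T f (r *\<^sub>R b) = r *\<^sub>R times_L2T f b" for r b
    unfolding times_L2T_def
    by (subst to_L2T_scaleR[symmetric, OF times_L2T_square_integrable], rule to_L2T_cong,
        rule times_L2T_square_integrable, intro square_integrable_scaleR times_L2T_square_integrable,
        rule AE_mp[OF rep_L2T_scaleR[of r b]])
       (auto intro!: AE_I2 simp: algebra_simps)
  show "norm (times_L2T f b) \<le> norm b * max C 0" for b
    unfolding times_L2T_def mult.commute[of "norm b"]
  proof (rule norm_to_L2T_le(2))
    show "AE x in circle. \<bar>rep_L2T f x * rep_L2T b x\<bar> \<le> max C 0 * \<bar>rep_L2T b x\<bar>"
      using f by eventually_elim (auto simp: abs_mult intro!: mult_right_mono)
  qed auto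
qed

end

lemma H1T_to_L2T_linear:
  "H1T_to_L2T (u + v) = H1T_to_L2T u + H1T_to_L2T v" "H1T_to_L2T (c *\<^sub>R u) = c *\<^sub>R H1T_to_L2T u"
  by (simp_all add: H1T_to_L2T_def plus_H1T.rep_eq scaleR_H1T.rep_eq)

text \<open>With two general L^2 factors \<open>times_L2T\<close> is not even additive, owing to the
  dummy value. Typing the first factor in \<open>H1T\<close> makes multiplication a genuine bounded
  bilinear map for the H^1 norm.\<close>

definition H1T_mult :: "H1T \<Rightarrow> L2T \<Rightarrow> L2T" where
  "H1T_mult u b = times_L2T (H1T_to_L2T u) b"

lemma bounded_bilinear_H1T_mult: "bounded_bilinear H1T_mult"
proof
  fix a a' :: H1T and b b' :: L2T and r :: real
  note sq = times_L2T_square_integrable[OF H1T_bounded]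
  interpret bounded_linear "times_L2T (H1T_to_L2T a)"
    by (rule bounded_linear_times_L2T[OF H1T_bounded])
  show "H1T_mult a (b + b') = H1T_mult a b + H1T_mult a b'" by (simp add: H1T_mult_def add)
  show "H1T_mult a (r *\<^sub>R b) = r *\<^sub>R H1T_mult a b" by (simp add: H1T_mult_def scale)
  show "H1T_mult (a + a') b = H1T_mult a b + H1T_mult a' b"
    unfolding H1T_mult_def times_L2T_def
    by (subst to_L2T_add[symmetric, OF sq sq], rule to_L2T_cong, rule sq, intro square_integrable_add sq,
        rule AE_mp[OF rep_L2T_add[of "H1T_to_L2T a" "H1T_to_L2T a'"]])
       (auto intro!: AE_I2 simp: algebra_simps H1T_to_L2T_linear)
  show "H1T_mult (r *\<^sub>R a) b = r *\<^sub>R H1T_mult a b"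
    unfolding H1T_mult_def times_L2T_def
    by (subst to_L2T_scaleR[symmetric, OF sq], rule to_L2T_cong, rule sq, intro square_integrable_scaleR sq,
        rule AE_mp[OF rep_L2T_scaleR[of r "H1T_to_L2T a"]])
       (auto intro!: AE_I2 simp: algebra_simps H1T_to_L2T_linear)
  show "\<exists>K. \<forall>a b. norm (H1T_mult a b) \<le> norm a * norm b * K"
  proof (intro exI[of _ 2] allI)
    fix a :: H1T and b :: L2T
    have "norm (to_L2T (\<lambda>x. rep_L2T (H1T_to_L2T a) x * rep_L2T b x)) \<le> (2 * norm a) * norm b"
    proof (rule norm_to_L2T_le(2))
      show "AE x in circle. \<bar>rep_L2T (H1T_to_L2T a) x * rep_L2T b x\<bar> \<le> 2 * norm a * \<bar>rep_L2T b x\<bar>"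
        using H1T_bounded[of a] by eventually_elim (simp add: abs_mult mult_right_mono)
    qed auto
    then show "norm (H1T_mult a b) \<le> norm a * norm b * 2"
      by (simp add: H1T_mult_def times_L2T_def ac_simps)
  qed
qed

text \<open>Replacing \<open>u\<close> by its averages on \<open>N\<close> equal intervals costs \<open>\<parallel>u\<parallel> / sqrt N\<close> in sup norm.\<close>
lemma H1T_mult_finite_rank_approximation:
  assumes \<delta>: "\<delta> > 0"
  shows "\<exists>(N::nat) (l :: nat \<Rightarrow> H1T \<Rightarrow> real) (P :: nat \<Rightarrow> L2T \<Rightarrow> L2T).
    (\<forall>j. bounded_linear (l j)) \<and> (\<forall>j. bounded_linear (P j)) \<and>
    (\<forall>u b. norm (H1T_mult u b - (\<Sum>j<N. l j u *\<^sub>R P j b)) \<le> \<delta> * norm u * norm b)"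
proof -
  interpret finite_measure circle by simp
  \<comment> \<open>Makes the cells so short that the Hoelder factor
    \<open>sqrt (1 / real N)\<close> is at most \<open>\<delta>\<close>.\<close>
  obtain N :: nat where N: "1 / \<delta>\<^sup>2 < real N" using reals_Archimedean2 by blast
  then have N0: "real N > 0" using \<delta> by (smt (verit) zero_less_divide_1_iff zero_less_power)
  have N\<delta>: "sqrt (1 / real N) \<le> \<delta>"
  proof (rule real_le_lsqrt)
    show "1 / real N \<le> \<delta>\<^sup>2" using N \<delta> N0 by (simp add: field_simps)
  qed (use \<delta> in auto)
  define J where "J j = {real j / real N..<(real j + 1) / real N}" for j :: nat
  define \<xi> where "\<xi> j = to_L2T (indicator (J j))" for j
  have ind_sq: "square_integrable circle (indicator (J j) :: real \<Rightarrow> real)" for j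
    by (rule square_integrable_indicator_circle) (simp add: J_def)
  have rep_\<xi>: "AE x in circle. rep_L2T (\<xi> j) x = indicator (J j) x" for j
    unfolding \<xi>_def by (rule rep_to_L2T[OF ind_sq])
  have \<xi>_bd: "AE x in circle. \<bar>rep_L2T (\<xi> j) x\<bar> \<le> 1" for j
    using rep_\<xi>[of j] by eventually_elim (auto simp: indicator_def)
  \<comment> \<open>The average of \<open>u\<close> over \<open>J j\<close>; \<open>real N\<close>
    is the reciprocal of the length of the cell.\<close>
  define l where "l j u = real N * inner (H1T_to_L2T u) (\<xi> j)" for j u
  have l: "bounded_linear (l j)" for j
  proof (rule bounded_linear_intro[where K="real N * norm (\<xi> j)"])
    show "norm (l j u) \<le> norm u * (real N * norm (\<xi> j))" for u
    proof -
      have "\<bar>inner (H1T_to_L2T u) (\<xi> j)\<bar> \<le> norm u * norm (\<xi> j)"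
        using Cauchy_Schwarz_ineq2[of "H1T_to_L2T u" "\<xi> j"] norm_Rep_H1T(1)[of u]
        by (meson mult_right_mono norm_ge_zero order_trans)
      then have "real N * \<bar>inner (H1T_to_L2T u) (\<xi> j)\<bar> \<le> real N * (norm u * norm (\<xi> j))"
        by (rule mult_left_mono) simp
      then show ?thesis by (simp add: l_def abs_mult ac_simps)
    qed
  qed (simp_all add: l_def H1T_to_L2T_linear inner_add_left algebra_simps)
  have P: "bounded_linear (times_L2T (\<xi> j))" for j by (rule bounded_linear_times_L2T[OF \<xi>_bd])
  have main: "norm (H1T_mult u b - (\<Sum>j<N. l j u *\<^sub>R times_L2T (\<xi> j) b)) \<le> \<delta> * norm u * norm b" for u b
  proof -
    obtain F where F: "F \<in> borel_measurable circle" "AE x in circle. rep_L2T (H1T_to_L2T u) x = F x"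
      and holder: "\<And>x y. x \<in> {0..<1} \<Longrightarrow> y \<in> {0..<1} \<Longrightarrow> \<bar>F x - F y\<bar> \<le> norm u * sqrt \<bar>x - y\<bar>"
      using H1T_representative[of u] by metis
    define h where "h x = (\<Sum>j<N. l j u * indicator (J j) x) * rep_L2T b x" for x
    \<comment> \<open>Identifies the finite-rank operator with the class of an explicit step
      function times \<open>b\<close>. Square integrability is carried through the induction because
      \<open>to_L2T\<close> is additive only on square integrable functions.\<close>
    have h_sum: "square_integrable circle (\<lambda>x. (\<Sum>j<m. l j u * indicator (J j) x) * rep_L2T b x) \<and>
        to_L2T (\<lambda>x. (\<Sum>j<m. l j u * indicator (J j) x) * rep_L2T b x) = (\<Sum>j<m. l j u *\<^sub>R times_L2T (\<xi> j) b)" for m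
    proof (induction m)
      case 0 show ?case by (simp add: to_L2T_zero square_integrable_const)
    next
      case (Suc m)
      have term_sq: "square_integrable circle (\<lambda>x. indicator (J m) x * rep_L2T b x)"
        by (rule norm_to_L2T_le(1)[where C=1 and b=b])
          (use borel_measurable_times[OF square_integrableD(1)[OF ind_sq[of m]] rep_L2T_measurable[of b]]
           in \<open>auto simp: indicator_def\<close>)
      have "to_L2T (\<lambda>x. indicator (J m) x * rep_L2T b x) = times_L2T (\<xi> m) b"
        unfolding times_L2T_def
        by (rule to_L2T_cong[OF term_sq times_L2T_square_integrable[OF \<xi>_bd]])
          (use rep_\<xi>[of m] in auto)
      moreover have "(\<lambda>x. (\<Sum>j<Suc m. l j u * indicator (J j) x) * rep_L2T b x) =
          (\<lambda>x. (\<Sum>j<m. l j u * indicator (J j) x) * rep_L2T b x + l m u * (indicator (J m) x * rep_L2T b x))"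
        by (auto simp: algebra_simps)
      ultimately show ?case
        using Suc term_sq
        by (simp add: to_L2T_add to_L2T_scaleR square_integrable_add square_integrable_scaleR)
    qed
    have prod_sq: "square_integrable circle (\<lambda>x. rep_L2T (H1T_to_L2T u) x * rep_L2T b x)"
      by (rule times_L2T_square_integrable[OF H1T_bounded])
    have "H1T_mult u b - (\<Sum>j<N. l j u *\<^sub>R times_L2T (\<xi> j) b) =
        to_L2T (\<lambda>x. rep_L2T (H1T_to_L2T u) x * rep_L2T b x - h x)"
      using h_sum[of N] prod_sq by (simp add: H1T_mult_def times_L2T_def h_def to_L2T_diff)
    also have "norm \<dots> \<le> (\<delta> * norm u) * norm b"
    proof (rule norm_to_L2T_le(2))
      show "(\<lambda>x. rep_L2T (H1T_to_L2T u) x * rep_L2T b x - h x) \<in> borel_measurable circle"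
        using prod_sq h_sum[of N] by (intro borel_measurable_diff square_integrableD(1)) (auto simp: h_def[abs_def])
      show "0 \<le> \<delta> * norm u" using \<delta> by simp
      show "AE x in circle. \<bar>rep_L2T (H1T_to_L2T u) x * rep_L2T b x - h x\<bar> \<le> \<delta> * norm u * \<bar>rep_L2T b x\<bar>"
        using F(2) AE_space
      proof eventually_elim
        case (elim x)
        then have x: "0 \<le> x" "x < 1" by auto
        \<comment> \<open>The index of the cell containing \<open>x\<close>; the cells are
          half-open, so it is the only one.\<close>
        define i where "i = nat \<lfloor>real N * x\<rfloor>"
        have i: "real i \<le> real N * x" "real N * x < real i + 1"
          using x N0 by (auto simp: i_def)
        have iN: "i < N"
        proof -
          have "real N * x < real N" using x N0 by simp
          then have "real i < real N" using i by linarith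
          then show ?thesis by simp
        qed
        have xJ: "x \<in> J j \<longleftrightarrow> j = i" for j
        proof -
          have "x \<in> J j \<longleftrightarrow> real j \<le> real N * x \<and> real N * x < real j + 1"
            using N0 by (auto simp: J_def field_simps)
          also have "\<dots> \<longleftrightarrow> j = i" using i by (auto; linarith)
          finally show ?thesis .
        qed
        have "h x = l i u * rep_L2T b x"
        proof -
          have "(\<Sum>j<N. l j u * indicator (J j) x) = (\<Sum>j<N. if j = i then l j u else 0)"
            by (intro sum.cong) (auto simp: indicator_def xJ)
          then show ?thesis using iN by (simp add: h_def)
        qed
        then have "rep_L2T (H1T_to_L2T u) x * rep_L2T b x - h x = (F x - l i u) * rep_L2T b x"
          using elim by (simp add: algebra_simps)
        moreover have "\<bar>F x - l i u\<bar> \<le> \<delta> * norm u"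
        proof -
          have Jle: "0 \<le> real i / real N" "real i / real N \<le> (real i + 1) / real N" "(real i + 1) / real N \<le> 1"
            using iN N0 by (auto simp: field_simps)
          have J_sets: "J i \<in> sets circle"
            using Jle by (auto simp: J_def circle_def sets_restrict_space_iff)
          have J_measure: "measure circle (J i) = 1 / real N"
            unfolding J_def using measure_circle_Ico[OF Jle] N0 by (simp add: field_simps)
          have "J i \<inter> {0..<1} = J i" using Jle by (auto simp: J_def)
          note J_measure = J_measure this
          have F_sq: "square_integrable circle F"
            by (rule square_integrable_bound[OF square_integrable_norm[OF square_integrable_rep[of "H1T_to_L2T u"]] F(1)])
              (use F(2) in \<open>eventually_elim, simp\<close>)
          have FJ: "integrable circle (\<lambda>y. F y * indicator (J i) y)"
            by (rule square_integrable_mult[OF F_sq ind_sq])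
          have "inner (H1T_to_L2T u) (\<xi> i) = (\<integral>y. rep_L2T (H1T_to_L2T u) y * indicator (J i) y \<partial>circle)"
            using inner_to_L2T[OF square_integrable_rep[of "H1T_to_L2T u"] ind_sq[of i]] by (simp add: \<xi>_def)
          also have "\<dots> = (\<integral>y. F y * indicator (J i) y \<partial>circle)"
            by (rule integral_cong_AE) (use F J_sets in \<open>auto\<close>)
          finally have l_eq: "l i u = real N * (\<integral>y. F y * indicator (J i) y \<partial>circle)" by (simp add: l_def)
          \<comment> \<open>The constant \<open>F x\<close> is its own average over
            \<open>J i\<close>, so both terms come under one integral, whose integrand the Hoelder
            estimate controls.\<close>
          have "F x - l i u = real N * (\<integral>y. F x * indicator (J i) y \<partial>circle) - l i u"
            using J_measure J_sets N0 by simp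
          also have "\<dots> = real N * (\<integral>y. F x * indicator (J i) y - F y * indicator (J i) y \<partial>circle)"
            using FJ J_sets unfolding l_eq
            by (subst Bochner_Integration.integral_diff) (auto simp: right_diff_distrib emeasure_finite less_top[symmetric])
          finally have "\<bar>F x - l i u\<bar> = real N * \<bar>\<integral>y. F x * indicator (J i) y - F y * indicator (J i) y \<partial>circle\<bar>"
            using N0 by (simp add: abs_mult)
          also have "\<bar>\<integral>y. F x * indicator (J i) y - F y * indicator (J i) y \<partial>circle\<bar>
              \<le> (\<integral>y. \<bar>F x * indicator (J i) y - F y * indicator (J i) y\<bar> \<partial>circle)"
            by (rule integral_abs_bound)
          also have "\<dots> \<le> (\<integral>y. (\<delta> * norm u) * indicator (J i) y \<partial>circle)"
          proof (rule integral_mono)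
            have Jint: "integrable circle (\<lambda>y. c * indicator (J i) y)" for c :: real
              using J_sets by (auto simp: emeasure_finite less_top[symmetric])
            show "integrable circle (\<lambda>y. \<bar>F x * indicator (J i) y - F y * indicator (J i) y\<bar>)"
              using FJ Jint[of "F x"] by (intro integrable_abs Bochner_Integration.integrable_diff)
            show "integrable circle (\<lambda>y. \<delta> * norm u * indicator (J i) y)" by (rule Jint)
            fix y assume "y \<in> space circle"
            then have y: "y \<in> {0..<1}" by simp
            show "\<bar>F x * indicator (J i) y - F y * indicator (J i) y\<bar> \<le> \<delta> * norm u * indicator (J i) y"
            proof (cases "y \<in> J i")
              case True
              have "x \<in> J i" by (simp add: xJ)
              with True have "\<bar>x - y\<bar> \<le> (real i + 1) / real N - real i / real N"
                unfolding J_def by auto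
              also have "\<dots> = 1 / real N" by (simp add: diff_divide_distrib[symmetric])
              finally have "sqrt \<bar>x - y\<bar> \<le> \<delta>"
                using N\<delta> by (meson order_trans real_sqrt_le_mono)
              then have "norm u * sqrt \<bar>x - y\<bar> \<le> norm u * \<delta>" by (rule mult_left_mono) simp
              then show ?thesis using holder[of x y] x y True by (simp add: mult.commute)
            qed simp
          qed
          also have "\<dots> = \<delta> * norm u * (1 / real N)" using J_measure J_sets by simp
          finally show ?thesis using N0 by (simp add: mult_left_mono field_simps)
        qed
        ultimately show ?case by (simp add: abs_mult mult_right_mono)
      qed
    qed
    finally show ?thesis by simp
  qed
  show ?thesis using l P main by (intro exI[of _ N] exI[of _ l] exI[of _ "\<lambda>j. times_L2T (\<xi> j)"]) auto
qed

section \<open>Weakly convergent coefficients in mild solutions\<close>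

lemma space_time [simp]: "space (time T) = {0<..<T}"
  by (simp add: time_def space_restrict_space)

lemma finite_measure_time [simp]: "finite_measure (time T)"
  using emeasure_bounded_finite[of "{0<..<T}"]
  by (intro finite_measureI) (simp add: time_def emeasure_restrict_space space_restrict_space)

lemma measurable_time:
  "f \<in> borel_measurable borel \<Longrightarrow> f \<in> borel_measurable (time T)"
  unfolding time_def by (intro measurable_restrict_space1) simp

lemma measure_time_subset:
  "A \<in> sets borel \<Longrightarrow> A \<subseteq> {0<..<T} \<Longrightarrow> measure (time T) A = measure lborel A"
  unfolding time_def by (intro measure_restrict_space) auto

lemma continuous_measurable_time:
  assumes "continuous_on {0..T} X"
  shows "X \<in> borel_measurable (time T)"
proof -
  have "X \<in> borel_measurable (restrict_space borel {0<..<T})"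
    by (rule borel_measurable_continuous_on_restrict) (rule continuous_on_subset[OF assms], auto)
  moreover have "sets (restrict_space borel {0<..<T}) = sets (time T)"
    unfolding time_def by (intro sets_restrict_space_cong) simp
  ultimately show ?thesis by (simp cong: measurable_cong_sets)
qed

text \<open>Mild solutions integrate over \<open>{0..t}\<close> against Lebesgue measure, whereas
  weak convergence lives on \<open>time T\<close>. Moving the cut-off into the integrand lets one
  measure serve every \<open>t\<close>; the endpoints 0 and \<open>T\<close> are null.\<close>

lemma integral_time_eq:
  fixes F :: "real \<Rightarrow> 'k::{banach, second_countable_topology}"
  assumes t: "0 \<le> t" "t \<le> T" and F: "set_integrable lborel {0..t} F"
  shows "integrable (time T) (\<lambda>s. indicator {..t} s *\<^sub>R F s)"
    and "(LINT s:{0..t}|lborel. F s) = (\<integral>s. indicator {..t} s *\<^sub>R F s \<partial>time T)"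
proof -
  have "integrable lborel (\<lambda>s. indicator {0<..<T} s *\<^sub>R (indicator {0..t} s *\<^sub>R F s))"
    using F unfolding set_integrable_def by (rule integrable_mult_indicator[rotated]) simp
  also have eq: "(\<lambda>s. indicator {0<..<T} s *\<^sub>R (indicator {0..t} s *\<^sub>R F s)) =
      (\<lambda>s. indicator {0<..<T} s *\<^sub>R (indicator {..t} s *\<^sub>R F s))"
    by (auto simp: indicator_def)
  finally have int: "integrable lborel (\<lambda>s. indicator {0<..<T} s *\<^sub>R (indicator {..t} s *\<^sub>R F s))" .
  then show "integrable (time T) (\<lambda>s. indicator {..t} s *\<^sub>R F s)"
    unfolding time_def by (subst integrable_restrict_space) (auto simp: set_integrable_def)
  have "(LINT s:{0..t}|lborel. F s) = (\<integral>s. indicator {0<..<T} s *\<^sub>R (indicator {..t} s *\<^sub>R F s) \<partial>lborel)"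
    unfolding set_lebesgue_integral_def
  proof (rule integral_cong_AE)
    show "AE s in lborel. indicator {0..t} s *\<^sub>R F s = indicator {0<..<T} s *\<^sub>R (indicator {..t} s *\<^sub>R F s)"
      using AE_lborel_singleton[of 0] AE_lborel_singleton[of T]
      by eventually_elim (use t in \<open>auto simp: indicator_def\<close>)
  qed (use borel_measurable_integrable[OF F[unfolded set_integrable_def]] borel_measurable_integrable[OF int] in simp_all)
  then show "(LINT s:{0..t}|lborel. F s) = (\<integral>s. indicator {..t} s *\<^sub>R F s \<partial>time T)"
    unfolding time_def by (subst integral_restrict_space) (auto simp: set_lebesgue_integral_def)
qed

lemma l2norm_indicator_time:
  assumes "0 \<le> a" "a \<le> b" "b \<le> T"
  shows "l2norm (time T) (indicator {a<..b} :: real \<Rightarrow> real) \<le> sqrt (b - a)"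
proof -
  have "(\<lambda>s. (norm (indicator {a<..b} s :: real))\<^sup>2) = indicator {a<..b}"
    by (rule ext) (simp add: indicator_def)
  then have "l2norm (time T) (indicator {a<..b} :: real \<Rightarrow> real) = sqrt (\<integral>s. indicator {a<..b} s \<partial>time T)"
    by (simp add: l2norm_def)
  also have "(\<integral>s. indicator {a<..b} s \<partial>time T) = measure (time T) ({a<..b} \<inter> {0<..<T})"
    by (simp add: Int_commute)
  also have "\<dots> = measure lborel ({a<..b} \<inter> {0<..<T})"
    by (intro measure_time_subset) auto
  also have "\<dots> \<le> measure lborel {a<..b}"
    by (intro measure_mono_fmeasurable fmeasurableI emeasure_bounded_finite) auto
  also have "\<dots> = b - a" using assms by simp
  finally show ?thesis by simp
qed

lemma integral_norm_le_l2norm_time: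
  fixes f :: "real \<Rightarrow> 'b::{banach, second_countable_topology}"
  assumes T: "T > 0" and f: "square_integrable (time T) f"
  shows "(\<integral>s. norm (f s) \<partial>time T) \<le> sqrt T * l2norm (time T) f"
proof -
  have "(\<integral>s. \<bar>1 * norm (f s)\<bar> \<partial>time T) \<le> l2norm (time T) (\<lambda>_. 1 :: real) * l2norm (time T) (\<lambda>s. norm (f s))"
    by (intro integral_mult_le_l2norm square_integrable_norm f square_integrable_const finite_measure_time)
  moreover have "measure (time T) {0<..<T} = T"
    using T by (subst measure_time_subset) auto
  ultimately show ?thesis by (simp add: l2norm_def)
qed

section \<open>Weakly null scalar functions of time and continuous kernels\<close>

lemma square_integrable_indicator_times:
  fixes g :: "'a \<Rightarrow> real"
  assumes g: "square_integrable M g" and A: "(indicator A :: 'a \<Rightarrow> real) \<in> borel_measurable M"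
  shows "square_integrable M (\<lambda>s. indicator A s * g s)"
  by (rule square_integrable_bound[OF square_integrable_norm[OF g]])
    (use borel_measurable_times[OF A square_integrableD(1)[OF g]] in \<open>auto simp: indicator_def\<close>)

lemma indicator_measurable_time [measurable]:
  "A \<in> sets borel \<Longrightarrow> (indicator A :: real \<Rightarrow> real) \<in> borel_measurable (time T)"
  by (intro measurable_time) simp

lemma square_integrable_indicator_time:
  "A \<in> sets borel \<Longrightarrow> square_integrable (time T) (indicator A :: real \<Rightarrow> real)"
  by (rule square_integrable_bound[OF square_integrable_const[OF finite_measure_time, of T 1]])
    (auto simp: indicator_def measurable_time)

text \<open>Testing with indicators gives convergence of the primitives at each time. By
  Cauchy--Schwarz they are Hoelder continuous of exponent 1/2 with the common constant
  \<open>C\<close>, so finitely many grid times decide uniform convergence.\<close>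

lemma weak_null_primitive_uniform:
  fixes g :: "nat \<Rightarrow> real \<Rightarrow> real"
  assumes T: "T > 0" and g: "\<And>n. square_integrable (time T) (g n)"
    and C: "\<And>n. l2norm (time T) (g n) \<le> C"
    and weak: "\<And>\<psi>. square_integrable (time T) \<psi> \<Longrightarrow> (\<lambda>n. \<integral>s. g n s * \<psi> s \<partial>time T) \<longlonglongrightarrow> 0"
    and e: "e > 0"
  shows "eventually (\<lambda>n. \<forall>t\<in>{0..T}. \<bar>\<integral>s. indicator {..t} s * g n s \<partial>time T\<bar> < e) sequentially"
proof -
  define G where "G n t = (\<integral>s. indicator {..t} s * g n s \<partial>time T)" for n t
  have int: "integrable (time T) (\<lambda>s. indicator A s * g n s)" if "A \<in> sets borel" for A n
    by (rule square_integrable_mult[OF square_integrable_indicator_time g]) (rule that)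
  have C0: "C \<ge> 0" using C[of 0] l2norm_nonneg[of "time T" "g 0"] by linarith
  have diff: "\<bar>G n t - G n r\<bar> \<le> sqrt (t - r) * C" if "0 \<le> r" "r \<le> t" "t \<le> T" for n t r
  proof -
    have "G n t - G n r = (\<integral>s. indicator {..t} s * g n s - indicator {..r} s * g n s \<partial>time T)"
      by (simp add: G_def int)
    also have "\<dots> = (\<integral>s. indicator {r<..t} s * g n s \<partial>time T)"
      by (rule Bochner_Integration.integral_cong) (use that in \<open>auto simp: indicator_def\<close>)
    also have "\<bar>\<dots>\<bar> \<le> (\<integral>s. \<bar>indicator {r<..t} s * g n s\<bar> \<partial>time T)" by (rule integral_abs_bound)
    also have "\<dots> \<le> l2norm (time T) (indicator {r<..t} :: real \<Rightarrow> real) * l2norm (time T) (g n)"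
      by (intro integral_mult_le_l2norm g square_integrable_indicator_time) simp
    also have "\<dots> \<le> sqrt (t - r) * C"
      by (intro mult_mono C l2norm_indicator_time) (use that in auto)
    finally show ?thesis .
  qed
  \<comment> \<open>Chosen so that the oscillation over one cell of length \<open>h\<close>, at most
    \<open>sqrt h * C\<close>, stays below \<open>e / 2\<close>. \<open>C + 1\<close> stands in for
    \<open>C\<close> to allow division when \<open>C = 0\<close>.\<close>
  obtain N :: nat where N: "T * (2 * (C + 1) / e)\<^sup>2 < real N" using reals_Archimedean2 by blast
  have "0 \<le> T * (2 * (C + 1) / e)\<^sup>2" using T by simp
  then have N0: "real N > 0" using N by linarith
  define h where "h = T / real N"
  have h: "h > 0" "real N * h = T" using T N0 by (simp_all add: h_def)
  have small: "sqrt h * C < e / 2"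
  proof -
    have "h < (e / (2 * (C + 1)))\<^sup>2"
    proof -
      have "T * (2 * (C + 1))\<^sup>2 < real N * e\<^sup>2"
        using N e by (simp add: power_divide pos_divide_less_eq)
      then show ?thesis using N0 C0 unfolding h_def power_divide
        by (subst pos_divide_less_eq, simp, subst times_divide_eq_left, subst pos_less_divide_eq)
          (auto simp: mult.commute add_nonneg_pos)
    qed
    then have "sqrt h < sqrt ((e / (2 * (C + 1)))\<^sup>2)" by (rule real_sqrt_less_mono)
    also have "\<dots> = e / (2 * (C + 1))" using e C0 by (subst real_sqrt_abs) simp
    finally have "sqrt h * (C + 1) < e / 2" using C0 by (simp add: field_simps)
    moreover have "sqrt h * C \<le> sqrt h * (C + 1)" using h by (intro mult_left_mono) auto
    ultimately show ?thesis by linarith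
  qed
  have "eventually (\<lambda>n. \<forall>k\<in>{..N}. \<bar>G n (real k * h)\<bar> < e / 2) sequentially"
  proof (intro eventually_ball_finite ballI)
    fix k
    have "(\<lambda>n. G n (real k * h)) \<longlonglongrightarrow> 0"
      unfolding G_def using weak[OF square_integrable_indicator_time[of "{..real k * h}"]]
      by (simp add: mult.commute)
    then show "eventually (\<lambda>n. \<bar>G n (real k * h)\<bar> < e / 2) sequentially"
      using e by (auto dest!: tendstoD[of _ _ _ "e / 2"])
  qed simp
  then show ?thesis
    unfolding G_def[symmetric]
  proof eventually_elim
    case (elim n)
    show ?case
    proof
      fix t assume t: "t \<in> {0..T}"
      define k where "k = nat \<lfloor>t / h\<rfloor>"
      have k: "real k * h \<le> t" "t < (real k + 1) * h"
      proof -
        have "real k \<le> t / h" "t / h < real k + 1" using t h by (auto simp: k_def)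
        then show "real k * h \<le> t" "t < (real k + 1) * h" using h by (auto simp: field_simps)
      qed
      have "real k * h \<le> real N * h" using k t h by simp
      then have kN: "k \<le> N" unfolding mult_le_cancel_right_pos[OF h(1)] by simp
      have "\<bar>G n t - G n (real k * h)\<bar> \<le> sqrt (t - real k * h) * C"
        by (rule diff) (use k t h in auto)
      also have "\<dots> \<le> sqrt h * C" using k C0 by (intro mult_right_mono) (auto simp: algebra_simps)
      finally have "\<bar>G n t - G n (real k * h)\<bar> < e / 2" using small by simp
      moreover have "\<bar>G n (real k * h)\<bar> < e / 2" using elim kN by simp
      ultimately show "\<bar>G n t\<bar> < e" by linarith
    qed
  qed
qed

text \<open>Freezing the kernel in \<open>s\<close> at the left ends of short cells turns the
  integral into finitely many increments of the scalar primitive, which are small uniformly in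
  \<open>t\<close>. The freezing error is weighted by the L^1 norm of \<open>g n\<close>, which is
  bounded in \<open>n\<close>.\<close>

lemma weak_null_kernel_uniform:
  fixes g :: "nat \<Rightarrow> real \<Rightarrow> real" and \<Phi> :: "real \<Rightarrow> real \<Rightarrow> 'k::{banach, second_countable_topology}"
  assumes T: "T > 0" and g: "\<And>n. square_integrable (time T) (g n)"
    and C: "\<And>n. l2norm (time T) (g n) \<le> C"
    and weak: "\<And>\<psi>. square_integrable (time T) \<psi> \<Longrightarrow> (\<lambda>n. \<integral>s. g n s * \<psi> s \<partial>time T) \<longlonglongrightarrow> 0"
    and \<Phi>: "continuous_on ({0..T} \<times> {0..T}) (\<lambda>(t, s). \<Phi> t s)"
    and e: "e > 0"
  shows "eventually (\<lambda>n. \<forall>t\<in>{0..T}. norm (\<integral>s. indicator {..t} s *\<^sub>R (g n s *\<^sub>R \<Phi> t s) \<partial>time T) < e) sequentially"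
proof -
  define G where "G n t = (\<integral>s. indicator {..t} s * g n s \<partial>time T)" for n t
  have C0: "C \<ge> 0" using C[of 0] l2norm_nonneg[of "time T" "g 0"] by linarith
  have cpt: "compact ({0..T} \<times> {0..T})" by (intro compact_Times) auto
  have "bounded ((\<lambda>(t, s). \<Phi> t s) ` ({0..T} \<times> {0..T}))"
    by (intro compact_imp_bounded compact_continuous_image \<Phi> cpt)
  then obtain K where K0: "K > 0" and "\<forall>x\<in>(\<lambda>(t, s). \<Phi> t s) ` ({0..T} \<times> {0..T}). norm x \<le> K"
    unfolding bounded_pos by blast
  then have K: "\<And>t s. t \<in> {0..T} \<Longrightarrow> s \<in> {0..T} \<Longrightarrow> norm (\<Phi> t s) \<le> K" by auto
  \<comment> \<open>The freezing error is at most \<open>\<delta>\<close> times the L^1 bound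
    \<open>sqrt T * C\<close>, hence at most \<open>e / 4\<close>.\<close>
  define \<delta> where "\<delta> = e / (4 * (sqrt T * C + 1))"
  have TC: "sqrt T * C \<ge> 0" using T C0 by simp
  have \<delta>: "\<delta> > 0" unfolding \<delta>_def using e TC by (intro divide_pos_pos) auto
  obtain d where d: "d > 0"
      "\<And>t s r. t \<in> {0..T} \<Longrightarrow> s \<in> {0..T} \<Longrightarrow> r \<in> {0..T} \<Longrightarrow> \<bar>s - r\<bar> < d \<Longrightarrow> norm (\<Phi> t s - \<Phi> t r) < \<delta>"
  proof -
    obtain d where "d > 0" and d: "\<forall>x\<in>{0..T} \<times> {0..T}. \<forall>y\<in>{0..T} \<times> {0..T}. dist y x < d \<longrightarrow>
        dist ((\<lambda>(t, s). \<Phi> t s) y) ((\<lambda>(t, s). \<Phi> t s) x) < \<delta>"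
      using compact_uniformly_continuous[OF \<Phi> cpt] \<delta> unfolding uniformly_continuous_on_def by blast
    show thesis
    proof (rule that[OF \<open>d > 0\<close>])
      fix t s r assume "t \<in> {0..T}" "s \<in> {0..T}" "r \<in> {0..T}" "\<bar>s - r\<bar> < d"
      then show "norm (\<Phi> t s - \<Phi> t r) < \<delta>"
        using d[rule_format, of "(t, r)" "(t, s)"] by (simp add: dist_norm dist_Pair_Pair)
    qed
  qed
  obtain N :: nat where N: "T / d < real N" using reals_Archimedean2 by blast
  have "0 < T / d" using T d by simp
  then have N0: "real N > 0" using N by linarith
  define h where "h = T / real N"
  have h: "h > 0" "real N * h = T" "h < d" using T N N0 d by (simp_all add: h_def field_simps)
  \<comment> \<open>Cells open on the left and closed on the right, as produced by differences of
    integrals over \<open>{..t}\<close>.\<close>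
  define I where "I l = {real l * h<..(real l + 1) * h}" for l :: nat
  have I_part: "\<exists>l<N. s \<in> I l \<and> (\<forall>j. s \<in> I j \<longleftrightarrow> j = l)" if s: "s \<in> {0<..<T}" for s
  proof -
    \<comment> \<open>A grid point belongs to the cell ending there, hence the ceiling minus one
      rather than the floor.\<close>
    define l where "l = nat (\<lceil>s / h\<rceil> - 1)"
    have pos: "0 < s / h" using s h by simp
    then have "real l < s / h" "s / h \<le> real l + 1" unfolding l_def by linarith+
    then have l: "real l * h < s" "s \<le> (real l + 1) * h" using h by (auto simp: field_simps)
    have "real l * h < real N * h" using l s h by simp
    then have "l < N" unfolding mult_less_cancel_right_pos[OF h(1)] by simp
    moreover have "s \<in> I j \<longleftrightarrow> j = l" for j
    proof
      assume "s \<in> I j"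
      then have "real j * h < (real l + 1) * h" "real l * h < (real j + 1) * h" using l by (auto simp: I_def)
      then have "real j < real l + 1" "real l < real j + 1" using h by simp_all
      then show "j = l" by linarith
    qed (use l in \<open>auto simp: I_def\<close>)
    ultimately show ?thesis by blast
  qed
  \<comment> \<open>Each of the \<open>N\<close> cells contributes two values of the primitive with
    a weight of at most \<open>K\<close>, in total at most
    \<open>2 * \<eta> * K * real N \<le> e / 2\<close>. Together with the freezing error
    \<open>e / 4\<close> this stays below \<open>e\<close>.\<close>
  define \<eta> where "\<eta> = e / (4 * (real N * K + 1))"
  have NK: "real N * K \<ge> 0" using K0 by simp
  have \<eta>: "\<eta> > 0" unfolding \<eta>_def using e NK by (intro divide_pos_pos) auto
  have gm: "g n \<in> borel_measurable (time T)" for n by (rule square_integrableD(1)[OF g])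
  have int: "integrable (time T) (\<lambda>s. indicator A s * g n s)" if "A \<in> sets borel" for A n
    by (rule square_integrable_mult[OF square_integrable_indicator_time g]) (rule that)
  have "eventually (\<lambda>n. \<forall>t\<in>{0..T}. \<bar>G n t\<bar> < \<eta>) sequentially"
    unfolding G_def by (rule weak_null_primitive_uniform[OF T g C weak \<eta>])
  then show ?thesis
  proof eventually_elim
    case (elim n)
    show ?case
    proof
      fix t assume t: "t \<in> {0..T}"
      define \<Psi> where "\<Psi> s = (\<Sum>l<N. indicator (I l) s *\<^sub>R \<Phi> t (real l * h))" for s
      have close: "norm (\<Phi> t s - \<Psi> s) \<le> \<delta>" if s: "s \<in> {0<..<T}" for s
      proof -
        obtain l where l: "l < N" "s \<in> I l" "\<And>j. s \<in> I j \<longleftrightarrow> j = l" using I_part[OF s] by blast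
        have "\<Psi> s = (\<Sum>j<N. if j = l then \<Phi> t (real j * h) else 0)"
          unfolding \<Psi>_def by (intro sum.cong) (auto simp: indicator_def l(3))
        then have "\<Psi> s = \<Phi> t (real l * h)" using l(1) by simp
        moreover have "norm (\<Phi> t s - \<Phi> t (real l * h)) < \<delta>"
        proof (rule d(2)[OF t])
          have "real l * h < s" "s \<le> real l * h + h" using l(2) by (auto simp: I_def algebra_simps)
          then show "\<bar>s - real l * h\<bar> < d" "real l * h \<in> {0..T}" "s \<in> {0..T}" using h s by auto
        qed
        ultimately show ?thesis by simp
      qed
      have close2: "\<bar>g n s\<bar> * norm (\<Phi> t s - \<Psi> s) \<le> \<delta> * \<bar>g n s\<bar>" if "s \<in> {0<..<T}" for s
        using mult_left_mono[OF close[OF that], of "\<bar>g n s\<bar>"] by (simp add: mult.commute)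
      have \<Phi>m: "(\<lambda>s. \<Phi> t s) \<in> borel_measurable (time T)"
      proof (rule continuous_measurable_time)
        have "continuous_on {0..T} (\<lambda>s. (t, s))" by (intro continuous_intros)
        from continuous_on_compose2[OF \<Phi> this] t show "continuous_on {0..T} (\<Phi> t)" by (simp add: image_subset_iff)
      qed
      have \<Psi>m: "\<Psi> \<in> borel_measurable (time T)"
        unfolding \<Psi>_def by (intro borel_measurable_sum borel_measurable_scaleR indicator_measurable_time
            borel_measurable_const) (simp add: I_def)
      have g_int: "integrable (time T) (\<lambda>s. \<bar>g n s\<bar>)"
        using square_integrable_integrable[OF finite_measure_time g] by simp
      have err_int: "integrable (time T) (\<lambda>s. indicator {..t} s *\<^sub>R (g n s *\<^sub>R (\<Phi> t s - \<Psi> s)))"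
      proof (rule Bochner_Integration.integrable_bound)
        show "integrable (time T) (\<lambda>s. \<delta> * \<bar>g n s\<bar>)" using g_int by simp
        show "(\<lambda>s. indicator {..t} s *\<^sub>R (g n s *\<^sub>R (\<Phi> t s - \<Psi> s))) \<in> borel_measurable (time T)"
          by (intro borel_measurable_scaleR indicator_measurable_time gm borel_measurable_diff \<Phi>m \<Psi>m) simp
        show "AE s in time T. norm (indicator {..t} s *\<^sub>R (g n s *\<^sub>R (\<Phi> t s - \<Psi> s))) \<le> norm (\<delta> * \<bar>g n s\<bar>)"
          using close2 \<delta> by (intro AE_I2) (simp add: indicator_def abs_mult)
      qed
      have term_int: "integrable (time T) (\<lambda>s. (indicator {..t} s * indicator (I l) s * g n s) *\<^sub>R c)" for l and c :: 'k
      proof -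
        have "integrable (time T) (\<lambda>s. indicator ({..t} \<inter> I l) s * g n s)"
          by (rule int) (auto simp: I_def)
        then show ?thesis by (intro integrable_scaleR_left) (simp add: indicator_inter_arith)
      qed
      define A where "A = (\<integral>s. indicator {..t} s *\<^sub>R (g n s *\<^sub>R (\<Phi> t s - \<Psi> s)) \<partial>time T)"
      define D where "D = (\<Sum>l<N. (\<integral>s. indicator {..t} s * indicator (I l) s * g n s \<partial>time T) *\<^sub>R \<Phi> t (real l * h))"
      have "(\<integral>s. indicator {..t} s *\<^sub>R (g n s *\<^sub>R \<Phi> t s) \<partial>time T) =
          (\<integral>s. indicator {..t} s *\<^sub>R (g n s *\<^sub>R (\<Phi> t s - \<Psi> s)) +
             (\<Sum>l<N. (indicator {..t} s * indicator (I l) s * g n s) *\<^sub>R \<Phi> t (real l * h)) \<partial>time T)"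
      proof (intro Bochner_Integration.integral_cong refl)
        fix s
        have "(\<Sum>l<N. (indicator {..t} s * indicator (I l) s * g n s) *\<^sub>R \<Phi> t (real l * h)) =
            (indicator {..t} s * g n s) *\<^sub>R \<Psi> s"
          unfolding \<Psi>_def scaleR_sum_right scaleR_scaleR by (intro sum.cong refl) (simp only: ac_simps)
        then show "indicator {..t} s *\<^sub>R (g n s *\<^sub>R \<Phi> t s) =
            indicator {..t} s *\<^sub>R (g n s *\<^sub>R (\<Phi> t s - \<Psi> s)) +
             (\<Sum>l<N. (indicator {..t} s * indicator (I l) s * g n s) *\<^sub>R \<Phi> t (real l * h))"
          by (simp only: scaleR_diff_right scaleR_scaleR diff_add_cancel)
      qed
      also have "\<dots> = A + D"
      proof -
        have "(\<integral>s. (\<Sum>l<N. (indicator {..t} s * indicator (I l) s * g n s) *\<^sub>R \<Phi> t (real l * h)) \<partial>time T)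
           = (\<Sum>l<N. (\<integral>s. (indicator {..t} s * indicator (I l) s * g n s) *\<^sub>R \<Phi> t (real l * h) \<partial>time T))"
          by (rule Bochner_Integration.integral_sum) (rule term_int)
        also have "\<dots> = (\<Sum>l<N. (\<integral>s. indicator {..t} s * indicator (I l) s * g n s \<partial>time T) *\<^sub>R \<Phi> t (real l * h))"
        proof (intro sum.cong refl integral_scaleR_left)
          fix l
          have "integrable (time T) (\<lambda>s. indicator ({..t} \<inter> I l) s * g n s)"
            by (rule int) (auto simp: I_def)
          then show "integrable (time T) (\<lambda>s. indicator {..t} s * indicator (I l) s * g n s)"
            by (simp add: indicator_inter_arith)
        qed
        finally show ?thesis
          unfolding A_def D_def
          by (subst Bochner_Integration.integral_add[OF err_int])
            (auto intro: Bochner_Integration.integrable_sum term_int)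
      qed
      finally have split: "(\<integral>s. indicator {..t} s *\<^sub>R (g n s *\<^sub>R \<Phi> t s) \<partial>time T) = A + D" .
      have A_le: "norm A \<le> e / 4"
      proof -
        have "norm A
            \<le> (\<integral>s. norm (indicator {..t} s *\<^sub>R (g n s *\<^sub>R (\<Phi> t s - \<Psi> s))) \<partial>time T)"
          unfolding A_def by (rule integral_norm_bound)
        also have "\<dots> \<le> (\<integral>s. \<delta> * \<bar>g n s\<bar> \<partial>time T)"
        proof (rule integral_mono[OF integrable_norm[OF err_int]])
          show "integrable (time T) (\<lambda>s. \<delta> * \<bar>g n s\<bar>)" using g_int by simp
          show "norm (indicator {..t} s *\<^sub>R (g n s *\<^sub>R (\<Phi> t s - \<Psi> s))) \<le> \<delta> * \<bar>g n s\<bar>"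
            if "s \<in> space (time T)" for s
            using close2[of s] that \<delta> by (simp add: indicator_def abs_mult)
        qed
        also have "\<dots> = \<delta> * (\<integral>s. norm (g n s) \<partial>time T)" by simp
        also have "\<dots> \<le> \<delta> * (sqrt T * C)"
        proof -
          have "(\<integral>s. norm (g n s) \<partial>time T) \<le> sqrt T * l2norm (time T) (g n)"
            by (rule integral_norm_le_l2norm_time[OF T g])
          also have "\<dots> \<le> sqrt T * C" using T C[of n] by (intro mult_left_mono) auto
          finally show ?thesis using \<delta> by (intro mult_left_mono) auto
        qed
        also have "\<dots> \<le> \<delta> * (sqrt T * C + 1)" using \<delta> by (intro mult_left_mono) auto
        also have "\<dots> = e / 4"
        proof -
          have "sqrt T * C + 1 > 0" using TC by linarith
          moreover have "e / (4 * z) * z = e / 4" if "z > 0" for z :: real using that by simp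
          ultimately show ?thesis unfolding \<delta>_def by blast
        qed
        finally show ?thesis .
      qed
      have D_le: "norm D \<le> e / 2"
      proof -
        have "norm ((\<integral>s. indicator {..t} s * indicator (I l) s * g n s \<partial>time T) *\<^sub>R \<Phi> t (real l * h)) \<le> 2 * \<eta> * K"
          if l: "l < N" for l
        proof -
          have lh: "real l * h \<in> {0..T}" "(real l + 1) * h \<in> {0..T}"
          proof -
            have "real l * h \<le> real N * h" "(real l + 1) * h \<le> real N * h"
              using l h by (auto intro!: mult_right_mono)
            then show "real l * h \<in> {0..T}" "(real l + 1) * h \<in> {0..T}" using h by auto
          qed
          \<comment> \<open>Truncating both ends of the cell at \<open>t\<close> treats the cells
            before, across and after \<open>t\<close> alike.\<close>
          have "(\<integral>s. indicator {..t} s * indicator (I l) s * g n s \<partial>time T) =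
              (\<integral>s. indicator {..min t ((real l + 1) * h)} s * g n s - indicator {..min t (real l * h)} s * g n s \<partial>time T)"
            by (rule Bochner_Integration.integral_cong) (use h in \<open>auto simp: I_def indicator_def algebra_simps\<close>)
          also have "\<dots> = G n (min t ((real l + 1) * h)) - G n (min t (real l * h))"
            unfolding G_def by (rule Bochner_Integration.integral_diff) (rule int, simp)+
          also have "\<bar>\<dots>\<bar> \<le> 2 * \<eta>"
          proof -
            have "min t ((real l + 1) * h) \<in> {0..T}" "min t (real l * h) \<in> {0..T}" using lh t by auto
            then have "\<bar>G n (min t ((real l + 1) * h))\<bar> < \<eta>" "\<bar>G n (min t (real l * h))\<bar> < \<eta>"
              using elim by blast+
            then show ?thesis by linarith
          qed
          finally show ?thesis unfolding norm_scaleR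
            by (intro mult_mono K t lh) (use \<eta> in auto)
        qed
        then have "norm D \<le> (\<Sum>l<N. 2 * \<eta> * K)"
          unfolding D_def by (intro sum_norm_le) auto
        also have "\<dots> \<le> 2 * \<eta> * (real N * K + 1)" using \<eta> by (simp add: algebra_simps)
        also have "\<dots> = e / 2"
        proof -
          have "real N * K + 1 > 0" using NK by linarith
          moreover have "2 * (e / (4 * z)) * z = e / 2" if "z > 0" for z :: real using that by simp
          ultimately show ?thesis unfolding \<eta>_def by blast
        qed
        finally show ?thesis .
      qed
      show "norm (\<integral>s. indicator {..t} s *\<^sub>R (g n s *\<^sub>R \<Phi> t s) \<partial>time T) < e"
        unfolding split using norm_triangle_ineq[of A D] A_le D_le e by linarith
    qed
  qed
qed

section \<open>Finite-rank reduction of Duhamel integrals\<close>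

lemma weakly_converges_diff:
  fixes u :: "nat \<Rightarrow> 'a \<Rightarrow> 'b::{real_inner, second_countable_topology}"
  assumes "weakly_converges M u w"
  shows "weakly_converges M (\<lambda>n x. u n x - w x) (\<lambda>_. 0)"
  unfolding weakly_converges_def
proof (intro conjI allI impI)
  have w: "square_integrable M w" and u: "\<And>n. square_integrable M (u n)"
    and lim: "\<And>\<phi>. square_integrable M \<phi> \<Longrightarrow> (\<lambda>n. \<integral>z. inner (u n z) (\<phi> z) \<partial>M) \<longlonglongrightarrow> (\<integral>z. inner (w z) (\<phi> z) \<partial>M)"
    using assms by (auto simp: weakly_converges_def)
  show "square_integrable M (\<lambda>x. u n x - w x)" for n by (rule square_integrable_vector_diff[OF u w])
  show "square_integrable M (\<lambda>_. 0 :: 'b)" by (simp add: square_integrable_def)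
  fix \<phi> :: "'a \<Rightarrow> 'b" assume \<phi>: "square_integrable M \<phi>"
  have "(\<lambda>n. (\<integral>z. inner (u n z) (\<phi> z) \<partial>M) - (\<integral>z. inner (w z) (\<phi> z) \<partial>M)) \<longlonglongrightarrow>
      (\<integral>z. inner (w z) (\<phi> z) \<partial>M) - (\<integral>z. inner (w z) (\<phi> z) \<partial>M)"
    by (intro tendsto_diff lim[OF \<phi>] tendsto_const)
  then show "(\<lambda>n. \<integral>z. inner (u n z - w z) (\<phi> z) \<partial>M) \<longlonglongrightarrow> (\<integral>z. inner 0 (\<phi> z) \<partial>M)"
    by (simp add: inner_diff_left square_integrable_inner(1)[OF u \<phi>] square_integrable_inner(1)[OF w \<phi>])
qed

text \<open>By the Riesz theorem \<open>l u\<close> is the inner product of \<open>u\<close> with a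
  fixed vector \<open>e\<close>, so \<open>\<psi> s *\<^sub>R e\<close> is an admissible test
  function in the vector-valued L^2 space.\<close>

lemma weakly_converges_functional:
  fixes u :: "nat \<Rightarrow> 'a \<Rightarrow> 'h::{real_inner, banach, second_countable_topology}"
  assumes weak: "weakly_converges M u (\<lambda>_. 0)" and l: "bounded_linear l"
    and \<psi>: "square_integrable M \<psi>"
  shows "(\<lambda>n. \<integral>s. l (u n s) * \<psi> s \<partial>M) \<longlonglongrightarrow> (0::real)"
proof -
  obtain e where e: "\<And>u. l u = inner u e" using riesz_representation[OF l] by blast
  have "square_integrable M (\<lambda>s. \<psi> s *\<^sub>R e)"
    using square_integrableD[OF \<psi>]
    by (auto simp: square_integrable_def power_mult_distrib intro!: borel_measurable_scaleR)
  then have "(\<lambda>n. \<integral>s. inner (u n s) (\<psi> s *\<^sub>R e) \<partial>M) \<longlonglongrightarrow> (\<integral>s. inner 0 (\<psi> s *\<^sub>R e) \<partial>M)"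
    using weak unfolding weakly_converges_def by blast
  then show ?thesis by (simp add: e mult.commute)
qed

lemma square_integrable_functional:
  assumes l: "bounded_linear l" and u: "square_integrable M u"
  shows "square_integrable M (\<lambda>s. l (u s) :: real)"
    and "l2norm M (\<lambda>s. l (u s)) \<le> onorm l * l2norm M u"
proof -
  have m: "(\<lambda>s. l (u s)) \<in> borel_measurable M"
    by (intro borel_measurable_continuous_on[OF linear_continuous_on[OF l]] square_integrableD(1)[OF u])
  have sq: "square_integrable M (\<lambda>s. onorm l *\<^sub>R norm (u s))"
    by (intro square_integrable_scaleR_vector square_integrable_norm u)
  have le: "norm (l (u s)) \<le> onorm l *\<^sub>R norm (u s)" for s
    using onorm[OF l] by simp
  show "square_integrable M (\<lambda>s. l (u s))"
    by (rule square_integrable_bound[OF sq m]) (use le in simp)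
  have "l2norm M (\<lambda>s. l (u s)) \<le> l2norm M (\<lambda>s. onorm l *\<^sub>R norm (u s))"
    by (rule l2norm_mono[OF sq m]) (use le onorm_pos_le[OF l] in \<open>auto simp: abs_mult\<close>)
  also have "\<dots> = onorm l * l2norm M u"
    unfolding l2norm_scaleR using onorm_pos_le[OF l] by (simp add: l2norm_def)
  finally show "l2norm M (\<lambda>s. l (u s)) \<le> onorm l * l2norm M u" .
qed

text \<open>\<open>C0_semigroup\<close> says nothing about negative times. Clamping the time gives a
  family continuous on the whole line, so integrands can be handled for all \<open>s\<close>;
  wherever clamping changes anything, the indicator of \<open>{..t}\<close> is 0.\<close>

lemma C0_semigroup_continuous_max:
  fixes S :: "real \<Rightarrow> 'k::banach \<Rightarrow> 'k"
  assumes S: "C0_semigroup S"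
  shows "continuous_on UNIV (\<lambda>p. S (max 0 (fst p)) (snd p))"
proof -
  have "continuous_on UNIV (\<lambda>p::real \<times> 'k. (max 0 (fst p), snd p))" by (intro continuous_intros)
  from continuous_on_compose2[OF C0_semigroup_continuous[OF S] this] show ?thesis
    by (simp add: image_subset_iff)
qed

lemma semigroup_measurable:
  fixes S :: "real \<Rightarrow> 'k::{banach, second_countable_topology} \<Rightarrow> 'k"
  assumes S: "C0_semigroup S" and y: "y \<in> borel_measurable (time T)"
  shows "(\<lambda>s. S (max 0 (t - s)) (y s)) \<in> borel_measurable (time T)"
proof -
  have "(\<lambda>s. (t - s, y s)) \<in> borel_measurable (time T)"
    by (intro borel_measurable_Pair y measurable_time) simp
  from borel_measurable_continuous_on[OF C0_semigroup_continuous_max[OF S] this] show ?thesis by simp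
qed

lemma bounded_bilinear_measurable:
  fixes B :: "'h::{real_normed_vector, second_countable_topology} \<Rightarrow> 'k::{real_normed_vector, second_countable_topology} \<Rightarrow> 'm::real_normed_vector"
  assumes B: "bounded_bilinear B" and f: "f \<in> borel_measurable M" and g: "g \<in> borel_measurable M"
  shows "(\<lambda>s. B (f s) (g s)) \<in> borel_measurable M"
proof -
  have "continuous_on UNIV (\<lambda>p. B (fst p) (snd p))"
    by (intro bounded_bilinear.continuous_on[OF B] continuous_intros)
  from borel_measurable_continuous_on[OF this borel_measurable_Pair[OF f g]] show ?thesis by simp
qed

text \<open>Substitute for compactness of the operators \<open>\<lambda>u. B u b\<close>, uniformly for \<open>b\<close> in the unit ball.\<close>
definition finite_rank_approximable ::
  "('h::real_normed_vector \<Rightarrow> 'k::real_normed_vector \<Rightarrow> 'm::real_normed_vector) \<Rightarrow> bool" where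
  "finite_rank_approximable B \<longleftrightarrow> (\<forall>\<delta>>0. \<exists>(N::nat) (l :: nat \<Rightarrow> 'h \<Rightarrow> real) (P :: nat \<Rightarrow> 'k \<Rightarrow> 'm).
    (\<forall>j. bounded_linear (l j)) \<and> (\<forall>j. bounded_linear (P j)) \<and>
    (\<forall>u b. norm (B u b - (\<Sum>j<N. l j u *\<^sub>R P j b)) \<le> \<delta> * norm u * norm b))"

text \<open>After finite-rank approximation only the scalar coefficients \<open>l (w n s)\<close> matter.\<close>
lemma duhamel_weak_null_uniform:
  fixes S :: "real \<Rightarrow> 'k::{banach, second_countable_topology} \<Rightarrow> 'k"
    and B :: "'h::{real_inner, banach, second_countable_topology} \<Rightarrow> 'k \<Rightarrow> 'k"
  assumes T: "T > 0" and S: "C0_semigroup S" and B: "bounded_bilinear B"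
    and approx: "finite_rank_approximable B"
    and weak: "weakly_converges (time T) w (\<lambda>_. 0)"
    and X: "continuous_on {0..T} X" and e: "e > 0"
  shows "eventually (\<lambda>n. \<forall>t\<in>{0..T}.
    norm (\<integral>s. indicator {..t} s *\<^sub>R S (max 0 (t - s)) (B (w n s) (X s)) \<partial>time T) < e) sequentially"
proof -
  obtain M where M1: "M \<ge> 1" and M: "\<And>t x. t \<in> {0..T} \<Longrightarrow> norm (S t x) \<le> M * norm x"
    using C0_semigroup_bounded_on[OF S] by metis
  obtain C where C: "\<And>n. l2norm (time T) (w n) \<le> C" using weakly_converges_bounded[OF weak] by blast
  have C0: "C \<ge> 0" using C[of 0] l2norm_nonneg[of "time T" "w 0"] by linarith
  have w: "square_integrable (time T) (w n)" for n using weak by (simp add: weakly_converges_def)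
  have "bounded (X ` {0..T})" by (intro compact_imp_bounded compact_continuous_image X) auto
  then obtain K where K0: "K > 0" and K: "\<And>s. s \<in> {0..T} \<Longrightarrow> norm (X s) \<le> K"
    unfolding bounded_pos by blast
  have wm: "w n \<in> borel_measurable (time T)" for n by (rule square_integrableD(1)[OF w])
  have Xm: "X \<in> borel_measurable (time T)" by (rule continuous_measurable_time[OF X])
  \<comment> \<open>\<open>Q\<close> bounds the integral of
    \<open>M * norm (w n s) * norm (X s)\<close> for every \<open>n\<close>, so the finite-rank
    error contributes at most \<open>\<delta> * Q \<le> e / 2\<close>.\<close>
  define Q where "Q = M * K * (sqrt T * C)"
  have Q0: "Q \<ge> 0" using M1 K0 T C0 by (simp add: Q_def)
  define \<delta> where "\<delta> = e / (2 * (Q + 1))"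
  have \<delta>: "\<delta> > 0" unfolding \<delta>_def using e Q0 by (intro divide_pos_pos) auto
  obtain N and l :: "nat \<Rightarrow> 'h \<Rightarrow> real" and P :: "nat \<Rightarrow> 'k \<Rightarrow> 'k" where
    "(\<forall>j. bounded_linear (l j)) \<and> (\<forall>j. bounded_linear (P j)) \<and>
      (\<forall>u b. norm (B u b - (\<Sum>j<N. l j u *\<^sub>R P j b)) \<le> \<delta> * norm u * norm b)"
    using approx[unfolded finite_rank_approximable_def, rule_format, OF \<delta>] by (elim exE) (rule that)
  then have l: "\<And>j. bounded_linear (l j)" and P: "\<And>j. bounded_linear (P j)"
    and NlP: "\<And>u b. norm (B u b - (\<Sum>j<N. l j u *\<^sub>R P j b)) \<le> \<delta> * norm u * norm b"
    by auto
  have lin: "bounded_linear (S (max 0 r))" for r by (intro C0_semigroupD(1)[OF S]) simp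
  have PX: "continuous_on {0..T} (\<lambda>s. P j (X s))" for j
    by (rule continuous_on_compose2[OF linear_continuous_on[OF P] X]) auto
  \<comment> \<open>The scalar \<open>l j (w n s)\<close> comes out of the linear operator. What
    remains is a kernel that depends on \<open>X\<close> only and is continuous in \<open>t\<close>
    and \<open>s\<close>, as \<open>weak_null_kernel_uniform\<close> requires.\<close>
  define R where "R j n t = (\<integral>s. indicator {..t} s *\<^sub>R (l j (w n s) *\<^sub>R S (max 0 (t - s)) (P j (X s))) \<partial>time T)" for j n t
  \<comment> \<open>With \<open>real N + 1\<close> in the denominator the \<open>N\<close> terms add
    up to strictly less than \<open>e / 2\<close>, also when \<open>N = 0\<close>.\<close>
  have "eventually (\<lambda>n. \<forall>j\<in>{..<N}. \<forall>t\<in>{0..T}. norm (R j n t) < e / (2 * (real N + 1))) sequentially"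
  proof (rule eventually_ball_finite[OF finite_lessThan], rule ballI)
    fix j
    show "eventually (\<lambda>n. \<forall>t\<in>{0..T}. norm (R j n t) < e / (2 * (real N + 1))) sequentially"
      unfolding R_def
    proof (rule weak_null_kernel_uniform[OF T])
      show "square_integrable (time T) (\<lambda>s. l j (w n s))" for n
        by (rule square_integrable_functional[OF l w])
      show "l2norm (time T) (\<lambda>s. l j (w n s)) \<le> onorm (l j) * C" for n
        using square_integrable_functional(2)[OF l[of j] w[of n]] mult_left_mono[OF C[of n] onorm_pos_le[OF l[of j]]]
        by linarith
      show "(\<lambda>n. \<integral>s. l j (w n s) * \<psi> s \<partial>time T) \<longlonglongrightarrow> 0" if "square_integrable (time T) \<psi>" for \<psi>
        by (rule weakly_converges_functional[OF weak l that])
      have "continuous_on ({0..T} \<times> {0..T}) (\<lambda>p. P j (X (snd p)))"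
        by (rule continuous_on_compose2[OF PX continuous_on_snd[OF continuous_on_id]]) auto
      then have "continuous_on ({0..T} \<times> {0..T}) (\<lambda>p. (fst p - snd p, P j (X (snd p))))"
        by (intro continuous_intros)
      from continuous_on_compose2[OF C0_semigroup_continuous_max[OF S] this]
      show "continuous_on ({0..T} \<times> {0..T}) (\<lambda>(t, s). S (max 0 (t - s)) (P j (X s)))"
        by (simp add: case_prod_unfold)
      show "0 < e / (2 * (real N + 1))" using e by simp
    qed
  qed
  then show ?thesis
  proof eventually_elim
    case (elim n)
    show ?case
    proof
      fix t assume t: "t \<in> {0..T}"
      define D where "D s = B (w n s) (X s) - (\<Sum>j<N. l j (w n s) *\<^sub>R P j (X s))" for s
      have Dm: "D \<in> borel_measurable (time T)"
        unfolding D_def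
        by (intro borel_measurable_diff borel_measurable_sum borel_measurable_scaleR
            bounded_bilinear_measurable[OF B] wm Xm continuous_measurable_time[OF PX]
            square_integrableD(1)[OF square_integrable_functional(1)[OF l w]])
      have w_int: "integrable (time T) (\<lambda>s. norm (w n s))"
        using square_integrable_integrable[OF finite_measure_time w] by simp
      have D_le: "norm (indicator {..t} s *\<^sub>R S (max 0 (t - s)) (D s)) \<le> M * \<delta> * K * norm (w n s)"
        if s: "s \<in> {0<..<T}" for s
      proof -
        have "norm (indicator {..t} s *\<^sub>R S (max 0 (t - s)) (D s)) \<le> norm (S (max 0 (t - s)) (D s))"
          by (simp add: indicator_def)
        also have "\<dots> \<le> M * norm (D s)" by (rule M) (use s t in auto)
        also have "\<dots> \<le> M * (\<delta> * norm (w n s) * norm (X s))"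
          unfolding D_def using M1 by (intro mult_left_mono NlP) auto
        also have "\<dots> \<le> M * (\<delta> * norm (w n s) * K)"
          using M1 \<delta> K[of s] s by (intro mult_left_mono) auto
        finally show ?thesis by (simp add: ac_simps)
      qed
      have D_int: "integrable (time T) (\<lambda>s. indicator {..t} s *\<^sub>R S (max 0 (t - s)) (D s))"
      proof (rule Bochner_Integration.integrable_bound)
        show "integrable (time T) (\<lambda>s. M * \<delta> * K * norm (w n s))" using w_int by simp
        show "(\<lambda>s. indicator {..t} s *\<^sub>R S (max 0 (t - s)) (D s)) \<in> borel_measurable (time T)"
          by (intro borel_measurable_scaleR indicator_measurable_time semigroup_measurable[OF S] Dm) simp
        show "AE s in time T. norm (indicator {..t} s *\<^sub>R S (max 0 (t - s)) (D s)) \<le> norm (M * \<delta> * K * norm (w n s))"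
          using D_le M1 \<delta> K0 by (intro AE_I2) simp
      qed
      have R_int: "integrable (time T) (\<lambda>s. indicator {..t} s *\<^sub>R (l j (w n s) *\<^sub>R S (max 0 (t - s)) (P j (X s))))" for j
      proof -
        obtain K' where K': "\<And>s. s \<in> {0..T} \<Longrightarrow> norm (P j (X s)) \<le> K'"
        proof -
          have "bounded ((\<lambda>s. P j (X s)) ` {0..T})" by (intro compact_imp_bounded compact_continuous_image PX) auto
          then show thesis using that unfolding bounded_iff by blast
        qed
        note l_sq = square_integrable_functional(1)[OF l[of j] w[of n]]
        show ?thesis
        proof (rule Bochner_Integration.integrable_bound)
          show "integrable (time T) (\<lambda>s. M * K' * norm (l j (w n s)))"
            using square_integrable_integrable[OF finite_measure_time l_sq] by simp
          show "(\<lambda>s. indicator {..t} s *\<^sub>R (l j (w n s) *\<^sub>R S (max 0 (t - s)) (P j (X s)))) \<in> borel_measurable (time T)"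
            by (intro borel_measurable_scaleR indicator_measurable_time semigroup_measurable[OF S]
                continuous_measurable_time[OF PX] square_integrableD(1)[OF l_sq]) simp
          show "AE s in time T. norm (indicator {..t} s *\<^sub>R (l j (w n s) *\<^sub>R S (max 0 (t - s)) (P j (X s))))
              \<le> norm (M * K' * norm (l j (w n s)))"
          proof (rule AE_I2)
            fix s assume "s \<in> space (time T)"
            then have s: "s \<in> {0..T}" by simp
            have "norm (S (max 0 (t - s)) (P j (X s))) \<le> M * norm (P j (X s))" by (rule M) (use s t in auto)
            also have "\<dots> \<le> M * K'" using K'[OF s] M1 by (intro mult_left_mono) auto
            finally have "norm (S (max 0 (t - s)) (P j (X s))) \<le> \<bar>M * K'\<bar>" by linarith
            then show "norm (indicator {..t} s *\<^sub>R (l j (w n s) *\<^sub>R S (max 0 (t - s)) (P j (X s))))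
              \<le> norm (M * K' * norm (l j (w n s)))"
              by (auto simp: indicator_def abs_mult mult.commute[of "\<bar>l j (w n s)\<bar>"] intro!: mult_right_mono)
          qed
        qed
      qed
      define A where "A = (\<integral>s. indicator {..t} s *\<^sub>R S (max 0 (t - s)) (D s) \<partial>time T)"
      have "(\<integral>s. indicator {..t} s *\<^sub>R S (max 0 (t - s)) (B (w n s) (X s)) \<partial>time T) =
          (\<integral>s. indicator {..t} s *\<^sub>R S (max 0 (t - s)) (D s) +
            (\<Sum>j<N. indicator {..t} s *\<^sub>R (l j (w n s) *\<^sub>R S (max 0 (t - s)) (P j (X s)))) \<partial>time T)"
      proof (intro Bochner_Integration.integral_cong refl)
        fix s
        interpret bounded_linear "S (max 0 (t - s))" by (rule lin)
        show "indicator {..t} s *\<^sub>R S (max 0 (t - s)) (B (w n s) (X s)) =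
          indicator {..t} s *\<^sub>R S (max 0 (t - s)) (D s) +
            (\<Sum>j<N. indicator {..t} s *\<^sub>R (l j (w n s) *\<^sub>R S (max 0 (t - s)) (P j (X s))))"
          by (simp add: D_def diff sum scale scaleR_diff_right scaleR_sum_right)
      qed
      also have "\<dots> = A + (\<Sum>j<N. R j n t)"
        unfolding R_def A_def using R_int
        by (subst Bochner_Integration.integral_add[OF D_int Bochner_Integration.integrable_sum])
          (simp_all only: Bochner_Integration.integral_sum)
      finally have split: "(\<integral>s. indicator {..t} s *\<^sub>R S (max 0 (t - s)) (B (w n s) (X s)) \<partial>time T) =
          A + (\<Sum>j<N. R j n t)" .
      have A_le: "norm A \<le> e / 2"
      proof -
        have "norm A \<le> (\<integral>s. norm (indicator {..t} s *\<^sub>R S (max 0 (t - s)) (D s)) \<partial>time T)"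
          unfolding A_def by (rule integral_norm_bound)
        also have "\<dots> \<le> (\<integral>s. M * \<delta> * K * norm (w n s) \<partial>time T)"
          using w_int D_le by (intro integral_mono integrable_norm[OF D_int]) auto
        also have "\<dots> = M * \<delta> * K * (\<integral>s. norm (w n s) \<partial>time T)" by simp
        also have "\<dots> \<le> M * \<delta> * K * (sqrt T * C)"
        proof (rule mult_left_mono)
          have "(\<integral>s. norm (w n s) \<partial>time T) \<le> sqrt T * l2norm (time T) (w n)"
            by (rule integral_norm_le_l2norm_time[OF T w])
          also have "\<dots> \<le> sqrt T * C" using T C[of n] by (intro mult_left_mono) auto
          finally show "(\<integral>s. norm (w n s) \<partial>time T) \<le> sqrt T * C" .
        qed (use M1 \<delta> K0 in auto)
        also have "\<dots> = \<delta> * Q" by (simp add: Q_def)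
        also have "\<dots> \<le> \<delta> * (Q + 1)" using \<delta> by (intro mult_left_mono) auto
        also have "\<dots> = e / 2"
        proof -
          have "Q + 1 > 0" using Q0 by linarith
          moreover have "e / (2 * z) * z = e / 2" if "z > 0" for z :: real using that by simp
          ultimately show ?thesis unfolding \<delta>_def by blast
        qed
        finally show ?thesis .
      qed
      have "norm (\<Sum>j<N. R j n t) \<le> real N * (e / (2 * (real N + 1)))"
      proof -
        have "norm (\<Sum>j<N. R j n t) \<le> (\<Sum>j<N. e / (2 * (real N + 1)))"
          by (rule sum_norm_le) (use elim t in \<open>blast intro: less_imp_le\<close>)
        then show ?thesis by (simp only: sum_constant card_lessThan)
      qed
      moreover have "e / 2 + real N * (e / (2 * (real N + 1))) < e"
        using e by (simp add: field_simps)
      ultimately show "norm (\<integral>s. indicator {..t} s *\<^sub>R S (max 0 (t - s)) (B (w n s) (X s)) \<partial>time T) < e"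
        unfolding split using norm_triangle_ineq[of A "\<Sum>j<N. R j n t"] A_le by linarith
    qed
  qed
qed

section \<open>A Gronwall inequality and the stability of mild solutions\<close>

text \<open>In the weighted norm
  \<open>sup exp (- \<mu> * t) * y t\<close> with \<open>\<mu>\<close> large, the integral term is a contraction by Cauchy--Schwarz.\<close>
lemma gronwall_square_integrable:
  fixes y k :: "real \<Rightarrow> real"
  assumes T: "T > 0" and y: "continuous_on {0..T} y" and y0: "\<And>t. t \<in> {0..T} \<Longrightarrow> 0 \<le> y t"
    and k: "square_integrable (time T) k" and k0: "\<And>s. 0 \<le> k s" and C: "l2norm (time T) k \<le> C"
    and \<mu>: "\<mu> > 0" "2 * C\<^sup>2 \<le> \<mu>"
    and le: "\<And>t. t \<in> {0..T} \<Longrightarrow> y t \<le> a + (\<integral>s. indicator {..t} s * (k s * y s) \<partial>time T)"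
    and t: "t \<in> {0..T}" and a: "a \<ge> 0"
  shows "y t \<le> 2 * a * exp (\<mu> * T)"
proof -
  define z where "z t = exp (- (\<mu> * t)) * y t" for t
  have C0: "C \<ge> 0" using C l2norm_nonneg[of "time T" k] by linarith
  have z_cont: "continuous_on {0..T} z" unfolding z_def by (intro continuous_intros y)
  \<comment> \<open>At a maximiser of the weighted function the integral inequality becomes an
    inequality for the single number \<open>z r\<close>.\<close>
  obtain r where r: "r \<in> {0..T}" "\<And>s. s \<in> {0..T} \<Longrightarrow> z s \<le> z r"
    using continuous_attains_sup[OF compact_Icc _ z_cont] T by auto
  \<comment> \<open>The weight left over when \<open>y s\<close> is expressed through
    \<open>z s\<close>. Its L^2 norm is at most \<open>sqrt (1 / (2 * \<mu>))\<close>, so it is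
    small for large \<open>\<mu>\<close>.\<close>
  define h where "h s = indicator {..r} s * exp (- (\<mu> * (r - s)))" for s
  have h_le: "\<bar>h s\<bar> \<le> 1" for s
  proof -
    have "0 \<le> \<mu> * (r - s)" if "s \<le> r" using that \<mu> by simp
    then show ?thesis by (simp add: h_def indicator_def)
  qed
  have hm: "h \<in> borel_measurable (time T)" unfolding h_def by (intro measurable_time) measurable
  have h_sq: "square_integrable (time T) h"
    by (rule square_integrable_bound[OF square_integrable_const[OF finite_measure_time, of T 1] hm])
      (use h_le in simp)
  have h_norm: "l2norm (time T) h \<le> sqrt (1 / (2 * \<mu>))"
    unfolding l2norm_def
  proof (rule real_sqrt_le_mono)
    define E where "E s = exp (- (2 * \<mu> * (r - s))) / (2 * \<mu>)" for s
    have E': "(E has_vector_derivative exp (- (2 * \<mu> * (r - s)))) (at s within A)" for s A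
      unfolding E_def has_real_derivative_iff_has_vector_derivative[symmetric]
      using \<mu> by (auto intro!: derivative_eq_intros)
    have cont: "continuous_on {0..r} (\<lambda>s. exp (- (2 * \<mu> * (r - s))))" by (intro continuous_intros)
    have "(\<integral>s. (norm (h s))\<^sup>2 \<partial>time T) = (\<integral>s. indicator {..r} s *\<^sub>R exp (- (2 * \<mu> * (r - s))) \<partial>time T)"
    proof (intro Bochner_Integration.integral_cong refl)
      fix s
      have "(exp (- (\<mu> * (r - s))))\<^sup>2 = exp (- (2 * \<mu> * (r - s)))"
        by (simp add: power2_eq_square exp_add[symmetric] algebra_simps)
      then show "(norm (h s))\<^sup>2 = indicator {..r} s *\<^sub>R exp (- (2 * \<mu> * (r - s)))"
        by (simp add: h_def indicator_def)
    qed
    also have "\<dots> = (LINT s:{0..r}|lborel. exp (- (2 * \<mu> * (r - s))))"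
      using r by (intro integral_time_eq(2)[symmetric] borel_integrable_atLeastAtMost' cont) auto
    also have "\<dots> = integral {0..r} (\<lambda>s. exp (- (2 * \<mu> * (r - s))))"
      by (intro set_borel_integral_eq_integral borel_integrable_atLeastAtMost' cont)
    also have "\<dots> = E r - E 0"
      using r by (intro integral_unique fundamental_theorem_of_calculus E') auto
    also have "\<dots> \<le> 1 / (2 * \<mu>)" using \<mu> by (simp add: E_def)
    finally show "(\<integral>s. (norm (h s))\<^sup>2 \<partial>time T) \<le> 1 / (2 * \<mu>)" .
  qed
  \<comment> \<open>The size of \<open>\<mu>\<close> enters here:
    \<open>2 * C\<^sup>2 \<le> \<mu>\<close> gives
    \<open>C\<^sup>2 / (2 * \<mu>) \<le> 1 / 4\<close>.\<close>
  have kh: "(\<integral>s. \<bar>k s * h s\<bar> \<partial>time T) \<le> 1 / 2"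
  proof -
    have "(\<integral>s. \<bar>k s * h s\<bar> \<partial>time T) \<le> l2norm (time T) k * l2norm (time T) h"
      by (rule integral_mult_le_l2norm[OF k h_sq])
    also have "\<dots> \<le> C * sqrt (1 / (2 * \<mu>))" by (intro mult_mono C h_norm C0) auto
    also have "\<dots> = sqrt (C\<^sup>2 / (2 * \<mu>))" using C0 by (simp add: real_sqrt_divide real_sqrt_mult)
    also have "\<dots> \<le> sqrt ((1 / 2)\<^sup>2)"
      using \<mu> by (intro real_sqrt_le_mono) (simp add: field_simps power2_eq_square)
    finally show ?thesis by simp
  qed
  have zr0: "0 \<le> z r" using y0[OF r(1)] by (simp add: z_def)
  have kh_int: "integrable (time T) (\<lambda>s. \<bar>k s * h s\<bar>)" using square_integrable_mult[OF k h_sq] by simp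
  have "z r \<le> exp (- (\<mu> * r)) * (a + (\<integral>s. indicator {..r} s * (k s * y s) \<partial>time T))"
    unfolding z_def by (intro mult_left_mono le r) simp
  also have "\<dots> = exp (- (\<mu> * r)) * a + (\<integral>s. exp (- (\<mu> * r)) * (indicator {..r} s * (k s * y s)) \<partial>time T)"
    by (simp add: distrib_left)
  also have "exp (- (\<mu> * r)) * a \<le> a"
    using r \<mu> a by (intro mult_left_le_one_le) auto
  also have "(\<integral>s. exp (- (\<mu> * r)) * (indicator {..r} s * (k s * y s)) \<partial>time T) \<le> (\<integral>s. z r * \<bar>k s * h s\<bar> \<partial>time T)"
  proof (rule integral_mono_AE')
    show "integrable (time T) (\<lambda>s. z r * \<bar>k s * h s\<bar>)" using kh_int by simp
    show "AE s in time T. exp (- (\<mu> * r)) * (indicator {..r} s * (k s * y s)) \<le> z r * \<bar>k s * h s\<bar>"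
    proof (rule AE_I2)
      fix s assume "s \<in> space (time T)"
      then have s: "s \<in> {0..T}" by simp
      have "exp (- (\<mu> * r)) * y s = exp (- (\<mu> * (r - s))) * z s"
        by (simp add: z_def exp_add[symmetric] algebra_simps flip: mult.assoc)
      then have "exp (- (\<mu> * r)) * (indicator {..r} s * (k s * y s)) = (k s * h s) * z s"
        by (simp add: h_def ac_simps)
      also have "\<dots> \<le> (k s * h s) * z r"
        using r(2)[OF s] k0[of s] by (intro mult_left_mono) (auto simp: h_def)
      also have "\<dots> = z r * \<bar>k s * h s\<bar>" using k0[of s] by (simp add: h_def abs_mult)
      finally show "exp (- (\<mu> * r)) * (indicator {..r} s * (k s * y s)) \<le> z r * \<bar>k s * h s\<bar>" .
    qed
    show "AE s in time T. 0 \<le> z r * \<bar>k s * h s\<bar>" using zr0 by simp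
  qed
  also have "\<dots> = z r * (\<integral>s. \<bar>k s * h s\<bar> \<partial>time T)" by simp
  also have "\<dots> \<le> z r * (1 / 2)" using kh zr0 by (intro mult_left_mono)
  \<comment> \<open>The chain reads \<open>z r \<le> a + z r / 2\<close>; absorbing the last term
    doubles \<open>a\<close>.\<close>
  finally have "z r \<le> 2 * a" by simp
  then have zt: "z t \<le> 2 * a" using r(2)[OF t] by linarith
  have "y t = exp (\<mu> * t) * z t" by (simp add: z_def exp_minus field_simps)
  also have "\<dots> \<le> exp (\<mu> * T) * (2 * a)"
    using zt t \<mu> a y0[OF t] by (intro mult_mono) (auto simp: z_def)
  finally show ?thesis by (simp add: mult.commute)
qed

text \<open>Stated for any semigroup and coupling, since only two properties matter: boundedness of
  \<open>B\<close> provides the Gronwall kernel \<open>k n\<close>, and finite-rank approximability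
  makes the remainder \<open>R n\<close> vanish uniformly.\<close>

theorem mild_solution_weak_to_strong:
  fixes S :: "real \<Rightarrow> 'k::{banach, second_countable_topology} \<Rightarrow> 'k"
    and B :: "'h::{real_inner, banach, second_countable_topology} \<Rightarrow> 'k \<Rightarrow> 'k"
  assumes T: "T > 0" and S: "C0_semigroup S" and B: "bounded_bilinear B"
    and approx: "finite_rank_approximable B"
    and weak: "weakly_converges (time T) v_n v" and X0: "X0_n \<longlonglongrightarrow> X0"
    and X: "continuous_on {0..T} X" and X_n: "\<And>n. continuous_on {0..T} (X_n n)"
    and int: "\<And>t. t \<in> {0..T} \<Longrightarrow> set_integrable lborel {0..t} (\<lambda>s. S (t - s) (B (v s) (X s)))"
    and eq: "\<And>t. t \<in> {0..T} \<Longrightarrow> X t = S t X0 + (LINT s:{0..t}|lborel. S (t - s) (B (v s) (X s)))"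
    and int_n: "\<And>n t. t \<in> {0..T} \<Longrightarrow> set_integrable lborel {0..t} (\<lambda>s. S (t - s) (B (v_n n s) (X_n n s)))"
    and eq_n: "\<And>n t. t \<in> {0..T} \<Longrightarrow>
      X_n n t = S t (X0_n n) + (LINT s:{0..t}|lborel. S (t - s) (B (v_n n s) (X_n n s)))"
  shows "uniform_limit {0..T} X_n X sequentially"
proof -
  obtain M where M1: "M \<ge> 1" and M: "\<And>t x. t \<in> {0..T} \<Longrightarrow> norm (S t x) \<le> M * norm x"
    using C0_semigroup_bounded_on[OF S] by metis
  obtain K where K0: "K > 0" and K: "\<And>u x. norm (B u x) \<le> norm u * norm x * K"
    using bounded_bilinear.pos_bounded[OF B] by blast
  obtain C where C: "\<And>n. l2norm (time T) (v_n n) \<le> C" using weakly_converges_bounded[OF weak] by blast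
  have v_n: "square_integrable (time T) (v_n n)" for n using weak by (simp add: weakly_converges_def)
  define k where "k n s = (M * K) * norm (v_n n s)" for n s
  have k_sq: "square_integrable (time T) (k n)" for n
    unfolding k_def by (intro square_integrable_scaleR square_integrable_norm v_n)
  have k_norm: "l2norm (time T) (k n) \<le> M * K * C" for n
  proof -
    have "l2norm (time T) (k n) = M * K * l2norm (time T) (v_n n)"
      using l2norm_scaleR[of "time T" "M * K" "\<lambda>s. norm (v_n n s)"] M1 K0
      by (simp add: k_def[abs_def] l2norm_def[of _ "\<lambda>s. norm (v_n n s)"] l2norm_def[of _ "v_n n"])
    then show ?thesis using C[of n] M1 K0 by simp
  qed
  \<comment> \<open>The rate depends only on the common bound for the L^2 norms of the kernels,
    hence not on \<open>n\<close>; the added 1 makes it positive.\<close>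
  define \<mu> where "\<mu> = 2 * (M * K * C)\<^sup>2 + 1"
  have \<mu>: "\<mu> > 0" "2 * (M * K * C)\<^sup>2 \<le> \<mu>"
    using zero_le_power2[of "M * K * C"] by (auto simp: \<mu>_def intro: add_nonneg_pos)
  have conv: "integrable (time T) (\<lambda>s. indicator {..t} s *\<^sub>R S (max 0 (t - s)) (f s))"
      "(LINT s:{0..t}|lborel. S (t - s) (f s)) = (\<integral>s. indicator {..t} s *\<^sub>R S (max 0 (t - s)) (f s) \<partial>time T)"
    if "t \<in> {0..T}" "set_integrable lborel {0..t} (\<lambda>s. S (t - s) (f s))" for t f
  proof -
    have "(\<lambda>s. indicator {..t} s *\<^sub>R S (t - s) (f s)) = (\<lambda>s. indicator {..t} s *\<^sub>R S (max 0 (t - s)) (f s))"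
      by (auto simp: fun_eq_iff indicator_def max_def)
    then show "integrable (time T) (\<lambda>s. indicator {..t} s *\<^sub>R S (max 0 (t - s)) (f s))"
      "(LINT s:{0..t}|lborel. S (t - s) (f s)) = (\<integral>s. indicator {..t} s *\<^sub>R S (max 0 (t - s)) (f s) \<partial>time T)"
      using integral_time_eq[of t T "\<lambda>s. S (t - s) (f s)"] that by auto
  qed
  have lin: "bounded_linear (S (max 0 r))" for r by (intro C0_semigroupD(1)[OF S]) simp
  define R where "R n t = (\<integral>s. indicator {..t} s *\<^sub>R S (max 0 (t - s)) (B (v_n n s - v s) (X s)) \<partial>time T)" for n t
  show ?thesis
  proof (rule uniform_limitI)
    fix e :: real assume e: "e > 0"
    \<comment> \<open>Gronwall will return \<open>2 * a * exp (\<mu> * T) = e / 2\<close>. The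
      budget \<open>a\<close> is shared equally by the initial data and the remainder.\<close>
    define a where "a = e / (4 * exp (\<mu> * T))"
    have a: "a > 0" using e by (simp add: a_def)
    have "eventually (\<lambda>n. \<forall>t\<in>{0..T}. norm (R n t) < a / 2) sequentially"
      unfolding R_def using a
      by (intro duhamel_weak_null_uniform[OF T S B approx weakly_converges_diff[OF weak] X]) simp
    moreover have "eventually (\<lambda>n. dist (X0_n n) X0 < a / (2 * M)) sequentially"
      using X0 a M1 by (intro tendstoD) auto
    ultimately show "eventually (\<lambda>n. \<forall>t\<in>{0..T}. dist (X_n n t) (X t) < e) sequentially"
    proof eventually_elim
      case (elim n)
      define Y where "Y t = X_n n t - X t" for t
      have Y_cont: "continuous_on {0..T} Y" unfolding Y_def by (intro continuous_intros X X_n)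
      have Y_le: "norm (Y t) \<le> a + (\<integral>s. indicator {..t} s * (k n s * norm (Y s)) \<partial>time T)" if t: "t \<in> {0..T}" for t
      proof -
        interpret St: bounded_linear "S t" using t by (intro C0_semigroupD(1)[OF S]) simp
        have BY_le: "norm (indicator {..t} s *\<^sub>R S (max 0 (t - s)) (B (v_n n s) (Y s)))
            \<le> indicator {..t} s * (k n s * norm (Y s))" if s: "s \<in> {0<..<T}" for s
        proof -
          have "norm (S (max 0 (t - s)) (B (v_n n s) (Y s))) \<le> M * norm (B (v_n n s) (Y s))"
            by (rule M) (use s t in auto)
          also have "\<dots> \<le> M * (norm (v_n n s) * norm (Y s) * K)" using M1 by (intro mult_left_mono K) auto
          finally show ?thesis by (cases "s \<le> t") (simp_all add: k_def ac_simps max_def)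
        qed
        have kY_int: "integrable (time T) (\<lambda>s. indicator {..t} s * (k n s * norm (Y s)))"
        proof -
          have "bounded (Y ` {0..T})" by (intro compact_imp_bounded compact_continuous_image Y_cont) auto
          then obtain L where L: "\<And>s. s \<in> {0..T} \<Longrightarrow> norm (Y s) \<le> L" unfolding bounded_iff by blast
          have Ysq: "square_integrable (time T) (\<lambda>s. norm (Y s))"
            by (rule square_integrable_norm, rule square_integrable_bound[OF square_integrable_const[OF finite_measure_time, of T L]
                  continuous_measurable_time[OF Y_cont]])
              (use L in \<open>auto intro!: AE_I2\<close>)
          have "square_integrable (time T) (\<lambda>s. indicator {..t} s * k n s)"
            by (intro square_integrable_indicator_times k_sq indicator_measurable_time) simp
          from square_integrable_mult[OF this Ysq] show ?thesis by (simp add: mult.assoc)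
        qed
        have BY_int: "integrable (time T) (\<lambda>s. indicator {..t} s *\<^sub>R S (max 0 (t - s)) (B (v_n n s) (Y s)))"
        proof (rule Bochner_Integration.integrable_bound[OF kY_int])
          show "(\<lambda>s. indicator {..t} s *\<^sub>R S (max 0 (t - s)) (B (v_n n s) (Y s))) \<in> borel_measurable (time T)"
            by (intro borel_measurable_scaleR indicator_measurable_time semigroup_measurable[OF S]
                bounded_bilinear_measurable[OF B] continuous_measurable_time[OF Y_cont]
                square_integrableD(1)[OF v_n]) simp
          show "AE s in time T. norm (indicator {..t} s *\<^sub>R S (max 0 (t - s)) (B (v_n n s) (Y s)))
              \<le> norm (indicator {..t} s * (k n s * norm (Y s)))"
            unfolding real_norm_def by (rule AE_I2, rule order_trans[OF BY_le abs_ge_self]) simp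
        qed
        \<comment> \<open>The remainder's integrand is expressed through those of the two solutions
          and of \<open>Y\<close>, each known to be integrable, so its integral splits
          accordingly.\<close>
        have split: "indicator {..t} s *\<^sub>R S (max 0 (t - s)) (B (v_n n s - v s) (X s)) =
            indicator {..t} s *\<^sub>R S (max 0 (t - s)) (B (v_n n s) (X_n n s)) -
            indicator {..t} s *\<^sub>R S (max 0 (t - s)) (B (v s) (X s)) -
            indicator {..t} s *\<^sub>R S (max 0 (t - s)) (B (v_n n s) (Y s))" for s
        proof -
          interpret bounded_linear "S (max 0 (t - s))" by (rule lin)
          show ?thesis
            by (simp add: Y_def bounded_bilinear.diff_left[OF B] bounded_bilinear.diff_right[OF B] diff
                scaleR_diff_right)
        qed
        define I where "I = (\<integral>s. indicator {..t} s *\<^sub>R S (max 0 (t - s)) (B (v_n n s) (Y s)) \<partial>time T)"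
        have "R n t = (\<integral>s. indicator {..t} s *\<^sub>R S (max 0 (t - s)) (B (v_n n s) (X_n n s)) \<partial>time T) -
            (\<integral>s. indicator {..t} s *\<^sub>R S (max 0 (t - s)) (B (v s) (X s)) \<partial>time T) -
            (\<integral>s. indicator {..t} s *\<^sub>R S (max 0 (t - s)) (B (v_n n s) (Y s)) \<partial>time T)"
          unfolding R_def split
          using conv(1)[OF t int_n[OF t, of n]] conv(1)[OF t int[OF t]] BY_int by simp
        then have split': "Y t = S t (X0_n n - X0) + R n t + I"
          unfolding I_def
          using eq[OF t] eq_n[OF t, of n] conv(2)[OF t int_n[OF t, of n]] conv(2)[OF t int[OF t]]
          by (simp add: Y_def[of t] St.diff algebra_simps)
        have "norm (S t (X0_n n - X0)) \<le> a / 2"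
        proof -
          have "norm (S t (X0_n n - X0)) \<le> M * norm (X0_n n - X0)" by (rule M[OF t])
          also have "\<dots> \<le> M * (a / (2 * M))"
            using elim(2) M1 by (intro mult_left_mono) (auto simp: dist_norm)
          finally show ?thesis using M1 by simp
        qed
        moreover have "norm (R n t) \<le> a / 2" using elim(1) t by (simp add: less_imp_le)
        moreover have "norm I \<le> (\<integral>s. indicator {..t} s * (k n s * norm (Y s)) \<partial>time T)"
          unfolding I_def using BY_le
          by (intro order_trans[OF integral_norm_bound] integral_mono integrable_norm[OF BY_int] kY_int) auto
        ultimately show ?thesis
          unfolding split' using norm_triangle_ineq[of "S t (X0_n n - X0) + R n t" I]
            norm_triangle_ineq[of "S t (X0_n n - X0)" "R n t"] by linarith
      qed
      show ?case
      proof
        fix t assume t: "t \<in> {0..T}"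
        have "norm (Y t) \<le> 2 * a * exp (\<mu> * T)"
        proof (rule gronwall_square_integrable[OF T _ _ k_sq _ k_norm \<mu> Y_le t])
          show "continuous_on {0..T} (\<lambda>s. norm (Y s))" by (intro continuous_intros Y_cont)
          show "0 \<le> k n s" for s using M1 K0 by (simp add: k_def)
        qed (use a in auto)
        also have "\<dots> < e" using e by (simp add: a_def)
        finally show "dist (X_n n t) (X t) < e" by (simp add: Y_def dist_norm)
      qed
    qed
  qed
qed

section \<open>The Maxwell coupling and energy solutions\<close>

lemma finite_rank_approximable_H1T_mult: "finite_rank_approximable H1T_mult"
  unfolding finite_rank_approximable_def using H1T_mult_finite_rank_approximation by blast

text \<open>\<open>coupling\<close> with its coefficient typed in H^1, so that it can play the role
  of the bounded bilinear map \<open>B\<close>.\<close>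

definition maxwell_coupling :: "real \<Rightarrow> real \<Rightarrow> H1T \<Rightarrow> L2T \<times> L2T \<Rightarrow> L2T \<times> L2T" where
  "maxwell_coupling \<epsilon> \<sigma> u X = coupling \<epsilon> \<sigma> (H1T_to_L2T u) X"

lemma maxwell_coupling_eq: "maxwell_coupling \<epsilon> \<sigma> u X = (- (\<sigma> / \<epsilon>) *\<^sub>R H1T_mult u (snd X), 0)"
  by (simp add: maxwell_coupling_def coupling_def H1T_mult_def)

lemma bounded_bilinear_maxwell_coupling: "bounded_bilinear (maxwell_coupling \<epsilon> \<sigma>)"
proof -
  interpret bounded_bilinear H1T_mult by (rule bounded_bilinear_H1T_mult)
  obtain K where K: "K > 0" "\<And>u b. norm (H1T_mult u b) \<le> norm u * norm b * K" using pos_bounded by blast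
  show ?thesis
  proof
    show "\<exists>K. \<forall>u X. norm (maxwell_coupling \<epsilon> \<sigma> u X) \<le> norm u * norm X * K"
    proof (intro exI[of _ "\<bar>\<sigma> / \<epsilon>\<bar> * K"] allI)
      fix u and X :: "L2T \<times> L2T"
      have "norm (H1T_mult u (snd X)) \<le> norm u * norm (snd X) * K" by (rule K)
      also have "\<dots> \<le> norm u * norm X * K"
        using K(1) norm_snd_le[of "snd X" "fst X"] by (intro mult_right_mono mult_left_mono) auto
      finally have "\<bar>\<sigma> / \<epsilon>\<bar> * norm (H1T_mult u (snd X)) \<le> \<bar>\<sigma> / \<epsilon>\<bar> * (norm u * norm X * K)"
        by (rule mult_left_mono) simp
      then show "norm (maxwell_coupling \<epsilon> \<sigma> u X) \<le> norm u * norm X * (\<bar>\<sigma> / \<epsilon>\<bar> * K)"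
        by (simp add: maxwell_coupling_eq norm_Pair ac_simps)
    qed
  qed (simp_all add: maxwell_coupling_eq add_left add_right scaleR_left scaleR_right scaleR_add_right ac_simps)
qed

lemma finite_rank_approximable_maxwell_coupling: "finite_rank_approximable (maxwell_coupling \<epsilon> \<sigma>)"
  unfolding finite_rank_approximable_def
proof (intro allI impI)
  fix \<delta> :: real assume \<delta>: "\<delta> > 0"
  \<comment> \<open>Dominates the factor \<open>\<bar>\<sigma> / \<epsilon>\<bar>\<close> and is
    positive by construction, so \<open>\<delta> / c\<close> is an admissible accuracy.\<close>
  define c where "c = \<bar>\<sigma> / \<epsilon>\<bar> + 1"
  have c: "c > 0" by (simp add: c_def add_nonneg_pos)
  have \<delta>c: "\<delta> / c > 0" using \<delta> c by simp
  obtain N and l :: "nat \<Rightarrow> H1T \<Rightarrow> real" and P :: "nat \<Rightarrow> L2T \<Rightarrow> L2T" where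
    "(\<forall>j. bounded_linear (l j)) \<and> (\<forall>j. bounded_linear (P j)) \<and>
      (\<forall>u b. norm (H1T_mult u b - (\<Sum>j<N. l j u *\<^sub>R P j b)) \<le> \<delta> / c * norm u * norm b)"
    using H1T_mult_finite_rank_approximation[OF \<delta>c] by (elim exE) (rule that)
  then have l: "\<And>j. bounded_linear (l j)" and P: "\<And>j. bounded_linear (P j)"
    and NlP: "\<And>u b. norm (H1T_mult u b - (\<Sum>j<N. l j u *\<^sub>R P j b)) \<le> \<delta> / c * norm u * norm b"
    by auto
  define P' where "P' j X = (- (\<sigma> / \<epsilon>) *\<^sub>R P j (snd X), 0 :: L2T)" for j and X :: "L2T \<times> L2T"
  have P': "bounded_linear (P' j)" for j
    unfolding P'_def
    by (intro bounded_linear_Pair bounded_linear_zero bounded_linear_compose[OF bounded_linear_scaleR_right]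
        bounded_linear_compose[OF P bounded_linear_snd])
  have "norm (maxwell_coupling \<epsilon> \<sigma> u X - (\<Sum>j<N. l j u *\<^sub>R P' j X)) \<le> \<delta> * norm u * norm X" for u X
  proof -
    have "(\<Sum>j<N. l j u *\<^sub>R P' j X) = (- (\<sigma> / \<epsilon>) *\<^sub>R (\<Sum>j<N. l j u *\<^sub>R P j (snd X)), 0)"
      by (induction N) (simp_all add: P'_def zero_prod_def scaleR_add_right scaleR_left_commute algebra_simps)
    then have "maxwell_coupling \<epsilon> \<sigma> u X - (\<Sum>j<N. l j u *\<^sub>R P' j X) =
        (- (\<sigma> / \<epsilon>) *\<^sub>R (H1T_mult u (snd X) - (\<Sum>j<N. l j u *\<^sub>R P j (snd X))), 0)"
      by (simp only: maxwell_coupling_eq diff_Pair scaleR_diff_right diff_zero)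
    then have "norm (maxwell_coupling \<epsilon> \<sigma> u X - (\<Sum>j<N. l j u *\<^sub>R P' j X)) =
        \<bar>\<sigma> / \<epsilon>\<bar> * norm (H1T_mult u (snd X) - (\<Sum>j<N. l j u *\<^sub>R P j (snd X)))"
      by (simp only: norm_Pair norm_scaleR norm_zero) simp
    also have "\<dots> \<le> c * (\<delta> / c * norm u * norm (snd X))"
      by (intro mult_mono NlP) (use c in \<open>auto simp: c_def\<close>)
    also have "\<dots> = \<delta> * norm u * norm (snd X)" using c by simp
    also have "\<dots> \<le> \<delta> * norm u * norm X"
      using \<delta> norm_snd_le[of "snd X" "fst X"] by (intro mult_left_mono) auto
    finally show ?thesis .
  qed
  with l P' show "\<exists>(N::nat) (l :: nat \<Rightarrow> H1T \<Rightarrow> real) P. (\<forall>j. bounded_linear (l j)) \<and> (\<forall>j. bounded_linear (P j)) \<and>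
      (\<forall>u X. norm (maxwell_coupling \<epsilon> \<sigma> u X - (\<Sum>j<N. l j u *\<^sub>R P j X)) \<le> \<delta> * norm u * norm X)"
    by (intro exI[of _ N] exI[of _ l] exI[of _ P']) simp
qed

text \<open>The semigroup of an energy solution is existentially quantified. Semigroups with the
  same generator agree at nonnegative times, and only the times \<open>t\<close> and
  \<open>t - s\<close> with \<open>s\<close> in \<open>{0..t}\<close> occur, so all solutions can be
  written with one \<open>S\<close>.\<close>

lemma energy_solution_semigroup:
  assumes sol: "energy_solution \<epsilon> \<sigma> T v X0 X"
    and S: "C0_semigroup S" and gen: "generator S = maxwell_op \<epsilon> \<sigma>" and t: "t \<in> {0..T}"
  shows "set_integrable lborel {0..t} (\<lambda>s. S (t - s) (maxwell_coupling \<epsilon> \<sigma> (v s) (X s)))"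
    and "X t = S t X0 + (LINT s:{0..t}|lborel. S (t - s) (maxwell_coupling \<epsilon> \<sigma> (v s) (X s)))"
proof -
  obtain R where R: "C0_semigroup R" "generator R = maxwell_op \<epsilon> \<sigma>"
    and int: "set_integrable lborel {0..t} (\<lambda>s. R (t - s) (coupling \<epsilon> \<sigma> (H1T_to_L2T (v s)) (X s)))"
    and eq: "X t = R t X0 + (LINT s:{0..t}|lborel. R (t - s) (coupling \<epsilon> \<sigma> (H1T_to_L2T (v s)) (X s)))"
    using sol t unfolding energy_solution_def by auto
  have SR: "R r = S r" if "r \<ge> 0" for r
    by (rule C0_semigroup_unique[OF R(1) S _ that]) (simp add: R gen)
  show "set_integrable lborel {0..t} (\<lambda>s. S (t - s) (maxwell_coupling \<epsilon> \<sigma> (v s) (X s)))"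
    using int by (subst set_integrable_cong[OF refl, symmetric]) (auto simp: SR maxwell_coupling_def)
  have "(LINT s:{0..t}|lborel. R (t - s) (coupling \<epsilon> \<sigma> (H1T_to_L2T (v s)) (X s))) =
      (LINT s:{0..t}|lborel. S (t - s) (maxwell_coupling \<epsilon> \<sigma> (v s) (X s)))"
    by (rule set_lebesgue_integral_cong) (auto simp: SR maxwell_coupling_def)
  then show "X t = S t X0 + (LINT s:{0..t}|lborel. S (t - s) (maxwell_coupling \<epsilon> \<sigma> (v s) (X s)))"
    using eq SR t by simp
qed

theorem energy_solution_weak_to_strong:
  assumes T: "T > 0" and weak: "weakly_converges (time T) v_n v" and X0: "X0_n \<longlonglongrightarrow> X0"
    and sol_n: "\<And>n. energy_solution \<epsilon> \<sigma> T (v_n n) (X0_n n) (X_n n)"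
    and sol: "energy_solution \<epsilon> \<sigma> T v X0 X"
  shows "uniform_limit {0..T} X_n X sequentially"
proof -
  obtain S where S: "C0_semigroup S" "generator S = maxwell_op \<epsilon> \<sigma>"
    using sol unfolding energy_solution_def by blast
  show ?thesis
  proof (rule mild_solution_weak_to_strong[OF T S(1) bounded_bilinear_maxwell_coupling
        finite_rank_approximable_maxwell_coupling weak X0])
    show "continuous_on {0..T} X" "continuous_on {0..T} (X_n n)" for n
      using sol sol_n[of n] by (auto simp: energy_solution_def)
  qed (rule energy_solution_semigroup[OF sol S] energy_solution_semigroup[OF sol_n S]; assumption)+
qed

section \<open>Weak limits of products in time\<close>

lemma square_integrable_bounded_time:
  fixes f :: "real \<Rightarrow> 'b::{banach, second_countable_topology}"
  assumes T: "T > 0" and f: "f \<in> borel_measurable (time T)" and C: "\<And>s. s \<in> {0<..<T} \<Longrightarrow> norm (f s) \<le> C"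
  shows "square_integrable (time T) f" "l2norm (time T) f \<le> sqrt T * C"
proof -
  have "0 \<le> norm (f (T / 2))" by simp
  also have "\<dots> \<le> C" using T by (intro C) auto
  finally have C0: "C \<ge> 0" .
  have const: "square_integrable (time T) (\<lambda>_. C)" by (rule square_integrable_const[OF finite_measure_time])
  show "square_integrable (time T) f"
    by (rule square_integrable_bound[OF const f]) (use C in \<open>auto intro!: AE_I2\<close>)
  have "l2norm (time T) f \<le> l2norm (time T) (\<lambda>_. C)"
    by (rule l2norm_mono[OF const f]) (use C C0 in \<open>auto intro!: AE_I2\<close>)
  also have "\<dots> = sqrt T * C"
  proof -
    have "measure (time T) {0<..<T} = T" using T by (subst measure_time_subset) auto
    then show ?thesis using C0 by (simp add: l2norm_def real_sqrt_mult)
  qed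
  finally show "l2norm (time T) f \<le> sqrt T * C" .
qed

lemma continuous_square_integrable_time:
  fixes f :: "real \<Rightarrow> 'b::{banach, second_countable_topology}"
  assumes T: "T > 0" and f: "continuous_on {0..T} f"
  shows "square_integrable (time T) f"
proof -
  have "bounded (f ` {0..T})" by (intro compact_imp_bounded compact_continuous_image f) auto
  then obtain C where "\<And>s. s \<in> {0..T} \<Longrightarrow> norm (f s) \<le> C" unfolding bounded_iff by blast
  then show ?thesis by (intro square_integrable_bounded_time(1)[OF T continuous_measurable_time[OF f], of C]) auto
qed

lemma uniform_limit_imp_l2norm:
  fixes f :: "nat \<Rightarrow> real \<Rightarrow> 'b::{banach, second_countable_topology}"
  assumes T: "T > 0" and lim: "uniform_limit {0..T} f g sequentially"
    and f: "\<And>n. continuous_on {0..T} (f n)" and g: "continuous_on {0..T} g"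
  shows "(\<lambda>n. l2norm (time T) (\<lambda>s. f n s - g s)) \<longlonglongrightarrow> 0"
proof (rule tendstoI)
  fix e :: real assume e: "e > 0"
  define d where "d = e / (2 * sqrt T)"
  have d: "d > 0" using e T by (simp add: d_def)
  have "eventually (\<lambda>n. \<forall>s\<in>{0..T}. dist (f n s) (g s) < d) sequentially"
    by (rule uniform_limitD[OF lim d])
  then show "eventually (\<lambda>n. dist (l2norm (time T) (\<lambda>s. f n s - g s)) 0 < e) sequentially"
  proof eventually_elim
    case (elim n)
    have "l2norm (time T) (\<lambda>s. f n s - g s) \<le> sqrt T * d"
    proof (rule square_integrable_bounded_time(2)[OF T])
      show "(\<lambda>s. f n s - g s) \<in> borel_measurable (time T)"
        by (intro borel_measurable_diff continuous_measurable_time f g)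
      show "norm (f n s - g s) \<le> d" if "s \<in> {0<..<T}" for s
        using elim that by (force simp: dist_norm intro: less_imp_le)
    qed
    also have "\<dots> = e / 2" using T by (simp add: d_def)
    finally show ?case using e by simp
  qed
qed

lemma weakly_convergesI_diff:
  fixes u u' :: "nat \<Rightarrow> 'a \<Rightarrow> 'b::{real_inner, second_countable_topology}"
  assumes w: "square_integrable M w" and u: "\<And>n. square_integrable M (u n)"
    and diff: "\<And>\<phi>. square_integrable M \<phi> \<Longrightarrow> (\<lambda>n. \<integral>z. inner (u n z - w z) (\<phi> z) \<partial>M) \<longlonglongrightarrow> 0"
  shows "weakly_converges M u w"
  unfolding weakly_converges_def
proof (intro conjI allI impI w u)
  fix \<phi> :: "'a \<Rightarrow> 'b" assume \<phi>: "square_integrable M \<phi>"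
  show "(\<lambda>n. \<integral>z. inner (u n z) (\<phi> z) \<partial>M) \<longlonglongrightarrow> (\<integral>z. inner (w z) (\<phi> z) \<partial>M)"
    using diff[OF \<phi>]
    by (simp add: inner_diff_left square_integrable_inner(1)[OF u \<phi>] square_integrable_inner(1)[OF w \<phi>] LIM_zero_iff)
qed

lemma square_integrable_bilinear:
  fixes B :: "'h::{banach, second_countable_topology} \<Rightarrow> 'k::{banach, second_countable_topology} \<Rightarrow> 'm::{banach, second_countable_topology}"
  assumes B: "bounded_bilinear B" and v: "square_integrable (time T) v" and x: "x \<in> borel_measurable (time T)"
    and C: "C \<ge> 0" "\<And>s. s \<in> {0<..<T} \<Longrightarrow> norm (x s) \<le> C"
    and K: "K \<ge> 0" "\<And>u b. norm (B u b) \<le> norm u * norm b * K"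
  shows "square_integrable (time T) (\<lambda>s. B (v s) (x s))"
    "l2norm (time T) (\<lambda>s. B (v s) (x s)) \<le> C * K * l2norm (time T) v"
proof -
  have m: "(\<lambda>s. B (v s) (x s)) \<in> borel_measurable (time T)"
    by (intro bounded_bilinear_measurable[OF B] x square_integrableD(1)[OF v])
  have sq: "square_integrable (time T) (\<lambda>s. (C * K) *\<^sub>R norm (v s))"
    by (intro square_integrable_scaleR_vector square_integrable_norm v)
  have le: "norm (B (v s) (x s)) \<le> (C * K) *\<^sub>R norm (v s)" if "s \<in> {0<..<T}" for s
  proof -
    have "norm (B (v s) (x s)) \<le> norm (v s) * norm (x s) * K" by (rule K)
    also have "\<dots> \<le> norm (v s) * C * K" using that K(1) by (intro mult_right_mono mult_left_mono C) auto
    finally show ?thesis by (simp add: ac_simps)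
  qed
  show "square_integrable (time T) (\<lambda>s. B (v s) (x s))"
    by (rule square_integrable_bound[OF sq m]) (use le in \<open>auto intro!: AE_I2\<close>)
  have "l2norm (time T) (\<lambda>s. B (v s) (x s)) \<le> l2norm (time T) (\<lambda>s. (C * K) *\<^sub>R norm (v s))"
    by (rule l2norm_mono[OF sq m]) (use le C K in \<open>auto intro!: AE_I2 simp: abs_mult\<close>)
  also have "\<dots> = C * K * l2norm (time T) v"
    unfolding l2norm_scaleR using C K by (simp add: l2norm_def)
  finally show "l2norm (time T) (\<lambda>s. B (v s) (x s)) \<le> C * K * l2norm (time T) v" .
qed

text \<open>In \<open>I2\<close>, testing \<open>w n s\<close> directly would use a Riesz
  representative that depends on \<open>s\<close> and whose measurability would have to be argued.
  Finite-rank approximation replaces it by the scalar test functions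
  \<open>\<psi> j\<close>.\<close>

lemma weakly_converges_bilinear:
  fixes B :: "'h::{real_inner, banach, second_countable_topology} \<Rightarrow> 'k::{banach, second_countable_topology} \<Rightarrow> 'm::{real_inner, banach, second_countable_topology}"
  assumes T: "T > 0" and B: "bounded_bilinear B" and approx: "finite_rank_approximable B"
    and weak: "weakly_converges (time T) v_n v" and lim: "uniform_limit {0..T} x_n x sequentially"
    and x_n: "\<And>n. continuous_on {0..T} (x_n n)" and x: "continuous_on {0..T} x"
  shows "weakly_converges (time T) (\<lambda>n s. B (v_n n s) (x_n n s)) (\<lambda>s. B (v s) (x s))"
proof (rule weakly_convergesI_diff)
  obtain K where K: "K > 0" "\<And>u b. norm (B u b) \<le> norm u * norm b * K"
    using bounded_bilinear.pos_bounded[OF B] by blast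
  have v_n: "square_integrable (time T) (v_n n)" and v: "square_integrable (time T) v" for n
    using weak by (auto simp: weakly_converges_def)
  have bd: "\<exists>C\<ge>0. \<forall>s\<in>{0..T}. norm (f s) \<le> C" if "continuous_on {0..T} f" for f :: "real \<Rightarrow> 'k"
  proof -
    have "bounded (f ` {0..T})" using that by (intro compact_imp_bounded compact_continuous_image) auto
    then show ?thesis unfolding bounded_pos by (auto intro: less_imp_le)
  qed
  obtain L where L: "L \<ge> 0" "\<And>s. s \<in> {0..T} \<Longrightarrow> norm (x s) \<le> L" using bd[OF x] by blast
  show "square_integrable (time T) (\<lambda>s. B (v_n n s) (x_n n s))" for n
  proof -
    obtain C where "C \<ge> 0" "\<And>s. s \<in> {0..T} \<Longrightarrow> norm (x_n n s) \<le> C" using bd[OF x_n] by blast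
    then show ?thesis
      using K by (intro square_integrable_bilinear(1)[OF B v_n continuous_measurable_time[OF x_n], of C _ K]) auto
  qed
  have sq_x: "square_integrable (time T) (\<lambda>s. B (u s) (x s))" if "square_integrable (time T) u" for u
    using K L by (intro square_integrable_bilinear(1)[OF B that continuous_measurable_time[OF x], of L K]) auto
  show "square_integrable (time T) (\<lambda>s. B (v s) (x s))" by (rule sq_x[OF v])
  fix \<phi> :: "real \<Rightarrow> 'm" assume \<phi>: "square_integrable (time T) \<phi>"
  obtain C where C: "\<And>n. l2norm (time T) (v_n n) \<le> C" using weakly_converges_bounded[OF weak] by blast
  have C0: "C \<ge> 0" using C[of 0] l2norm_nonneg[of "time T" "v_n 0"] by linarith
  define w where "w n s = v_n n s - v s" for n s
  have w_weak: "weakly_converges (time T) w (\<lambda>_. 0)"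
    unfolding w_def by (rule weakly_converges_diff[OF weak])
  have w: "square_integrable (time T) (w n)" for n using w_weak by (simp add: weakly_converges_def)
  obtain D where D: "\<And>n. l2norm (time T) (w n) \<le> D" using weakly_converges_bounded[OF w_weak] by blast
  have D0: "D \<ge> 0" using D[of 0] l2norm_nonneg[of "time T" "w 0"] by linarith
  define I1 where "I1 n = (\<integral>s. inner (B (v_n n s) (x_n n s - x s)) (\<phi> s) \<partial>time T)" for n
  define I2 where "I2 n = (\<integral>s. inner (B (w n s) (x s)) (\<phi> s) \<partial>time T)" for n
  define p where "p = l2norm (time T) \<phi>"
  have p0: "p \<ge> 0" by (simp add: p_def)
  have diff_meas: "(\<lambda>s. x_n n s - x s) \<in> borel_measurable (time T)" for n
    by (intro borel_measurable_diff continuous_measurable_time x_n x)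
  have sq1: "square_integrable (time T) (\<lambda>s. B (v_n n s) (x_n n s - x s))" for n
  proof -
    obtain C where "C \<ge> 0" "\<And>s. s \<in> {0..T} \<Longrightarrow> norm (x_n n s - x s) \<le> C"
      using bd[OF continuous_on_diff[OF x_n x]] by blast
    then show ?thesis
      using K by (intro square_integrable_bilinear(1)[OF B v_n diff_meas, of C _ K]) auto
  qed
  have I1: "I1 \<longlonglongrightarrow> 0"
  proof (rule tendstoI)
    fix e :: real assume e: "e > 0"
    define d where "d = e / (2 * (K * C * p + 1))"
    have KCp: "K * C * p + 1 > 0" using K C0 p0 by (intro add_nonneg_pos) auto
    have d: "d > 0" unfolding d_def using e KCp by (intro divide_pos_pos) auto
    have "eventually (\<lambda>n. \<forall>s\<in>{0..T}. dist (x_n n s) (x s) < d) sequentially"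
      by (rule uniform_limitD[OF lim d])
    then show "eventually (\<lambda>n. dist (I1 n) 0 < e) sequentially"
    proof eventually_elim
      case (elim n)
      have "\<bar>I1 n\<bar> \<le> l2norm (time T) (\<lambda>s. B (v_n n s) (x_n n s - x s)) * p"
        unfolding I1_def p_def by (rule square_integrable_inner(2)[OF sq1 \<phi>])
      also have "\<dots> \<le> (d * K * C) * p"
      proof (rule mult_right_mono[OF _ p0])
        have "l2norm (time T) (\<lambda>s. B (v_n n s) (x_n n s - x s)) \<le> d * K * l2norm (time T) (v_n n)"
          using elim d K
          by (intro square_integrable_bilinear(2)[OF B v_n diff_meas])
             (force simp: dist_norm intro: less_imp_le)+
        also have "\<dots> \<le> d * K * C" using d K C by (intro mult_left_mono) auto
        finally show "l2norm (time T) (\<lambda>s. B (v_n n s) (x_n n s - x s)) \<le> d * K * C" .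
      qed
      also have "\<dots> \<le> d * (K * C * p + 1)" using d by (simp add: algebra_simps)
      also have "\<dots> = e / 2"
      proof -
        have "e / (2 * z) * z = e / 2" if "z > 0" for z :: real using that by simp
        then show ?thesis unfolding d_def using KCp by blast
      qed
      finally show ?case using e by simp
    qed
  qed
  have I2: "I2 \<longlonglongrightarrow> 0"
  proof (rule tendstoI)
    fix e :: real assume e: "e > 0"
    \<comment> \<open>The finite-rank error \<open>Z\<close> pairs with \<open>\<phi>\<close> to at
      most \<open>\<delta> * (L * D * p)\<close>; the added 1 covers the case that this product is
      0.\<close>
    define \<delta> where "\<delta> = e / (2 * (L * D * p + 1))"
    have LDp: "L * D * p + 1 > 0" using L D0 p0 by (intro add_nonneg_pos) auto
    have \<delta>: "\<delta> > 0" unfolding \<delta>_def using e LDp by (intro divide_pos_pos) auto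
    obtain N and l :: "nat \<Rightarrow> 'h \<Rightarrow> real" and P :: "nat \<Rightarrow> 'k \<Rightarrow> 'm" where
      "(\<forall>j. bounded_linear (l j)) \<and> (\<forall>j. bounded_linear (P j)) \<and>
        (\<forall>u b. norm (B u b - (\<Sum>j<N. l j u *\<^sub>R P j b)) \<le> \<delta> * norm u * norm b)"
      using approx[unfolded finite_rank_approximable_def, rule_format, OF \<delta>] by (elim exE) (rule that)
    then have l: "\<And>j. bounded_linear (l j)" and P: "\<And>j. bounded_linear (P j)"
      and NlP: "\<And>u b. norm (B u b - (\<Sum>j<N. l j u *\<^sub>R P j b)) \<le> \<delta> * norm u * norm b"
      by auto
    have Px: "continuous_on {0..T} (\<lambda>s. P j (x s))" for j
      by (rule continuous_on_compose2[OF linear_continuous_on[OF P] x]) auto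
    define \<psi> where "\<psi> j s = inner (P j (x s)) (\<phi> s)" for j s
    have \<psi>: "square_integrable (time T) (\<psi> j)" for j
    proof -
      have "bounded ((\<lambda>s. P j (x s)) ` {0..T})" by (intro compact_imp_bounded compact_continuous_image Px) auto
      then obtain R where R: "\<And>s. s \<in> {0..T} \<Longrightarrow> norm (P j (x s)) \<le> R" unfolding bounded_iff by blast
      have "square_integrable (time T) (\<lambda>s. R * norm (\<phi> s))"
        by (intro square_integrable_scaleR square_integrable_norm \<phi>)
      then show ?thesis
      proof (rule square_integrable_bound)
        show "\<psi> j \<in> borel_measurable (time T)"
          unfolding \<psi>_def by (intro borel_measurable_inner continuous_measurable_time Px square_integrableD(1)[OF \<phi>])
        show "AE s in time T. norm (\<psi> j s) \<le> R * norm (\<phi> s)"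
        proof (rule AE_I2)
          fix s assume "s \<in> space (time T)"
          then have "norm (P j (x s)) * norm (\<phi> s) \<le> R * norm (\<phi> s)" by (intro mult_right_mono R) auto
          then show "norm (\<psi> j s) \<le> R * norm (\<phi> s)"
            unfolding \<psi>_def real_norm_def using Cauchy_Schwarz_ineq2 order_trans by blast
        qed
      qed
    qed
    have l_sq: "square_integrable (time T) (\<lambda>s. l j (w n s))" for j n
      by (rule square_integrable_functional[OF l w])
    have "(\<lambda>n. \<Sum>j<N. \<integral>s. l j (w n s) * \<psi> j s \<partial>time T) \<longlonglongrightarrow> (\<Sum>j<N. 0)"
      by (intro tendsto_sum weakly_converges_functional[OF w_weak l \<psi>])
    then have "eventually (\<lambda>n. \<bar>\<Sum>j<N. \<integral>s. l j (w n s) * \<psi> j s \<partial>time T\<bar> < e / 2) sequentially"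
      using e by (auto dest!: tendstoD[of _ _ _ "e / 2"])
    then show "eventually (\<lambda>n. dist (I2 n) 0 < e) sequentially"
    proof eventually_elim
      case (elim n)
      define Z where "Z s = B (w n s) (x s) - (\<Sum>j<N. l j (w n s) *\<^sub>R P j (x s))" for s
      have Zm: "Z \<in> borel_measurable (time T)"
        unfolding Z_def
        by (intro borel_measurable_diff borel_measurable_sum borel_measurable_scaleR
            square_integrableD(1)[OF sq_x[OF w]] continuous_measurable_time[OF Px] square_integrableD(1)[OF l_sq])
      have \<delta>L: "square_integrable (time T) (\<lambda>s. (\<delta> * L) *\<^sub>R norm (w n s))"
        by (intro square_integrable_scaleR_vector square_integrable_norm w)
      have Z_le: "norm (Z s) \<le> (\<delta> * L) *\<^sub>R norm (w n s)" if "s \<in> {0<..<T}" for s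
      proof -
        have "norm (Z s) \<le> \<delta> * norm (w n s) * norm (x s)" unfolding Z_def by (rule NlP)
        also have "\<dots> \<le> \<delta> * norm (w n s) * L" using \<delta> that by (intro mult_left_mono L) auto
        finally show ?thesis by (simp add: ac_simps)
      qed
      have Z: "square_integrable (time T) Z"
        by (rule square_integrable_bound[OF \<delta>L Zm]) (use Z_le in \<open>auto intro!: AE_I2\<close>)
      have "l2norm (time T) Z \<le> l2norm (time T) (\<lambda>s. (\<delta> * L) *\<^sub>R norm (w n s))"
        by (rule l2norm_mono[OF \<delta>L Zm]) (use Z_le \<delta> L in \<open>auto intro!: AE_I2 simp: abs_mult\<close>)
      also have "\<dots> = \<delta> * L * l2norm (time T) (w n)"
        unfolding l2norm_scaleR using \<delta> L by (simp add: l2norm_def)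
      also have "\<dots> \<le> \<delta> * L * D" using \<delta> L D by (intro mult_left_mono) auto
      finally have Z_norm: "l2norm (time T) Z \<le> \<delta> * L * D" .
      have "\<bar>\<integral>s. inner (Z s) (\<phi> s) \<partial>time T\<bar> \<le> l2norm (time T) Z * p"
        unfolding p_def by (rule square_integrable_inner(2)[OF Z \<phi>])
      also have "\<dots> \<le> \<delta> * L * D * p" by (rule mult_right_mono[OF Z_norm p0])
      also have "\<dots> \<le> \<delta> * (L * D * p + 1)" using \<delta> by (simp add: algebra_simps)
      also have "\<dots> = e / 2"
      proof -
        have "e / (2 * z) * z = e / 2" if "z > 0" for z :: real using that by simp
        then show ?thesis unfolding \<delta>_def using LDp by blast
      qed
      finally have Z_small: "\<bar>\<integral>s. inner (Z s) (\<phi> s) \<partial>time T\<bar> \<le> e / 2" .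
      have "I2 n = (\<integral>s. inner (Z s) (\<phi> s) + (\<Sum>j<N. l j (w n s) * \<psi> j s) \<partial>time T)"
        unfolding I2_def by (intro Bochner_Integration.integral_cong refl)
          (simp add: Z_def \<psi>_def inner_diff_left inner_sum_left)
      also have "\<dots> = (\<integral>s. inner (Z s) (\<phi> s) \<partial>time T) + (\<Sum>j<N. \<integral>s. l j (w n s) * \<psi> j s \<partial>time T)"
        using square_integrable_mult[OF l_sq \<psi>]
        by (subst Bochner_Integration.integral_add[OF square_integrable_inner(1)[OF Z \<phi>] Bochner_Integration.integrable_sum])
          (simp_all only: Bochner_Integration.integral_sum)
      finally show ?case using elim Z_small by simp
    qed
  qed
  have "(\<lambda>n. I1 n + I2 n) \<longlonglongrightarrow> 0 + 0" by (intro tendsto_add I1 I2)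
  moreover have "I1 n + I2 n = (\<integral>s. inner (B (v_n n s) (x_n n s) - B (v s) (x s)) (\<phi> s) \<partial>time T)" for n
  proof -
    have "I1 n + I2 n = (\<integral>s. inner (B (v_n n s) (x_n n s - x s)) (\<phi> s) + inner (B (w n s) (x s)) (\<phi> s) \<partial>time T)"
      unfolding I1_def I2_def
      by (rule Bochner_Integration.integral_add[symmetric, OF square_integrable_inner(1)[OF sq1 \<phi>]
            square_integrable_inner(1)[OF sq_x[OF w] \<phi>]])
    also have "\<dots> = (\<integral>s. inner (B (v_n n s) (x_n n s) - B (v s) (x s)) (\<phi> s) \<partial>time T)"
      by (intro Bochner_Integration.integral_cong refl)
        (simp add: w_def bounded_bilinear.diff_left[OF B] bounded_bilinear.diff_right[OF B] inner_add_left[symmetric])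
    finally show ?thesis .
  qed
  ultimately show "(\<lambda>n. \<integral>s. inner (B (v_n n s) (x_n n s) - B (v s) (x s)) (\<phi> s) \<partial>time T) \<longlonglongrightarrow> 0" by simp
qed

section \<open>Fields on spacetime\<close>

lemma L2T_dense_sequence: "\<exists>d :: nat \<Rightarrow> L2T. \<forall>u. \<forall>e>0. \<exists>i. norm (u - d i) < e"
proof -
  obtain Q :: "L2T set" where Q: "countable Q" "closure Q = UNIV" using L2T_countable_dense by blast
  then have "Q \<noteq> {}" by auto
  have "\<exists>i. norm (u - from_nat_into Q i) < e" if "e > 0" for u e
  proof -
    have "u \<in> closure Q" using Q by simp
    then obtain y where y: "y \<in> Q" "dist y u < e" using \<open>e > 0\<close> unfolding closure_approachable by blast
    then obtain i where "y = from_nat_into Q i" using from_nat_into_surj[OF Q(1)] by metis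
    then show ?thesis using y by (auto simp: dist_norm norm_minus_commute)
  qed
  then show ?thesis by blast
qed

text \<open>The first index of a dense sequence that comes within distance \<open>e\<close> selects
  a countably valued approximation; it depends on \<open>\<Phi> t\<close> through scalar distances
  only, whence its measurability.\<close>

lemma L2T_measurable_index:
  assumes d: "\<And>u e. e > 0 \<Longrightarrow> \<exists>i. norm (u - d i) < e"
    and meas: "\<And>i::nat. (\<lambda>t. norm (\<Phi> t - d i :: L2T)) \<in> borel_measurable M" and e: "e > 0"
  shows "(\<lambda>t. LEAST i. norm (\<Phi> t - d i) < e) \<in> measurable M (count_space UNIV)"
    and "norm (\<Phi> t - d (LEAST i. norm (\<Phi> t - d i) < e)) < e"
proof -
  show "(\<lambda>t. LEAST i. norm (\<Phi> t - d i) < e) \<in> measurable M (count_space UNIV)"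
  proof -
    note [measurable] = meas
    show ?thesis by measurable
  qed
  show "norm (\<Phi> t - d (LEAST i. norm (\<Phi> t - d i) < e)) < e"
    by (rule LeastI_ex) (rule d[OF e])
qed

text \<open>By separability, measurability can be read off from distances to fixed points: the
  selections from a dense sequence are measurable and converge at rate
  \<open>(1/2) ^ k\<close>.\<close>

lemma L2T_measurableI:
  fixes \<Phi> :: "'a \<Rightarrow> L2T"
  assumes meas: "\<And>c. (\<lambda>t. norm (\<Phi> t - c)) \<in> borel_measurable M"
  shows "\<Phi> \<in> borel_measurable M"
proof -
  obtain d :: "nat \<Rightarrow> L2T" where d: "\<And>u e. e > 0 \<Longrightarrow> \<exists>i. norm (u - d i) < e"
    using L2T_dense_sequence by blast
  define \<Phi>' where "\<Phi>' k t = d (LEAST i. norm (\<Phi> t - d i) < (1/2) ^ k)" for k t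
  show ?thesis
  proof (rule borel_measurable_LIMSEQ_metric)
    show "\<Phi>' k \<in> borel_measurable M" for k
      unfolding \<Phi>'_def
      by (rule measurable_compose[OF L2T_measurable_index(1)[of d \<Phi> M "(1/2) ^ k", OF d meas]]) simp_all
    fix t
    have "norm (\<Phi>' k t - \<Phi> t) \<le> (1/2) ^ k" for k
      unfolding \<Phi>'_def norm_minus_commute[of _ "\<Phi> t"]
      using L2T_measurable_index(2)[of d "\<Phi>" M "(1/2) ^ k" t, OF d meas] by simp
    then have "(\<lambda>k. \<Phi>' k t - \<Phi> t) \<longlonglongrightarrow> 0"
      by (rule Lim_null_comparison[OF always_eventually[OF allI]]) (simp add: LIMSEQ_realpow_zero)
    then show "(\<lambda>k. \<Phi>' k t) \<longlonglongrightarrow> \<Phi> t" by (rule LIM_zero_cancel)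
  qed
qed

text \<open>The geometric rate makes the squared distances summable, so the whole sequence converges
  almost everywhere. Passing to a subsequence would not do, since in its use below the subsequence
  would depend on time.\<close>

lemma L2T_fast_convergence_AE:
  fixes h :: "nat \<Rightarrow> L2T"
  assumes le: "\<And>k. norm (h k - g) < (1/2) ^ k"
  shows "AE x in circle. (\<lambda>k. rep_L2T (h k) x) \<longlonglongrightarrow> rep_L2T g x"
proof -
  have "(\<integral>\<^sup>+x. (\<Sum>k. ennreal ((rep_L2T (h k) x - rep_L2T g x)\<^sup>2)) \<partial>circle) =
      (\<Sum>k. \<integral>\<^sup>+x. ennreal ((rep_L2T (h k) x - rep_L2T g x)\<^sup>2) \<partial>circle)"
    by (intro nn_integral_suminf) measurable
  also have "\<dots> = (\<Sum>k. ennreal ((norm (h k - g))\<^sup>2))"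
    by (intro suminf_cong) (simp add: nn_norm_to_L2T square_integrable_diff to_L2T_diff)
  also have "\<dots> \<le> (\<Sum>k. ennreal ((1/4) ^ k))"
  proof (intro suminf_le ennreal_leI)
    fix k
    have "(norm (h k - g))\<^sup>2 \<le> ((1/2) ^ k)\<^sup>2" by (rule power_mono[OF less_imp_le[OF le]]) simp
    also have "\<dots> = (1/4) ^ k" by (simp add: power2_eq_square power_mult_distrib[symmetric])
    finally show "(norm (h k - g))\<^sup>2 \<le> (1/4) ^ k" .
  qed auto
  also have "\<dots> < \<infinity>" by (subst suminf_ennreal2) (auto intro!: summable_geometric)
  finally have "AE x in circle. (\<Sum>k. ennreal ((rep_L2T (h k) x - rep_L2T g x)\<^sup>2)) \<noteq> \<infinity>"
    by (intro nn_integral_PInf_AE) auto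
  then show ?thesis
  proof eventually_elim
    case (elim x)
    then have "summable (\<lambda>k. (rep_L2T (h k) x - rep_L2T g x)\<^sup>2)"
      by (intro summable_suminf_not_top) auto
    then have "(\<lambda>k. (rep_L2T (h k) x - rep_L2T g x)\<^sup>2) \<longlonglongrightarrow> 0" by (rule summable_LIMSEQ_zero)
    then have "(\<lambda>k. \<bar>rep_L2T (h k) x - rep_L2T g x\<bar>) \<longlonglongrightarrow> 0"
      using tendsto_real_sqrt by fastforce
    then show ?case by (rule LIM_zero_cancel[OF tendsto_rabs_zero_cancel])
  qed
qed

text \<open>Tonelli slice by slice. The integrals are nonnegative ones because the identity is also
  used to prove that \<open>F\<close> is square integrable.\<close>

lemma nn_integral_field:
  assumes F: "F \<in> borel_measurable (spacetime T)"
    and AE: "AE t in time T. AE x in circle. F (t, x) = rep_L2T (u t) x"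
  shows "(\<integral>\<^sup>+z. ennreal ((F z)\<^sup>2) \<partial>spacetime T) = (\<integral>\<^sup>+t. ennreal ((norm (u t))\<^sup>2) \<partial>time T)"
proof -
  interpret C: sigma_finite_measure circle by (rule sigma_finite_circle)
  have "(\<integral>\<^sup>+z. ennreal ((F z)\<^sup>2) \<partial>spacetime T) = (\<integral>\<^sup>+t. \<integral>\<^sup>+x. ennreal ((F (t, x))\<^sup>2) \<partial>circle \<partial>time T)"
    unfolding spacetime_def using F unfolding spacetime_def by (subst C.nn_integral_fst[symmetric]) auto
  also have "\<dots> = (\<integral>\<^sup>+t. ennreal ((norm (u t))\<^sup>2) \<partial>time T)"
  proof (rule nn_integral_cong_AE, use AE in eventually_elim)
    fix t assume "AE x in circle. F (t, x) = rep_L2T (u t) x"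
    then have "(\<integral>\<^sup>+x. ennreal ((F (t, x))\<^sup>2) \<partial>circle) = (\<integral>\<^sup>+x. ennreal ((rep_L2T (u t) x)\<^sup>2) \<partial>circle)"
      by (intro nn_integral_cong_AE) auto
    then show "(\<integral>\<^sup>+x. ennreal ((F (t, x))\<^sup>2) \<partial>circle) = ennreal ((norm (u t))\<^sup>2)"
      by (simp add: nn_norm_to_L2T)
  qed
  finally show ?thesis .
qed

text \<open>The representatives \<open>rep_L2T (u t)\<close> are chosen separately for each
  \<open>t\<close> and need not fit together measurably. Approximation from a dense sequence
  involves only countably many representatives, and joint measurability survives the limit.\<close>

lemma field_of_exists:
  assumes u: "square_integrable (time T) u"
  shows "\<exists>F. field_of T u F"
proof -
  have um: "u \<in> borel_measurable (time T)" by (rule square_integrableD(1)[OF u])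
  obtain d :: "nat \<Rightarrow> L2T" where d: "\<And>u e. e > 0 \<Longrightarrow> \<exists>i. norm (u - d i) < e"
    using L2T_dense_sequence by blast
  have nm: "(\<lambda>t. norm (u t - c)) \<in> borel_measurable (time T)" for c
    by (rule measurable_compose[OF _ borel_measurable_norm]) (intro borel_measurable_diff um, simp)
  define i where "i k t = (LEAST i. norm (u t - d i) < (1/2) ^ k)" for k t
  have i_meas: "i k \<in> measurable (time T) (count_space UNIV)" for k
    unfolding i_def by (rule L2T_measurable_index(1)[OF d nm]) simp_all
  have i_close: "norm (d (i k t) - u t) < (1/2) ^ k" for k t
    unfolding i_def norm_minus_commute[of _ "u t"]
    by (rule L2T_measurable_index(2)[where M = "time T", OF d nm]) simp_all
  \<comment> \<open>Where the sequence diverges \<open>lim\<close> has an unspecified value; at each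
    \<open>t\<close> this concerns a null set of \<open>x\<close> only.\<close>
  define F where "F z = lim (\<lambda>k. rep_L2T (d (i k (fst z))) (snd z))" for z
  have Fm: "F \<in> borel_measurable (spacetime T)"
    unfolding F_def
  proof (rule borel_measurable_lim_metric)
    fix k
    show "(\<lambda>z. rep_L2T (d (i k (fst z))) (snd z)) \<in> borel_measurable (spacetime T)"
      unfolding spacetime_def
    proof (rule measurable_compose_countable[where g="\<lambda>z. i k (fst z)" and f="\<lambda>j z. rep_L2T (d j) (snd z)"])
      show "(\<lambda>z. rep_L2T (d j) (snd z)) \<in> borel_measurable (time T \<Otimes>\<^sub>M circle)" for j
        by (rule measurable_compose[OF measurable_snd rep_L2T_measurable])
      show "(\<lambda>z. i k (fst z)) \<in> measurable (time T \<Otimes>\<^sub>M circle) (count_space UNIV)"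
        by (rule measurable_compose[OF measurable_fst i_meas])
    qed
  qed
  have AE: "AE t in time T. AE x in circle. F (t, x) = rep_L2T (u t) x"
  proof (rule AE_I2)
    fix t
    from L2T_fast_convergence_AE[OF i_close, of t]
    show "AE x in circle. F (t, x) = rep_L2T (u t) x"
      by eventually_elim (simp add: F_def limI)
  qed
  have "(\<integral>\<^sup>+z. ennreal ((F z)\<^sup>2) \<partial>spacetime T) < \<infinity>"
    unfolding nn_integral_field[OF Fm AE]
    using square_integrableD(2)[OF u] by (simp add: integrable_iff_bounded)
  then show ?thesis
    unfolding field_of_def using AE square_integrable_nn[OF Fm] by blast
qed

lemma field_of_diff:
  assumes F: "field_of T u F" and G: "field_of T w G"
  shows "field_of T (\<lambda>t. u t - w t) (\<lambda>z. F z - G z)"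
proof -
  have "AE t in time T. AE x in circle. F (t, x) = rep_L2T (u t) x"
       "AE t in time T. AE x in circle. G (t, x) = rep_L2T (w t) x"
    using F G by (auto simp: field_of_def)
  then have "AE t in time T. AE x in circle. F (t, x) - G (t, x) = rep_L2T (u t - w t) x"
  proof eventually_elim
    case (elim t)
    from elim(1) elim(2) rep_L2T_diff[of "u t" "w t"]
    show ?case by eventually_elim simp
  qed
  then show ?thesis
    using F G square_integrable_diff unfolding field_of_def by blast
qed

text \<open>Curves and fields are identified isometrically. Applied to the difference of two
  magnetic fields, this carries strong convergence from time to spacetime.\<close>

lemma l2norm_field:
  assumes F: "field_of T u F" and u: "square_integrable (time T) u"
  shows "l2norm (spacetime T) F = l2norm (time T) u"
proof -
  have sq: "square_integrable (spacetime T) F"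
    and AE: "AE t in time T. AE x in circle. F (t, x) = rep_L2T (u t) x"
    using F by (auto simp: field_of_def)
  have "ennreal (\<integral>z. (F z)\<^sup>2 \<partial>spacetime T) = (\<integral>\<^sup>+z. ennreal ((F z)\<^sup>2) \<partial>spacetime T)"
    using square_integrableD(2)[OF sq] by (intro nn_integral_eq_integral[symmetric]) auto
  also have "\<dots> = (\<integral>\<^sup>+t. ennreal ((norm (u t))\<^sup>2) \<partial>time T)"
    by (rule nn_integral_field[OF square_integrableD(1)[OF sq] AE])
  also have "\<dots> = ennreal (\<integral>t. (norm (u t))\<^sup>2 \<partial>time T)"
    using square_integrableD(2)[OF u] by (intro nn_integral_eq_integral) auto
  finally have "(\<integral>z. (F z)\<^sup>2 \<partial>spacetime T) = (\<integral>t. (norm (u t))\<^sup>2 \<partial>time T)"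
    by (subst (asm) ennreal_inj) auto
  then show ?thesis by (simp add: l2norm_def)
qed

text \<open>\<open>\<Phi>\<close> is the curve of time slices of \<open>\<phi>\<close>.\<close>
lemma spacetime_curve:
  assumes \<phi>: "square_integrable (spacetime T) \<phi>"
  obtains \<Phi> where "square_integrable (time T) \<Phi>"
    "\<And>u F. square_integrable (time T) u \<Longrightarrow> field_of T u F \<Longrightarrow>
      (\<integral>z. F z * \<phi> z \<partial>spacetime T) = (\<integral>t. inner (u t) (\<Phi> t) \<partial>time T)"
proof -
  interpret C: sigma_finite_measure circle by (rule sigma_finite_circle)
  interpret finite_measure "time T" by simp
  interpret P: pair_sigma_finite "time T" circle ..
  have \<phi>m: "\<phi> \<in> borel_measurable (time T \<Otimes>\<^sub>M circle)"
    using square_integrableD(1)[OF \<phi>] by (simp add: spacetime_def)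
  have slice: "(\<lambda>x. \<phi> (t, x)) \<in> borel_measurable circle" if "t \<in> space (time T)" for t
    by (rule measurable_Pair2[OF \<phi>m that])
  define \<Phi> where "\<Phi> t = to_L2T (\<lambda>x. \<phi> (t, x))" for t
  \<comment> \<open>\<open>q t\<close> may be infinite for a null set of times. There
    \<open>\<Phi> t\<close> is the dummy value 0, which the integrals do not notice.\<close>
  define q where "q t = (\<integral>\<^sup>+x. ennreal ((\<phi> (t, x))\<^sup>2) \<partial>circle)" for t
  have qm: "q \<in> borel_measurable (time T)"
    unfolding q_def using \<phi>m by (intro C.borel_measurable_nn_integral_fst) measurable
  have q_int: "(\<integral>\<^sup>+t. q t \<partial>time T) < \<infinity>"
  proof -
    have "(\<integral>\<^sup>+t. q t \<partial>time T) = (\<integral>\<^sup>+z. ennreal ((\<phi> z)\<^sup>2) \<partial>spacetime T)"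
      unfolding q_def spacetime_def using \<phi>m by (subst C.nn_integral_fst[symmetric]) auto
    also have "\<dots> < \<infinity>" using square_integrableD(2)[OF \<phi>] by (simp add: integrable_iff_bounded)
    finally show ?thesis .
  qed
  have sq: "square_integrable circle (\<lambda>x. \<phi> (t, x)) \<longleftrightarrow> q t < \<infinity>" if t: "t \<in> space (time T)" for t
    using slice[OF t] by (simp add: square_integrable_def integrable_iff_bounded q_def)
  have norm_le: "ennreal ((norm (\<Phi> t))\<^sup>2) \<le> q t" if t: "t \<in> space (time T)" for t
  proof (cases "q t < \<infinity>")
    case True
    then show ?thesis using sq[OF t] by (simp add: \<Phi>_def q_def nn_norm_to_L2T)
  next
    case False then show ?thesis by (simp add: top_unique less_top[symmetric])
  qed
  have \<Phi>m: "\<Phi> \<in> borel_measurable (time T)"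
  proof (rule L2T_measurableI)
    fix c
    \<comment> \<open>Distances to a fixed \<open>c\<close> are parameter integrals, hence
      measurable in \<open>t\<close>; this is the form in which \<open>L2T_measurableI\<close> asks
      for measurability of \<open>\<Phi>\<close>.\<close>
    have "norm (\<Phi> t - c) = (if q t < \<infinity> then sqrt (\<integral>x. (\<phi> (t, x) - rep_L2T c x)\<^sup>2 \<partial>circle) else norm c)"
      if t: "t \<in> space (time T)" for t
    proof (cases "q t < \<infinity>")
      case True
      then have s: "square_integrable circle (\<lambda>x. \<phi> (t, x))" using sq[OF t] by simp
      have "(norm (to_L2T (\<lambda>x. \<phi> (t, x) - rep_L2T c x)))\<^sup>2 = (\<integral>x. (\<phi> (t, x) - rep_L2T c x)\<^sup>2 \<partial>circle)"
        by (rule norm_to_L2T[OF square_integrable_diff[OF s square_integrable_rep]])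
      then have "sqrt (\<integral>x. (\<phi> (t, x) - rep_L2T c x)\<^sup>2 \<partial>circle) = norm (to_L2T (\<lambda>x. \<phi> (t, x) - rep_L2T c x))"
        by (rule real_sqrt_unique) simp
      then show ?thesis using True s by (simp add: \<Phi>_def to_L2T_diff)
    next
      case False
      then have "\<not> square_integrable circle (\<lambda>x. \<phi> (t, x))" using sq[OF t] by simp
      then show ?thesis using False by (simp add: \<Phi>_def to_L2T_def)
    qed
    moreover have "(\<lambda>t. if q t < \<infinity> then sqrt (\<integral>x. (\<phi> (t, x) - rep_L2T c x)\<^sup>2 \<partial>circle) else norm c)
        \<in> borel_measurable (time T)"
    proof (rule measurable_If)
      have "(\<lambda>z. (\<phi> z - rep_L2T c (snd z))\<^sup>2) \<in> borel_measurable (time T \<Otimes>\<^sub>M circle)"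
        by (intro borel_measurable_power borel_measurable_diff \<phi>m measurable_compose[OF measurable_snd rep_L2T_measurable])
      then have "(\<lambda>t. \<integral>x. (\<phi> (t, x) - rep_L2T c x)\<^sup>2 \<partial>circle) \<in> borel_measurable (time T)"
        by (intro C.borel_measurable_lebesgue_integral) (simp add: case_prod_unfold)
      then show "(\<lambda>t. sqrt (\<integral>x. (\<phi> (t, x) - rep_L2T c x)\<^sup>2 \<partial>circle)) \<in> borel_measurable (time T)"
        by (rule measurable_compose[OF _ borel_measurable_sqrt])
      show "{t \<in> space (time T). q t < \<infinity>} \<in> sets (time T)" using qm by measurable
    qed simp
    ultimately show "(\<lambda>t. norm (\<Phi> t - c)) \<in> borel_measurable (time T)"
      by (subst measurable_cong) auto
  qed
  have \<Phi>sq: "square_integrable (time T) \<Phi>"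
    unfolding square_integrable_def integrable_iff_bounded
  proof (intro conjI \<Phi>m)
    show "(\<lambda>t. (norm (\<Phi> t))\<^sup>2) \<in> borel_measurable (time T)" using \<Phi>m by measurable
    have "(\<integral>\<^sup>+t. ennreal (norm ((norm (\<Phi> t))\<^sup>2)) \<partial>time T) \<le> (\<integral>\<^sup>+t. q t \<partial>time T)"
      by (intro nn_integral_mono) (simp add: norm_le[simplified])
    then show "(\<integral>\<^sup>+t. ennreal (norm ((norm (\<Phi> t))\<^sup>2)) \<partial>time T) < \<infinity>" using q_int by simp
  qed
  show thesis
  proof (rule that[OF \<Phi>sq])
    fix u F assume u: "square_integrable (time T) u" and F: "field_of T u F"
    have Fsq: "square_integrable (spacetime T) F" and AE: "AE t in time T. AE x in circle. F (t, x) = rep_L2T (u t) x"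
      using F by (auto simp: field_of_def)
    have int: "integrable (time T \<Otimes>\<^sub>M circle) (\<lambda>z. F z * \<phi> z)"
      using square_integrable_mult[OF Fsq \<phi>] by (simp add: spacetime_def)
    have "(\<integral>z. F z * \<phi> z \<partial>spacetime T) = (\<integral>t. (\<integral>x. F (t, x) * \<phi> (t, x) \<partial>circle) \<partial>time T)"
      unfolding spacetime_def using P.integral_fst'[OF int] by simp
    also have "\<dots> = (\<integral>t. inner (u t) (\<Phi> t) \<partial>time T)"
    proof (rule integral_cong_AE)
      show "(\<lambda>t. \<integral>x. F (t, x) * \<phi> (t, x) \<partial>circle) \<in> borel_measurable (time T)"
        using borel_measurable_integrable[OF int]
        by (intro C.borel_measurable_lebesgue_integral) (simp add: case_prod_unfold)
      show "(\<lambda>t. inner (u t) (\<Phi> t)) \<in> borel_measurable (time T)"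
        by (intro borel_measurable_inner \<Phi>m square_integrableD(1)[OF u])
      have "AE t in time T. q t \<noteq> \<infinity>" by (rule nn_integral_PInf_AE[OF qm]) (use q_int in auto)
      with AE AE_space show "AE t in time T. (\<integral>x. F (t, x) * \<phi> (t, x) \<partial>circle) = inner (u t) (\<Phi> t)"
      proof eventually_elim
        case (elim t)
        have s: "square_integrable circle (\<lambda>x. \<phi> (t, x))"
          using sq elim by (simp add: less_top[symmetric])
        have Fm: "(\<lambda>x. F (t, x)) \<in> borel_measurable circle"
          by (rule measurable_Pair2[OF _ elim(2)]) (use square_integrableD(1)[OF Fsq] in \<open>simp add: spacetime_def\<close>)
        have "(\<integral>x. F (t, x) * \<phi> (t, x) \<partial>circle) = (\<integral>x. rep_L2T (u t) x * \<phi> (t, x) \<partial>circle)"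
          by (rule integral_cong_AE) (use elim(1) Fm slice[OF elim(2)] in auto)
        also have "\<dots> = inner (u t) (\<Phi> t)"
          using inner_to_L2T[OF square_integrable_rep[of "u t"] s] by (simp add: \<Phi>_def)
        finally show ?case .
      qed
    qed
    finally show "(\<integral>z. F z * \<phi> z \<partial>spacetime T) = (\<integral>t. inner (u t) (\<Phi> t) \<partial>time T)" .
  qed
qed

section \<open>Weak and distributional limits on spacetime\<close>

lemma weakly_converges_field:
  assumes weak: "weakly_converges (time T) u_n u"
    and F_n: "\<And>n. field_of T (u_n n) (F_n n)" and F: "field_of T u F"
  shows "weakly_converges (spacetime T) F_n F"
  unfolding weakly_converges_def
proof (intro conjI allI impI)
  show "square_integrable (spacetime T) (F_n n)" for n using F_n[of n] by (simp add: field_of_def)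
  show "square_integrable (spacetime T) F" using F by (simp add: field_of_def)
  have u: "square_integrable (time T) u" "\<And>n. square_integrable (time T) (u_n n)"
    using weak by (auto simp: weakly_converges_def)
  fix \<phi> :: "real \<times> real \<Rightarrow> real" assume "square_integrable (spacetime T) \<phi>"
  then obtain \<Phi> where \<Phi>: "square_integrable (time T) \<Phi>"
    "\<And>u F. square_integrable (time T) u \<Longrightarrow> field_of T u F \<Longrightarrow>
      (\<integral>z. F z * \<phi> z \<partial>spacetime T) = (\<integral>t. inner (u t) (\<Phi> t) \<partial>time T)"
    using spacetime_curve by blast
  show "(\<lambda>n. \<integral>z. inner (F_n n z) (\<phi> z) \<partial>spacetime T) \<longlonglongrightarrow> (\<integral>z. inner (F z) (\<phi> z) \<partial>spacetime T)"
    using weak \<Phi>(1) unfolding weakly_converges_def by (simp add: \<Phi>(2)[OF u(1) F] \<Phi>(2)[OF u(2) F_n])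
qed

lemma spacetime_test_bounded:
  assumes \<phi>: "spacetime_test T \<phi>"
  obtains C where "C \<ge> 0" "\<And>z. z \<in> space (spacetime T) \<Longrightarrow> \<bar>\<phi> z\<bar> \<le> C" "\<phi> \<in> borel_measurable (spacetime T)"
proof -
  have "C_k 0 \<phi>" using \<phi> unfolding spacetime_test_def smooth_def by blast
  then have cont: "continuous_on UNIV \<phi>" by simp
  have "bounded (\<phi> ` ({0..T} \<times> {0..1}))"
    by (intro compact_imp_bounded compact_continuous_image continuous_on_subset[OF cont] compact_Times) auto
  then obtain C where C: "C > 0" "\<And>z. z \<in> {0..T} \<times> {0..1} \<Longrightarrow> \<bar>\<phi> z\<bar> \<le> C" unfolding bounded_pos by auto
  have "(\<lambda>z. (fst z, snd z)) \<in> borel_measurable (spacetime T)"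
  proof (rule borel_measurable_Pair)
    have "(\<lambda>x. x) \<in> borel_measurable (time T)" by (intro measurable_time) simp
    then show "fst \<in> borel_measurable (spacetime T)"
      unfolding spacetime_def using measurable_compose[OF measurable_fst] by blast
    have "(\<lambda>x. x) \<in> borel_measurable circle" unfolding circle_def by (intro measurable_restrict_space1) simp
    then show "snd \<in> borel_measurable (spacetime T)"
      unfolding spacetime_def using measurable_compose[OF measurable_snd] by blast
  qed
  then have "\<phi> \<in> borel_measurable (spacetime T)"
    using borel_measurable_continuous_on[OF cont] by simp
  moreover have "\<bar>\<phi> z\<bar> \<le> C" if "z \<in> space (spacetime T)" for z
    using that by (intro C(2)) (auto simp: spacetime_def space_pair_measure)
  ultimately show thesis using that C(1) by (meson less_imp_le)
qed

text \<open>Boundedness of \<open>\<phi>\<close> puts \<open>B z * \<phi> z\<close> in L^2, so it is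
  an admissible test function for the weak limit of \<open>J_n\<close>. The rest pairs the bounded
  sequence \<open>J_n\<close> with a strongly null factor.\<close>

lemma distr_converges_product:
  assumes weak: "weakly_converges (spacetime T) J_n J"
    and B_n: "\<And>n. square_integrable (spacetime T) (B_n n)" and B: "square_integrable (spacetime T) B"
    and strong: "(\<lambda>n. l2norm (spacetime T) (\<lambda>z. B_n n z - B z)) \<longlonglongrightarrow> 0"
  shows "distr_converges T (\<lambda>n z. J_n n z * B_n n z) (\<lambda>z. J z * B z)"
  unfolding distr_converges_def
proof (intro allI impI)
  fix \<phi> assume "spacetime_test T \<phi>"
  then obtain C where C: "C \<ge> 0" "\<And>z. z \<in> space (spacetime T) \<Longrightarrow> \<bar>\<phi> z\<bar> \<le> C" "\<phi> \<in> borel_measurable (spacetime T)"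
    using spacetime_test_bounded by blast
  have J_n: "square_integrable (spacetime T) (J_n n)" for n using weak by (simp add: weakly_converges_def)
  have scale: "square_integrable (spacetime T) (\<lambda>z. G z * \<phi> z)" "l2norm (spacetime T) (\<lambda>z. G z * \<phi> z) \<le> C * l2norm (spacetime T) G"
    if G: "square_integrable (spacetime T) G" for G
  proof -
    have m: "(\<lambda>z. G z * \<phi> z) \<in> borel_measurable (spacetime T)"
      by (intro borel_measurable_times C square_integrableD(1)[OF G])
    have sq: "square_integrable (spacetime T) (\<lambda>z. C *\<^sub>R norm (G z))"
      by (intro square_integrable_scaleR_vector square_integrable_norm G)
    have le: "norm (G z * \<phi> z) \<le> C *\<^sub>R norm (G z)" if "z \<in> space (spacetime T)" for z
      using mult_left_mono[OF C(2)[OF that], of "\<bar>G z\<bar>"] by (simp add: abs_mult mult.commute)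
    show "square_integrable (spacetime T) (\<lambda>z. G z * \<phi> z)"
      by (rule square_integrable_bound[OF sq m AE_I2[OF le]])
    have "l2norm (spacetime T) (\<lambda>z. G z * \<phi> z) \<le> l2norm (spacetime T) (\<lambda>z. C *\<^sub>R norm (G z))"
      by (rule l2norm_mono[OF sq m AE_I2]) (use le C in \<open>simp add: abs_mult\<close>)
    also have "\<dots> = C * l2norm (spacetime T) G"
      unfolding l2norm_scaleR using C by (simp add: l2norm_def)
    finally show "l2norm (spacetime T) (\<lambda>z. G z * \<phi> z) \<le> C * l2norm (spacetime T) G" .
  qed
  obtain K where K: "\<And>n. l2norm (spacetime T) (J_n n) \<le> K" using weakly_converges_bounded[OF weak] by blast
  have K0: "K \<ge> 0" using K[of 0] l2norm_nonneg[of "spacetime T" "J_n 0"] by linarith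
  have diff: "square_integrable (spacetime T) (\<lambda>z. B_n n z - B z)" for n
    by (rule square_integrable_diff[OF B_n B])
  have "(\<lambda>n. \<integral>z. J_n n z * ((B_n n z - B z) * \<phi> z) \<partial>spacetime T) \<longlonglongrightarrow> 0"
  proof (rule Lim_null_comparison[OF always_eventually[OF allI]])
    fix n
    have "norm (\<integral>z. J_n n z * ((B_n n z - B z) * \<phi> z) \<partial>spacetime T)
        \<le> (\<integral>z. \<bar>J_n n z * ((B_n n z - B z) * \<phi> z)\<bar> \<partial>spacetime T)"
      unfolding real_norm_def by (rule integral_abs_bound)
    also have "\<dots> \<le> l2norm (spacetime T) (J_n n) * l2norm (spacetime T) (\<lambda>z. (B_n n z - B z) * \<phi> z)"
      by (rule integral_mult_le_l2norm[OF J_n scale(1)[OF diff]])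
    also have "\<dots> \<le> K * (C * l2norm (spacetime T) (\<lambda>z. B_n n z - B z))"
      by (intro mult_mono K scale(2)[OF diff] K0) simp
    finally show "norm (\<integral>z. J_n n z * ((B_n n z - B z) * \<phi> z) \<partial>spacetime T)
        \<le> K * (C * l2norm (spacetime T) (\<lambda>z. B_n n z - B z))" .
  next
    have "(\<lambda>n. K * (C * l2norm (spacetime T) (\<lambda>z. B_n n z - B z))) \<longlonglongrightarrow> K * (C * 0)"
      by (intro tendsto_intros strong)
    then show "(\<lambda>n. K * (C * l2norm (spacetime T) (\<lambda>z. B_n n z - B z))) \<longlonglongrightarrow> 0" by simp
  qed
  moreover have "(\<lambda>n. \<integral>z. J_n n z * (B z * \<phi> z) \<partial>spacetime T) \<longlonglongrightarrow> (\<integral>z. J z * (B z * \<phi> z) \<partial>spacetime T)"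
    using weak scale(1)[OF B] unfolding weakly_converges_def by simp
  ultimately have "(\<lambda>n. (\<integral>z. J_n n z * ((B_n n z - B z) * \<phi> z) \<partial>spacetime T) + (\<integral>z. J_n n z * (B z * \<phi> z) \<partial>spacetime T))
      \<longlonglongrightarrow> 0 + (\<integral>z. J z * (B z * \<phi> z) \<partial>spacetime T)"
    by (rule tendsto_add)
  moreover have "(\<integral>z. J_n n z * ((B_n n z - B z) * \<phi> z) \<partial>spacetime T) + (\<integral>z. J_n n z * (B z * \<phi> z) \<partial>spacetime T)
      = (\<integral>z. J_n n z * B_n n z * \<phi> z \<partial>spacetime T)" for n
    using square_integrable_mult[OF J_n scale(1)[OF diff]] square_integrable_mult[OF J_n scale(1)[OF B]]
    by (subst Bochner_Integration.integral_add[symmetric]) (auto simp: algebra_simps)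
  ultimately show "(\<lambda>n. \<integral>z. J_n n z * B_n n z * \<phi> z \<partial>spacetime T) \<longlonglongrightarrow> (\<integral>z. J z * B z * \<phi> z \<partial>spacetime T)"
    by (simp add: mult.assoc)
qed

lemma weakly_converges_ohm_current:
  assumes T: "T > 0" and weak: "weakly_converges (time T) v_n v"
    and E_lim: "uniform_limit {0..T} E_n E sequentially" and b_lim: "uniform_limit {0..T} b_n b sequentially"
    and E_n: "\<And>n. continuous_on {0..T} (E_n n)" and E: "continuous_on {0..T} E"
    and b_n: "\<And>n. continuous_on {0..T} (b_n n)" and b: "continuous_on {0..T} b"
  shows "weakly_converges (time T) (\<lambda>n. ohm_current \<sigma> (v_n n) (E_n n) (b_n n)) (ohm_current \<sigma> v E b)"
proof -
  note cont_sq = continuous_square_integrable_time[OF T]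
  define m_n m where "m_n n s = H1T_mult (v_n n s) (b_n n s)" and "m s = H1T_mult (v s) (b s)" for n s
  have m: "weakly_converges (time T) m_n m"
    unfolding m_n_def m_def
    by (rule weakly_converges_bilinear[OF T bounded_bilinear_H1T_mult finite_rank_approximable_H1T_mult
          weak b_lim b_n b])
  have m_sq: "square_integrable (time T) (m_n n)" "square_integrable (time T) m" for n
    using m by (auto simp: weakly_converges_def)
  \<comment> \<open>The sum is written as a difference with \<open>- m\<close> to match
    \<open>square_integrable_vector_diff\<close>.\<close>
  have ohm: "ohm_current \<sigma> (v_n n) (E_n n) (b_n n) = (\<lambda>s. \<sigma> *\<^sub>R (E_n n s - - m_n n s))"
    "ohm_current \<sigma> v E b = (\<lambda>s. \<sigma> *\<^sub>R (E s - - m s))" for n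
    by (auto simp: ohm_current_def m_n_def m_def H1T_mult_def)
  have neg: "square_integrable (time T) (\<lambda>s. - f s)" if "square_integrable (time T) f" for f :: "real \<Rightarrow> L2T"
    using square_integrable_scaleR_vector[OF that, of "- 1"] by simp
  show ?thesis
  proof (rule weakly_convergesI_diff)
    show "square_integrable (time T) (ohm_current \<sigma> v E b)"
      "square_integrable (time T) (ohm_current \<sigma> (v_n n) (E_n n) (b_n n))" for n
      unfolding ohm by (intro square_integrable_scaleR_vector square_integrable_vector_diff cont_sq E E_n neg m_sq)+
    fix \<phi> :: "real \<Rightarrow> L2T" assume \<phi>: "square_integrable (time T) \<phi>"
    have E_sq: "square_integrable (time T) (\<lambda>s. E_n n s - E s)" for n
      by (intro cont_sq continuous_intros E E_n)
    have m_diff: "square_integrable (time T) (\<lambda>s. m_n n s - m s)" for n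
      by (intro square_integrable_vector_diff m_sq)
    have "(\<lambda>n. \<integral>s. inner (E_n n s - E s) (\<phi> s) \<partial>time T) \<longlonglongrightarrow> 0"
    proof (rule Lim_null_comparison[OF always_eventually[OF allI]])
      show "norm (\<integral>s. inner (E_n n s - E s) (\<phi> s) \<partial>time T) \<le> l2norm (time T) (\<lambda>s. E_n n s - E s) * l2norm (time T) \<phi>" for n
        unfolding real_norm_def by (rule square_integrable_inner(2)[OF E_sq \<phi>])
      have "(\<lambda>n. l2norm (time T) (\<lambda>s. E_n n s - E s) * l2norm (time T) \<phi>) \<longlonglongrightarrow> 0 * l2norm (time T) \<phi>"
        by (intro tendsto_intros uniform_limit_imp_l2norm[OF T E_lim E_n E])
      then show "(\<lambda>n. l2norm (time T) (\<lambda>s. E_n n s - E s) * l2norm (time T) \<phi>) \<longlonglongrightarrow> 0" by simp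
    qed
    moreover have "(\<lambda>n. \<integral>s. inner (m_n n s - m s) (\<phi> s) \<partial>time T) \<longlonglongrightarrow> 0"
      using weakly_converges_diff[OF m] \<phi> unfolding weakly_converges_def by simp
    ultimately have "(\<lambda>n. \<sigma> * ((\<integral>s. inner (E_n n s - E s) (\<phi> s) \<partial>time T) + (\<integral>s. inner (m_n n s - m s) (\<phi> s) \<partial>time T)))
        \<longlonglongrightarrow> \<sigma> * (0 + 0)"
      by (intro tendsto_intros)
    moreover have "\<sigma> * ((\<integral>s. inner (E_n n s - E s) (\<phi> s) \<partial>time T) + (\<integral>s. inner (m_n n s - m s) (\<phi> s) \<partial>time T))
        = (\<integral>s. inner (ohm_current \<sigma> (v_n n) (E_n n) (b_n n) s - ohm_current \<sigma> v E b s) (\<phi> s) \<partial>time T)" for n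
    proof -
      have "\<sigma> * ((\<integral>s. inner (E_n n s - E s) (\<phi> s) \<partial>time T) + (\<integral>s. inner (m_n n s - m s) (\<phi> s) \<partial>time T))
          = (\<integral>s. \<sigma> * (inner (E_n n s - E s) (\<phi> s) + inner (m_n n s - m s) (\<phi> s)) \<partial>time T)"
        by (simp only: integral_mult_right_zero Bochner_Integration.integral_add[OF square_integrable_inner(1)[OF E_sq \<phi>]
              square_integrable_inner(1)[OF m_diff \<phi>]])
      also have "\<dots> = (\<integral>s. inner (ohm_current \<sigma> (v_n n) (E_n n) (b_n n) s - ohm_current \<sigma> v E b s) (\<phi> s) \<partial>time T)"
        unfolding ohm by (intro Bochner_Integration.integral_cong refl)
          (simp add: inner_diff_left inner_add_left algebra_simps)
      finally show ?thesis .
    qed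
    ultimately show "(\<lambda>n. \<integral>s. inner (ohm_current \<sigma> (v_n n) (E_n n) (b_n n) s - ohm_current \<sigma> v E b s) (\<phi> s) \<partial>time T) \<longlonglongrightarrow> 0"
      by simp
  qed
qed

text \<open>\<open>field_of\<close> determines a representative up to null sets, so asserting that
  suitable ones exist loses nothing: both limits then hold for any choice. Convergence in C([0,T];
  L^2) is the uniform limit, the continuity of the members being part of
  \<open>energy_solution\<close>.\<close>

theorem theorem1p1:
  fixes T \<epsilon> \<sigma> :: real
    and v :: "real \<Rightarrow> H1T" and v_n :: "nat \<Rightarrow> real \<Rightarrow> H1T"
    and E0 b0 :: L2T and E0_n b0_n :: "nat \<Rightarrow> L2T"
    and E b :: "real \<Rightarrow> L2T" and E_n b_n :: "nat \<Rightarrow> real \<Rightarrow> L2T"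
  assumes "T > 0" and "\<epsilon> > 0" and "\<sigma> > 0"
    and "weakly_converges (time T) v_n v"
    and "(\<lambda>n. (E0_n n, b0_n n)) \<longlonglongrightarrow> (E0, b0)"
    and "\<And>n. energy_solution \<epsilon> \<sigma> T (v_n n) (E0_n n, b0_n n) (\<lambda>t. (E_n n t, b_n n t))"
    and "energy_solution \<epsilon> \<sigma> T v (E0, b0) (\<lambda>t. (E t, b t))"
  shows "uniform_limit {0..T} (\<lambda>n t. (E_n n t, b_n n t)) (\<lambda>t. (E t, b t)) sequentially \<and>
    (\<exists>J_n J B_n B.
       (\<forall>n. field_of T (ohm_current \<sigma> (v_n n) (E_n n) (b_n n)) (J_n n)) \<and>
       field_of T (ohm_current \<sigma> v E b) J \<and>
       (\<forall>n. field_of T (b_n n) (B_n n)) \<and>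
       field_of T b B \<and>
       weakly_converges (spacetime T) J_n J \<and>
       distr_converges T (\<lambda>n z. J_n n z * B_n n z) (\<lambda>z. J z * B z))"
proof -
  note T = assms(1) and weak = assms(4)
  have lim: "uniform_limit {0..T} (\<lambda>n t. (E_n n t, b_n n t)) (\<lambda>t. (E t, b t)) sequentially"
    by (rule energy_solution_weak_to_strong[OF T weak assms(5-7)])
  have cont: "continuous_on {0..T} (\<lambda>t. (E t, b t))" and cont_n: "\<And>n. continuous_on {0..T} (\<lambda>t. (E_n n t, b_n n t))"
    using assms(6,7) by (auto simp: energy_solution_def)
  have E: "continuous_on {0..T} E" and b: "continuous_on {0..T} b"
    using continuous_on_fst[OF cont] continuous_on_snd[OF cont] by simp_all
  have E_n: "continuous_on {0..T} (E_n n)" and b_n: "continuous_on {0..T} (b_n n)" for n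
    using continuous_on_fst[OF cont_n] continuous_on_snd[OF cont_n] by simp_all
  have E_lim: "uniform_limit {0..T} E_n E sequentially" and b_lim: "uniform_limit {0..T} b_n b sequentially"
    using bounded_linear.uniform_limit[OF bounded_linear_fst lim] bounded_linear.uniform_limit[OF bounded_linear_snd lim]
    by simp_all
  note current = weakly_converges_ohm_current[OF T weak E_lim b_lim E_n E b_n b, of \<sigma>]
  note cont_sq = continuous_square_integrable_time[OF T]
  have "\<exists>F. field_of T (ohm_current \<sigma> (v_n n) (E_n n) (b_n n)) F" for n
    using current by (intro field_of_exists) (simp add: weakly_converges_def)
  then obtain J_n where J_n: "\<And>n. field_of T (ohm_current \<sigma> (v_n n) (E_n n) (b_n n)) (J_n n)" by metis
  obtain J where J: "field_of T (ohm_current \<sigma> v E b) J"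
    using field_of_exists[of T "ohm_current \<sigma> v E b"] current by (auto simp: weakly_converges_def)
  obtain B_n where B_n: "\<And>n. field_of T (b_n n) (B_n n)" using field_of_exists[OF cont_sq[OF b_n]] by metis
  obtain B where B: "field_of T b B" using field_of_exists[OF cont_sq[OF b]] by blast
  have J_weak: "weakly_converges (spacetime T) J_n J" by (rule weakly_converges_field[OF current J_n J])
  have "distr_converges T (\<lambda>n z. J_n n z * B_n n z) (\<lambda>z. J z * B z)"
  proof (rule distr_converges_product[OF J_weak])
    show "square_integrable (spacetime T) (B_n n)" for n using B_n[of n] by (simp add: field_of_def)
    show "square_integrable (spacetime T) B" using B by (simp add: field_of_def)
    have "l2norm (spacetime T) (\<lambda>z. B_n n z - B z) = l2norm (time T) (\<lambda>s. b_n n s - b s)" for n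
      by (rule l2norm_field[OF field_of_diff[OF B_n B] cont_sq[OF continuous_on_diff[OF b_n b]]])
    then show "(\<lambda>n. l2norm (spacetime T) (\<lambda>z. B_n n z - B z)) \<longlonglongrightarrow> 0"
      using uniform_limit_imp_l2norm[OF T b_lim b_n b] by simp
  qed
  with lim J_n J B_n B J_weak show ?thesis by blast
qed

end
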